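(* Let $\mathcal{C}$ be an additive category with an automorphism $\Sigma$, let $n\ge3$, and let $\mathscr{N}$ be a collection of $n$-$\Sigma$-sequences in $\mathcal{C}$. The following are equivalent: (1) $\mathscr{N}$ satisfies (N1), (N2) and (N3); (2) $\mathscr{N}$ satisfies (N1* ), (N2) and (N3); (3) $\mathscr{N}$ satisfies (N1* ), (N2* ) and (N3).
   Context: $\mathcal{C}$ is an additive category, $\Sigma\colon\mathcal{C}\to\mathcal{C}$ an automorphism, $n\ge3$. An $n$-$\Sigma$-sequence $A_\bullet$ is a diagram $A_1\xrightarrow{\alpha_1}A_2\to\cdots\xrightarrow{\alpha_{n-1}}A_n\xrightarrow{\alpha_n}\Sigma A_1$. It is exact if for every object $B$ the doubly infinite sequence of abelian groups $\cdots\to\mathrm{Hom}(B,\Sigma^iA_1)\xrightarrow{(\Sigma^i\alpha_1)_*}\mathrm{Hom}(B,\Sigma^iA_2)\to\cdots\xrightarrow{(\Sigma^i\alpha_n)_*}\mathrm{Hom}(B,\Sigma^{i+1}A_1)\to\cdots$ ($i\in\mathbb{Z}$) is exact. The left rotation of $A_\bullet$ is $A_2\xrightarrow{\alpha_2}\cdots\xrightarrow{\alpha_n}\Sigma A_1\xrightarrow{(-1)^n\Sigma\alpha_1}\Sigma A_2$. A morphism $(\varphi_1,\dots,\varphi_n)\colon A_\bullet\to B_\bullet$ consists of $\varphi_i\colon A_i\to B_i$ with $\varphi_{i+1}\alpha_i=\beta_i\varphi_i$ ($1\le i\le n-1$) and $\Sigma\varphi_1\circ\alpha_n=\beta_n\varphi_n$;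 it is an isomorphism if all $\varphi_i$ are isomorphisms, and a weak isomorphism if $\varphi_i$ and $\varphi_{i+1}$ are isomorphisms for some $1\le i\le n$ (with $\varphi_{n+1}:=\Sigma\varphi_1$). Direct sums of $n$-$\Sigma$-sequences are termwise; $A_\bullet$ is a direct summand of $B_\bullet$ if there are morphisms $\varphi\colon A_\bullet\to B_\bullet$, $\psi\colon B_\bullet\to A_\bullet$ with $\psi_i\varphi_i=1_{A_i}$ for all $i$. Axioms for a collection $\mathscr{N}$: (N1): (a) $\mathscr{N}$ is closed under direct sums, direct summands and isomorphisms; (b) for all objects $A$, the trivial sequence $A\xrightarrow{1}A\to0\to\cdots\to0\to\Sigma A$ is in $\mathscr{N}$; (c) every morphism $\alpha\colon A_1\to A_2$ is the first morphism of some sequence in $\mathscr{N}$. (N1* ): (a) if $A_\bullet\to B_\bullet$ is a weak isomorphism of exact $n$-$\Sigma$-sequences with $A_\bullet\in\mathscr{N}$, then $B_\bullet\in\mathscr{N}$; (b) and (c) as in (N1). (N2): an $n$-$\Sigma$-sequence is in $\mathscr{N}$ if and only if its left rotation is in $\mathscr{N}$. (N2* ): the left rotation of every sequence in $\mathscr{N}$ is in $\mathscr{N}$. (N3): given $A_\bullet,B_\bullet\in\mathscr{N}$ and $\varphi_1\colon A_1\to B_1$, $\varphi_2\colon A_2\to B_2$ with $\varphi_2\alpha_1=\beta_1\varphi_1$, there exist $\varphi_3,\dots,\varphi_n$ making $(\varphi_1,\dots,\varphi_n)$ a morphism of $n$-$\Sigma$-sequences. *)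

theory Defs
  imports Main
begin

text \<open>A category is given by a set of objects, a set of morphisms with domain and
codomain maps, composition (ccomp g f = g o f), identities, and for the additive
structure: addition of parallel morphisms, zero morphisms and negation.\<close>

record ('o, 'm) addcat =
  cOb   :: "'o set"
  cMor  :: "'m set"
  cdom  :: "'m \<Rightarrow> 'o"
  ccod  :: "'m \<Rightarrow> 'o"
  ccomp :: "'m \<Rightarrow> 'm \<Rightarrow> 'm"
  cid   :: "'o \<Rightarrow> 'm"
  cadd  :: "'m \<Rightarrow> 'm \<Rightarrow> 'm"
  czero :: "'o \<Rightarrow> 'o \<Rightarrow> 'm"
  cneg  :: "'m \<Rightarrow> 'm"

definition Hom :: "('o, 'm) addcat \<Rightarrow> 'o \<Rightarrow> 'o \<Rightarrow> 'm set" where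
  "Hom C A B = {f \<in> cMor C. cdom C f = A \<and> ccod C f = B}"

definition is_category :: "('o, 'm) addcat \<Rightarrow> bool" where
  "is_category C \<longleftrightarrow>
     (\<forall>f \<in> cMor C. cdom C f \<in> cOb C \<and> ccod C f \<in> cOb C) \<and>
     (\<forall>A \<in> cOb C. cid C A \<in> Hom C A A) \<and>
     (\<forall>A B D f g. f \<in> Hom C A B \<longrightarrow> g \<in> Hom C B D \<longrightarrow> ccomp C g f \<in> Hom C A D) \<and>
     (\<forall>A B f. f \<in> Hom C A B \<longrightarrow> ccomp C (cid C B) f = f \<and> ccomp C f (cid C A) = f) \<and>
     (\<forall>A B D E f g h. f \<in> Hom C A B \<longrightarrow> g \<in> Hom C B D \<longrightarrow> h \<in> Hom C D E \<longrightarrow>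
        ccomp C h (ccomp C g f) = ccomp C (ccomp C h g) f)"

definition is_preadditive :: "('o, 'm) addcat \<Rightarrow> bool" where
  "is_preadditive C \<longleftrightarrow> is_category C \<and>
     (\<forall>A \<in> cOb C. \<forall>B \<in> cOb C. czero C A B \<in> Hom C A B) \<and>
     (\<forall>A B f g. f \<in> Hom C A B \<longrightarrow> g \<in> Hom C A B \<longrightarrow>
        cadd C f g \<in> Hom C A B \<and> cadd C f g = cadd C g f) \<and>
     (\<forall>A B f. f \<in> Hom C A B \<longrightarrow> cneg C f \<in> Hom C A B \<and>
        cadd C f (cneg C f) = czero C A B \<and> cadd C f (czero C A B) = f) \<and>
     (\<forall>A B f g h. f \<in> Hom C A B \<longrightarrow> g \<in> Hom C A B \<longrightarrow> h \<in> Hom C A B \<longrightarrow>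
        cadd C (cadd C f g) h = cadd C f (cadd C g h)) \<and>
     (\<forall>A B D f g h. f \<in> Hom C A B \<longrightarrow> g \<in> Hom C A B \<longrightarrow> h \<in> Hom C B D \<longrightarrow>
        ccomp C h (cadd C f g) = cadd C (ccomp C h f) (ccomp C h g)) \<and>
     (\<forall>A B D f g k. f \<in> Hom C B D \<longrightarrow> g \<in> Hom C B D \<longrightarrow> k \<in> Hom C A B \<longrightarrow>
        ccomp C (cadd C f g) k = cadd C (ccomp C f k) (ccomp C g k))"

definition is_zero_object :: "('o, 'm) addcat \<Rightarrow> 'o \<Rightarrow> bool" where
  "is_zero_object C Z \<longleftrightarrow> Z \<in> cOb C \<and> cid C Z = czero C Z Z"

definition is_biproduct ::
  "('o, 'm) addcat \<Rightarrow> 'o \<Rightarrow> 'o \<Rightarrow> 'o \<Rightarrow> 'm \<Rightarrow> 'm \<Rightarrow> 'm \<Rightarrow> 'm \<Rightarrow> bool" where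
  "is_biproduct C A B S i1 i2 p1 p2 \<longleftrightarrow>
     S \<in> cOb C \<and> i1 \<in> Hom C A S \<and> i2 \<in> Hom C B S \<and> p1 \<in> Hom C S A \<and> p2 \<in> Hom C S B \<and>
     ccomp C p1 i1 = cid C A \<and> ccomp C p2 i2 = cid C B \<and>
     cadd C (ccomp C i1 p1) (ccomp C i2 p2) = cid C S"

definition is_additive_category :: "('o, 'm) addcat \<Rightarrow> bool" where
  "is_additive_category C \<longleftrightarrow> is_preadditive C \<and>
     (\<exists>Z. is_zero_object C Z) \<and>
     (\<forall>A \<in> cOb C. \<forall>B \<in> cOb C. \<exists>S i1 i2 p1 p2. is_biproduct C A B S i1 i2 p1 p2)"

definition is_automorphism ::
  "('o, 'm) addcat \<Rightarrow> ('o \<Rightarrow> 'o) \<Rightarrow> ('m \<Rightarrow> 'm) \<Rightarrow> bool" where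
  "is_automorphism C SO SM \<longleftrightarrow>
     (\<forall>A B f. f \<in> Hom C A B \<longrightarrow> SM f \<in> Hom C (SO A) (SO B)) \<and>
     (\<forall>A \<in> cOb C. SM (cid C A) = cid C (SO A)) \<and>
     (\<forall>A B D f g. f \<in> Hom C A B \<longrightarrow> g \<in> Hom C B D \<longrightarrow>
        SM (ccomp C g f) = ccomp C (SM g) (SM f)) \<and>
     (\<forall>A B f g. f \<in> Hom C A B \<longrightarrow> g \<in> Hom C A B \<longrightarrow>
        SM (cadd C f g) = cadd C (SM f) (SM g)) \<and>
     bij_betw SO (cOb C) (cOb C) \<and>
     (\<forall>A \<in> cOb C. \<forall>B \<in> cOb C. bij_betw SM (Hom C A B) (Hom C (SO A) (SO B)))"

definition spow_obj :: "('o, 'm) addcat \<Rightarrow> ('o \<Rightarrow> 'o) \<Rightarrow> int \<Rightarrow> 'o \<Rightarrow> 'o" where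
  "spow_obj C SO i = (if 0 \<le> i then SO ^^ nat i else (inv_into (cOb C) SO) ^^ nat (- i))"

definition spow_mor :: "('o, 'm) addcat \<Rightarrow> ('m \<Rightarrow> 'm) \<Rightarrow> int \<Rightarrow> 'm \<Rightarrow> 'm" where
  "spow_mor C SM i = (if 0 \<le> i then SM ^^ nat i else (inv_into (cMor C) SM) ^^ nat (- i))"

text \<open>An n-\<Sigma>-sequence is a pair (As, als) of lists of length n, 0-indexed:
As!j = A_(j+1), als!j = alpha_(j+1).\<close>

type_synonym ('o, 'm) nseq = "'o list \<times> 'm list"

definition is_nseq ::
  "('o, 'm) addcat \<Rightarrow> ('o \<Rightarrow> 'o) \<Rightarrow> nat \<Rightarrow> ('o, 'm) nseq \<Rightarrow> bool" where
  "is_nseq C SO n X \<longleftrightarrow> (case X of (As, als) \<Rightarrow>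
     length As = n \<and> length als = n \<and> 0 < n \<and>
     (\<forall>j < n. As ! j \<in> cOb C) \<and>
     (\<forall>j. j + 1 < n \<longrightarrow> als ! j \<in> Hom C (As ! j) (As ! (j + 1))) \<and>
     als ! (n - 1) \<in> Hom C (As ! (n - 1)) (SO (As ! 0)))"

text \<open>The doubly infinite unrolled sequence: position k = i*n + j carries the object
\<Sigma>^i A_(j+1) and the map \<Sigma>^i alpha_(j+1).\<close>

definition unr_obj ::
  "('o, 'm) addcat \<Rightarrow> ('o \<Rightarrow> 'o) \<Rightarrow> nat \<Rightarrow> ('o, 'm) nseq \<Rightarrow> int \<Rightarrow> 'o" where
  "unr_obj C SO n X k = spow_obj C SO (k div int n) (fst X ! nat (k mod int n))"

definition unr_mor ::
  "('o, 'm) addcat \<Rightarrow> ('m \<Rightarrow> 'm) \<Rightarrow> nat \<Rightarrow> ('o, 'm) nseq \<Rightarrow> int \<Rightarrow> 'm" where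
  "unr_mor C SM n X k = spow_mor C SM (k div int n) (snd X ! nat (k mod int n))"

definition is_exact ::
  "('o, 'm) addcat \<Rightarrow> ('o \<Rightarrow> 'o) \<Rightarrow> ('m \<Rightarrow> 'm) \<Rightarrow> nat \<Rightarrow> ('o, 'm) nseq \<Rightarrow> bool" where
  "is_exact C SO SM n X \<longleftrightarrow>
     (\<forall>B \<in> cOb C. \<forall>k :: int.
        (\<forall>g \<in> Hom C B (unr_obj C SO n X k).
           ccomp C (unr_mor C SM n X (k + 1)) (ccomp C (unr_mor C SM n X k) g)
             = czero C B (unr_obj C SO n X (k + 2))) \<and>
        (\<forall>h \<in> Hom C B (unr_obj C SO n X (k + 1)).
           ccomp C (unr_mor C SM n X (k + 1)) h = czero C B (unr_obj C SO n X (k + 2)) \<longrightarrow>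
           (\<exists>g \<in> Hom C B (unr_obj C SO n X k). ccomp C (unr_mor C SM n X k) g = h)))"

definition left_rot ::
  "('o, 'm) addcat \<Rightarrow> ('o \<Rightarrow> 'o) \<Rightarrow> ('m \<Rightarrow> 'm) \<Rightarrow> nat \<Rightarrow> ('o, 'm) nseq \<Rightarrow> ('o, 'm) nseq" where
  "left_rot C SO SM n X = (case X of (As, als) \<Rightarrow>
     (tl As @ [SO (As ! 0)],
      tl als @ [if even n then SM (als ! 0) else cneg C (SM (als ! 0))]))"

definition is_nseq_mor ::
  "('o, 'm) addcat \<Rightarrow> ('o \<Rightarrow> 'o) \<Rightarrow> ('m \<Rightarrow> 'm) \<Rightarrow> nat \<Rightarrow>
   ('o, 'm) nseq \<Rightarrow> ('o, 'm) nseq \<Rightarrow> 'm list \<Rightarrow> bool" where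
  "is_nseq_mor C SO SM n X Y phi \<longleftrightarrow> length phi = n \<and>
     (\<forall>j < n. phi ! j \<in> Hom C (fst X ! j) (fst Y ! j)) \<and>
     (\<forall>j. j + 1 < n \<longrightarrow>
        ccomp C (phi ! (j + 1)) (snd X ! j) = ccomp C (snd Y ! j) (phi ! j)) \<and>
     ccomp C (SM (phi ! 0)) (snd X ! (n - 1)) = ccomp C (snd Y ! (n - 1)) (phi ! (n - 1))"

definition is_iso :: "('o, 'm) addcat \<Rightarrow> 'm \<Rightarrow> bool" where
  "is_iso C f \<longleftrightarrow> f \<in> cMor C \<and>
     (\<exists>g \<in> Hom C (ccod C f) (cdom C f).
        ccomp C g f = cid C (cdom C f) \<and> ccomp C f g = cid C (ccod C f))"

definition is_nseq_iso ::
  "('o, 'm) addcat \<Rightarrow> ('o \<Rightarrow> 'o) \<Rightarrow> ('m \<Rightarrow> 'm) \<Rightarrow> nat \<Rightarrow>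
   ('o, 'm) nseq \<Rightarrow> ('o, 'm) nseq \<Rightarrow> 'm list \<Rightarrow> bool" where
  "is_nseq_iso C SO SM n X Y phi \<longleftrightarrow> is_nseq_mor C SO SM n X Y phi \<and>
     (\<forall>j < n. is_iso C (phi ! j))"

text \<open>Weak isomorphism: phi_i and phi_(i+1) are isos for some i (phi_(n+1) := \<Sigma> phi_1).\<close>

definition is_nseq_weak_iso ::
  "('o, 'm) addcat \<Rightarrow> ('o \<Rightarrow> 'o) \<Rightarrow> ('m \<Rightarrow> 'm) \<Rightarrow> nat \<Rightarrow>
   ('o, 'm) nseq \<Rightarrow> ('o, 'm) nseq \<Rightarrow> 'm list \<Rightarrow> bool" where
  "is_nseq_weak_iso C SO SM n X Y phi \<longleftrightarrow> is_nseq_mor C SO SM n X Y phi \<and>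
     (\<exists>j < n. is_iso C (phi ! j) \<and>
        is_iso C (if j + 1 < n then phi ! (j + 1) else SM (phi ! 0)))"

definition is_nseq_dsum ::
  "('o, 'm) addcat \<Rightarrow> ('o \<Rightarrow> 'o) \<Rightarrow> ('m \<Rightarrow> 'm) \<Rightarrow> nat \<Rightarrow>
   ('o, 'm) nseq \<Rightarrow> ('o, 'm) nseq \<Rightarrow> ('o, 'm) nseq \<Rightarrow> bool" where
  "is_nseq_dsum C SO SM n X Y S \<longleftrightarrow>
     length (fst S) = n \<and> length (snd S) = n \<and>
     (\<exists>i1 i2 p1 p2. length i1 = n \<and> length i2 = n \<and> length p1 = n \<and> length p2 = n \<and>
        (\<forall>j < n. is_biproduct C (fst X ! j) (fst Y ! j) (fst S ! j)
                    (i1 ! j) (i2 ! j) (p1 ! j) (p2 ! j)) \<and>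
        (\<forall>j. j + 1 < n \<longrightarrow> snd S ! j =
           cadd C (ccomp C (i1 ! (j + 1)) (ccomp C (snd X ! j) (p1 ! j)))
                  (ccomp C (i2 ! (j + 1)) (ccomp C (snd Y ! j) (p2 ! j)))) \<and>
        snd S ! (n - 1) =
           cadd C (ccomp C (SM (i1 ! 0)) (ccomp C (snd X ! (n - 1)) (p1 ! (n - 1))))
                  (ccomp C (SM (i2 ! 0)) (ccomp C (snd Y ! (n - 1)) (p2 ! (n - 1)))))"

definition is_nseq_summand ::
  "('o, 'm) addcat \<Rightarrow> ('o \<Rightarrow> 'o) \<Rightarrow> ('m \<Rightarrow> 'm) \<Rightarrow> nat \<Rightarrow>
   ('o, 'm) nseq \<Rightarrow> ('o, 'm) nseq \<Rightarrow> bool" where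
  "is_nseq_summand C SO SM n X Y \<longleftrightarrow>
     (\<exists>phi psi. is_nseq_mor C SO SM n X Y phi \<and> is_nseq_mor C SO SM n Y X psi \<and>
        (\<forall>j < n. ccomp C (psi ! j) (phi ! j) = cid C (fst X ! j)))"

definition triv_nseq ::
  "('o, 'm) addcat \<Rightarrow> ('o \<Rightarrow> 'o) \<Rightarrow> nat \<Rightarrow> 'o \<Rightarrow> 'o \<Rightarrow> ('o, 'm) nseq" where
  "triv_nseq C SO n Z A =
     ([A, A] @ replicate (n - 2) Z,
      [cid C A, czero C A Z] @ replicate (n - 3) (czero C Z Z) @ [czero C Z (SO A)])"

definition N1a where
  "N1a C SO SM n N \<longleftrightarrow>
     (\<forall>X \<in> N. \<forall>Y \<in> N. \<forall>S. is_nseq_dsum C SO SM n X Y S \<longrightarrow> S \<in> N) \<and>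
     (\<forall>X Y. is_nseq C SO n X \<longrightarrow> Y \<in> N \<longrightarrow> is_nseq_summand C SO SM n X Y \<longrightarrow> X \<in> N) \<and>
     (\<forall>X Y phi. is_nseq C SO n X \<longrightarrow> Y \<in> N \<longrightarrow> is_nseq_iso C SO SM n X Y phi \<longrightarrow> X \<in> N)"

definition N1b where
  "N1b C SO n N \<longleftrightarrow>
     (\<forall>A \<in> cOb C. \<forall>Z. is_zero_object C Z \<longrightarrow> triv_nseq C SO n Z A \<in> N)"

definition N1c where
  "N1c C n N \<longleftrightarrow>
     (\<forall>A1 A2 f. f \<in> Hom C A1 A2 \<longrightarrow> A1 \<in> cOb C \<longrightarrow> A2 \<in> cOb C \<longrightarrow>
        (\<exists>X \<in> N. fst X ! 0 = A1 \<and> fst X ! 1 = A2 \<and> snd X ! 0 = f))"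

definition N1 where
  "N1 C SO SM n N \<longleftrightarrow> N1a C SO SM n N \<and> N1b C SO n N \<and> N1c C n N"

definition N1star where
  "N1star C SO SM n N \<longleftrightarrow>
     (\<forall>X Y phi. is_nseq C SO n X \<longrightarrow> is_nseq C SO n Y \<longrightarrow>
        is_exact C SO SM n X \<longrightarrow> is_exact C SO SM n Y \<longrightarrow>
        is_nseq_weak_iso C SO SM n X Y phi \<longrightarrow> X \<in> N \<longrightarrow> Y \<in> N) \<and>
     N1b C SO n N \<and> N1c C n N"

definition N2 where
  "N2 C SO SM n N \<longleftrightarrow>
     (\<forall>X. is_nseq C SO n X \<longrightarrow> (X \<in> N \<longleftrightarrow> left_rot C SO SM n X \<in> N))"

definition N2star where
  "N2star C SO SM n N \<longleftrightarrow> (\<forall>X \<in> N. left_rot C SO SM n X \<in> N)"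

definition N3 where
  "N3 C SO SM n N \<longleftrightarrow>
     (\<forall>X \<in> N. \<forall>Y \<in> N. \<forall>f0 f1.
        f0 \<in> Hom C (fst X ! 0) (fst Y ! 0) \<longrightarrow> f1 \<in> Hom C (fst X ! 1) (fst Y ! 1) \<longrightarrow>
        ccomp C f1 (snd X ! 0) = ccomp C (snd Y ! 0) f0 \<longrightarrow>
        (\<exists>phi. is_nseq_mor C SO SM n X Y phi \<and> phi ! 0 = f0 \<and> phi ! 1 = f1))"

end

theory Submission
  imports Defs
begin

text \<open>
  Axioms (N1b), (N2*) and (N3) already force every member of the collection to be exact.

  Under (N1*), closure under sums and summands reduces to weak isomorphisms: a retract of members
  receives, from a member with the same first morphism, a morphism built by (N3) that is the
  identity in the first two places. The missing half of (N2) is obtained in the same way after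
  rotating \<open>n\<close> times and desuspending.

  Conversely, let \<open>phi: X \<rightarrow> Y\<close> be a weak isomorphism of exact sequences with \<open>X\<close> in the collection;
  by (N2) the first two components may be taken invertible. Lifting downwards along \<open>Y\<close> from the
  place \<open>n\<close>, where \<open>phi\<close> is invertible again, gives \<open>psi: Y \<rightarrow> X\<close> inverse to \<open>phi\<close> in the first two
  places. The endomorphism \<open>phi psi\<close> differs from an automorphism of \<open>Y\<close> by null-homotopic
  endomorphisms, which factor through rotated trivial sequences, so \<open>Y\<close> is a summand of the direct
  sum of \<open>X\<close> and sequences of this kind.
\<close>

text \<open>Exactness concerns the functors \<open>Hom(B,-)\<close> only: each map of an exact
  sequence is a weak kernel of the next one, while nothing is known about cokernels. A partial
  morphism can therefore be completed only against the direction of the arrows, from a place to the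
  one before it. This is why \<open>psi\<close> cannot be extended upwards from the inverses of
  \<open>phi ! 0\<close> and \<open>phi ! 1\<close>, but starts at place \<open>n\<close> from the
  inverse of \<open>SM (phi ! 0)\<close>; (N3) would require \<open>Y\<close> to be a member
  already. The lifted components must then be matched with the prescribed inverses at places 0 and
  1, and this forces the correction at place 2. The composite \<open>phi psi\<close> meets the same
  obstacle: homotopies that avoid places 0 and 1 reduce it to the identity everywhere except at
  place 2, and one more homotopy, from place 2 to place 1, would destroy the identity at place 1.
  Instead the remaining error \<open>d\<close> squares to zero, so that \<open>1 + d\<close> is
  inverted by \<open>1 - d\<close>.\<close>

section \<open>Integer powers of a bijection and periodic predicates\<close>

text \<open>\<open>spow_obj\<close> and \<open>spow_mor\<close> use powers of the map or of
  \<open>inv_into\<close>, according to the sign of the exponent. The recursion bridges the two: for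
  negative \<open>i\<close>, one inverse step is cancelled by \<open>F\<close>.\<close>

lemma bij_betw_int_power:
  assumes "bij_betw F S S" "x \<in> S"
  defines "pw \<equiv> \<lambda>i :: int. if 0 \<le> i then F ^^ nat i else inv_into S F ^^ nat (- i)"
  shows "pw i x \<in> S" and "pw (i + 1) x = F (pw i x)"
proof -
  have 1: "(F ^^ m) x \<in> S" for m
    using assms(1,2) by (induction m) (auto simp: bij_betw_def)
  have 2: "(inv_into S F ^^ m) x \<in> S" for m
    using assms(2) bij_betwE[OF bij_betw_inv_into[OF assms(1)]] by (induction m) auto
  show "pw i x \<in> S" using 1 2 by (simp add: pw_def)
  show "pw (i + 1) x = F (pw i x)"
  proof (cases "0 \<le> i")
    case True
    then show ?thesis by (simp add: pw_def nat_add_distrib)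
  next
    case False
    define m where "m = nat (- i - 1)"
    have i: "i = - 1 - int m" using False by (simp add: m_def)
    have "nat (- (i + 1)) = m" "nat (- i) = Suc m" using i by auto
    then have "pw (i + 1) x = (inv_into S F ^^ m) x" "pw i x = inv_into S F ((inv_into S F ^^ m) x)"
      using False i by (auto simp: pw_def)
    then show ?thesis using 2[of m] bij_betw_inv_into_right[OF assms(1)] by simp
  qed
qed

text \<open>\<open>k\<close> and \<open>k mod n\<close> differ by a multiple of \<open>n\<close>. As
  \<open>per\<close> is an equivalence, one may climb from the residue to \<open>k\<close>, or from
  \<open>k\<close> to the residue when the quotient is negative.\<close>

lemma int_periodic_induct:
  fixes k n :: int
  assumes "0 < n" and base: "\<And>j. 0 \<le> j \<Longrightarrow> j < n \<Longrightarrow> P j" and per: "\<And>k. P k \<longleftrightarrow> P (k + n)"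
  shows "P k"
proof -
  have "P (j + n * int m) \<longleftrightarrow> P j" for j m
  proof (induction m)
    case (Suc m)
    then show ?case using per[of "j + n * int m"] by (simp add: algebra_simps)
  qed simp
  from this[of "k mod n" "nat (k div n)"] this[of k "nat (- (k div n))"] base[of "k mod n"] assms(1)
  show ?thesis
    by (cases "0 \<le> k div n") (simp_all add: minus_mult_div_eq_mod algebra_simps)
qed

lemma tl_append_drop:
  assumes "m < length xs"
  shows "tl (drop m xs @ ys) = drop (Suc m) xs @ ys" "(drop m xs @ ys) ! 0 = xs ! m"
    "take (Suc m) xs = take m xs @ [xs ! m]"
  using assms by (auto simp: drop_Suc tl_drop nth_append take_Suc_conv_app_nth)

section \<open>Calculus in an additive category\<close>

locale suspended_category =
  fixes C :: "('o, 'm) addcat" and SO :: "'o \<Rightarrow> 'o" and SM :: "'m \<Rightarrow> 'm" and n :: nat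
  assumes additive: "is_additive_category C"
    and aut: "is_automorphism C SO SM"
    and n_ge_3: "3 \<le> n"
begin

abbreviation hom where "hom \<equiv> Hom C"
abbreviation Ob where "Ob \<equiv> cOb C"
abbreviation Mor where "Mor \<equiv> cMor C"
abbreviation dom where "dom \<equiv> cdom C"
abbreviation cod where "cod \<equiv> ccod C"
abbreviation ident where "ident \<equiv> cid C"
abbreviation zero where "zero \<equiv> czero C"
abbreviation neg where "neg \<equiv> cneg C"
abbreviation comp (infixr \<open>\<cdot>\<close> 75) where "g \<cdot> f \<equiv> ccomp C g f"
abbreviation plus (infixl \<open>\<oplus>\<close> 65) where "f \<oplus> g \<equiv> cadd C f g"

lemma preadditive: "is_preadditive C" and category: "is_category C"
  using additive by (auto simp: is_additive_category_def is_preadditive_def)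

lemma hom_iff: "f \<in> hom A B \<longleftrightarrow> f \<in> Mor \<and> dom f = A \<and> cod f = B"
  by (auto simp: Hom_def)

lemma dom_cod_ob [simp]: "f \<in> Mor \<Longrightarrow> dom f \<in> Ob" "f \<in> Mor \<Longrightarrow> cod f \<in> Ob"
  using category by (auto simp: is_category_def)

lemma hom_ob: "f \<in> hom A B \<Longrightarrow> A \<in> Ob" "f \<in> hom A B \<Longrightarrow> B \<in> Ob"
  by (auto simp: hom_iff)

lemma ident_hom: "A \<in> Ob \<Longrightarrow> ident A \<in> hom A A"
  using category by (auto simp: is_category_def)

lemma ident_mor [simp]:
  "A \<in> Ob \<Longrightarrow> ident A \<in> Mor" "A \<in> Ob \<Longrightarrow> dom (ident A) = A" "A \<in> Ob \<Longrightarrow> cod (ident A) = A"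
  using ident_hom by (auto simp: hom_iff)

lemma comp_hom: "g \<in> hom B D \<Longrightarrow> f \<in> hom A B \<Longrightarrow> g \<cdot> f \<in> hom A D"
  using category unfolding is_category_def by blast

lemma comp_mor [simp]:
  assumes "f \<in> Mor" "g \<in> Mor" "dom g = cod f"
  shows "g \<cdot> f \<in> Mor" "dom (g \<cdot> f) = dom f" "cod (g \<cdot> f) = cod g"
  using comp_hom[of g "dom g" "cod g" f "dom f"] assms by (auto simp: hom_iff)

lemma comp_ident [simp]:
  "f \<in> Mor \<Longrightarrow> cod f = A \<Longrightarrow> ident A \<cdot> f = f"
  "f \<in> Mor \<Longrightarrow> dom f = A \<Longrightarrow> f \<cdot> ident A = f"
  using category unfolding is_category_def hom_iff by blast+

lemma comp_assoc [simp]: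
  "\<lbrakk>f \<in> Mor; g \<in> Mor; h \<in> Mor; dom g = cod f; dom h = cod g\<rbrakk> \<Longrightarrow> (h \<cdot> g) \<cdot> f = h \<cdot> g \<cdot> f"
proof -
  have "\<And>A B D E f g h. f \<in> hom A B \<Longrightarrow> g \<in> hom B D \<Longrightarrow> h \<in> hom D E \<Longrightarrow> h \<cdot> g \<cdot> f = (h \<cdot> g) \<cdot> f"
    using category unfolding is_category_def by blast
  then show "\<lbrakk>f \<in> Mor; g \<in> Mor; h \<in> Mor; dom g = cod f; dom h = cod g\<rbrakk> \<Longrightarrow> (h \<cdot> g) \<cdot> f = h \<cdot> g \<cdot> f"
    by (auto simp: hom_iff)
qed

lemma comp_left_cong:
  assumes "a \<cdot> b = c" "b \<in> hom B D" "a \<in> hom D E" "g \<in> hom A B"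
  shows "a \<cdot> b \<cdot> g = c \<cdot> g"
proof -
  have "a \<cdot> b \<cdot> g = (a \<cdot> b) \<cdot> g" using assms(2-) by (simp add: hom_iff)
  then show ?thesis using assms(1) by simp
qed

lemma zero_hom: "A \<in> Ob \<Longrightarrow> B \<in> Ob \<Longrightarrow> zero A B \<in> hom A B"
  using preadditive by (auto simp: is_preadditive_def)

lemma zero_mor [simp]:
  assumes "A \<in> Ob" "B \<in> Ob"
  shows "zero A B \<in> Mor" "dom (zero A B) = A" "cod (zero A B) = B"
  using zero_hom[OF assms] by (auto simp: hom_iff)

lemma plus_closed_commute:
  "\<forall>A B f g. f \<in> hom A B \<longrightarrow> g \<in> hom A B \<longrightarrow> f \<oplus> g \<in> hom A B \<and> f \<oplus> g = g \<oplus> f"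
  using preadditive unfolding is_preadditive_def by (elim conjE)

lemma plus_hom: "f \<in> hom A B \<Longrightarrow> g \<in> hom A B \<Longrightarrow> f \<oplus> g \<in> hom A B"
  using plus_closed_commute by simp

lemma plus_mor [simp]:
  assumes "f \<in> Mor" "g \<in> Mor" "dom g = dom f" "cod g = cod f"
  shows "f \<oplus> g \<in> Mor" "dom (f \<oplus> g) = dom f" "cod (f \<oplus> g) = cod f"
  using plus_hom[of f "dom f" "cod f" g] assms by (auto simp: hom_iff)

lemma neg_zero_laws:
  "\<forall>A B f. f \<in> hom A B \<longrightarrow> neg f \<in> hom A B \<and> f \<oplus> neg f = zero A B \<and> f \<oplus> zero A B = f"
  using preadditive unfolding is_preadditive_def by (elim conjE)

lemma neg_hom: "f \<in> hom A B \<Longrightarrow> neg f \<in> hom A B"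
  using neg_zero_laws by simp

lemma neg_mor [simp]:
  assumes "f \<in> Mor"
  shows "neg f \<in> Mor" "dom (neg f) = dom f" "cod (neg f) = cod f"
  using neg_hom[of f "dom f" "cod f"] assms by (auto simp: hom_iff)

lemma plus_commute:
  "\<lbrakk>f \<in> Mor; g \<in> Mor; dom g = dom f; cod g = cod f\<rbrakk> \<Longrightarrow> f \<oplus> g = g \<oplus> f"
  using plus_closed_commute[rule_format, of f "dom f" "cod f" g] by (simp add: hom_iff)

lemma plus_neg [simp]:
  assumes "f \<in> Mor" "dom f = A" "cod f = B"
  shows "f \<oplus> neg f = zero A B" "f \<oplus> zero A B = f" "zero A B \<oplus> f = f" "neg f \<oplus> f = zero A B"
proof -
  have f: "f \<in> hom A B" using assms by (simp add: hom_iff)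
  show *: "f \<oplus> neg f = zero A B" "f \<oplus> zero A B = f"
    using neg_zero_laws f by blast+
  show "zero A B \<oplus> f = f" "neg f \<oplus> f = zero A B"
    using * assms plus_commute[of f "zero A B"] plus_commute[of f "neg f"] by auto
qed

lemma plus_assoc [simp]:
  "\<lbrakk>f \<in> Mor; g \<in> Mor; h \<in> Mor; dom g = dom f; cod g = cod f; dom h = dom f; cod h = cod f\<rbrakk>
   \<Longrightarrow> f \<oplus> g \<oplus> h = f \<oplus> (g \<oplus> h)"
proof -
  have "\<And>A B f g h. f \<in> hom A B \<Longrightarrow> g \<in> hom A B \<Longrightarrow> h \<in> hom A B \<Longrightarrow> f \<oplus> g \<oplus> h = f \<oplus> (g \<oplus> h)"
    using preadditive unfolding is_preadditive_def by (elim conjE) presburger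
  then show "\<lbrakk>f \<in> Mor; g \<in> Mor; h \<in> Mor; dom g = dom f; cod g = cod f; dom h = dom f; cod h = cod f\<rbrakk>
   \<Longrightarrow> f \<oplus> g \<oplus> h = f \<oplus> (g \<oplus> h)" by (auto simp: hom_iff)
qed

lemma plus_left_commute:
  assumes "f \<in> Mor" "g \<in> Mor" "h \<in> Mor" "dom g = dom f" "cod g = cod f" "dom h = dom f" "cod h = cod f"
  shows "f \<oplus> (g \<oplus> h) = g \<oplus> (f \<oplus> h)"
proof -
  have "f \<oplus> (g \<oplus> h) = (f \<oplus> g) \<oplus> h" using assms by simp
  also have "f \<oplus> g = g \<oplus> f" using assms plus_commute by simp
  also have "(g \<oplus> f) \<oplus> h = g \<oplus> (f \<oplus> h)" using assms by simp
  finally show ?thesis .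
qed

lemma plus_left_cancel:
  assumes "f \<in> Mor" "g \<in> Mor" "h \<in> Mor" "dom g = dom f" "cod g = cod f" "dom h = dom f" "cod h = cod f"
    and eq: "f \<oplus> g = f \<oplus> h"
  shows "g = h"
proof -
  have "(neg f \<oplus> f) \<oplus> k = neg f \<oplus> (f \<oplus> k)" if "k \<in> Mor" "dom k = dom f" "cod k = cod f" for k
    using that assms(1) by (intro plus_assoc) auto
  then have "(neg f \<oplus> f) \<oplus> g = (neg f \<oplus> f) \<oplus> h" using assms by metis
  then show ?thesis using assms(1-7) by (simp del: plus_assoc)
qed

lemma comp_plus [simp]:
  assumes "f \<in> Mor" "g \<in> Mor" "dom g = dom f" "cod g = cod f" "h \<in> Mor"
  shows "dom h = cod f \<Longrightarrow> h \<cdot> (f \<oplus> g) = h \<cdot> f \<oplus> h \<cdot> g"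
    and "dom f = cod h \<Longrightarrow> (f \<oplus> g) \<cdot> h = f \<cdot> h \<oplus> g \<cdot> h"
proof -
  have *: "\<And>A B D f g h. f \<in> hom A B \<Longrightarrow> g \<in> hom A B \<Longrightarrow> h \<in> hom B D \<Longrightarrow> h \<cdot> (f \<oplus> g) = h \<cdot> f \<oplus> h \<cdot> g"
    "\<And>A B D f g k. f \<in> hom B D \<Longrightarrow> g \<in> hom B D \<Longrightarrow> k \<in> hom A B \<Longrightarrow> (f \<oplus> g) \<cdot> k = f \<cdot> k \<oplus> g \<cdot> k"
    using preadditive unfolding is_preadditive_def by (elim conjE, presburger)+
  show "dom h = cod f \<Longrightarrow> h \<cdot> (f \<oplus> g) = h \<cdot> f \<oplus> h \<cdot> g"
    "dom f = cod h \<Longrightarrow> (f \<oplus> g) \<cdot> h = f \<cdot> h \<oplus> g \<cdot> h"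
    using assms by (auto intro!: * simp: hom_iff)
qed

lemma plus_self_eq_zero:
  assumes "f \<in> Mor" "f \<oplus> f = f" "dom f = A" "cod f = B" shows "f = zero A B"
  using assms plus_left_cancel[of f f "zero A B"] by auto

lemma comp_zero [simp]:
  assumes "f \<in> Mor" "A \<in> Ob"
  shows "dom f = B \<Longrightarrow> f \<cdot> zero A B = zero A (cod f)"
    and "cod f = B \<Longrightarrow> zero B A \<cdot> f = zero (dom f) A"
proof -
  show "dom f = B \<Longrightarrow> f \<cdot> zero A B = zero A (cod f)"
  proof (rule plus_self_eq_zero)
    assume B: "dom f = B"
    then have "B \<in> Ob" using assms by auto
    then have "f \<cdot> (zero A B \<oplus> zero A B) = f \<cdot> zero A B" using assms by simp
    then show "f \<cdot> zero A B \<oplus> f \<cdot> zero A B = f \<cdot> zero A B" using B assms \<open>B \<in> Ob\<close>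
      by (simp del: plus_neg)
  qed (use assms in auto)
  show "cod f = B \<Longrightarrow> zero B A \<cdot> f = zero (dom f) A"
  proof (rule plus_self_eq_zero)
    assume B: "cod f = B"
    then have "B \<in> Ob" using assms by auto
    then have "(zero B A \<oplus> zero B A) \<cdot> f = zero B A \<cdot> f" using assms by simp
    then show "zero B A \<cdot> f \<oplus> zero B A \<cdot> f = zero B A \<cdot> f" using B assms \<open>B \<in> Ob\<close>
      by (simp del: plus_neg)
  qed (use assms in auto)
qed

lemma neg_unique:
  assumes "f \<in> Mor" "g \<in> Mor" "dom g = dom f" "cod g = cod f" "f \<oplus> g = zero (dom f) (cod f)"
  shows "g = neg f"
  using assms plus_left_cancel[of f g "neg f"] by simp

lemma comp_neg [simp]:
  assumes "f \<in> Mor" "g \<in> Mor" "dom g = cod f"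
  shows "g \<cdot> neg f = neg (g \<cdot> f)" "neg g \<cdot> f = neg (g \<cdot> f)"
proof -
  have "g \<cdot> (f \<oplus> neg f) = zero (dom f) (cod g)" "(g \<oplus> neg g) \<cdot> f = zero (dom f) (cod g)"
    using assms by (simp_all del: comp_plus)
  then show "g \<cdot> neg f = neg (g \<cdot> f)" "neg g \<cdot> f = neg (g \<cdot> f)"
    using assms by (auto intro!: neg_unique simp del: plus_neg)
qed

lemma neg_neg [simp]: "f \<in> Mor \<Longrightarrow> neg (neg f) = f"
  by (rule neg_unique[symmetric]) auto

lemma neg_zero [simp]: "A \<in> Ob \<Longrightarrow> B \<in> Ob \<Longrightarrow> neg (zero A B) = zero A B"
  by (rule neg_unique[symmetric]) auto

lemma neg_eq_iff: "f \<in> Mor \<Longrightarrow> g \<in> Mor \<Longrightarrow> neg f = neg g \<longleftrightarrow> f = g"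
  by (metis neg_neg)

lemma neg_eq_zero_iff [simp]:
  "f \<in> Mor \<Longrightarrow> A \<in> Ob \<Longrightarrow> B \<in> Ob \<Longrightarrow> neg f = zero A B \<longleftrightarrow> f = zero A B"
  by (metis neg_neg neg_zero)

lemma zero_object_hom_eq:
  assumes "is_zero_object C Z" "f \<in> Mor" "g \<in> Mor" "dom f = dom g" "cod f = cod g"
  shows "cod f = Z \<Longrightarrow> f = g" and "dom f = Z \<Longrightarrow> f = g"
proof -
  have Z: "Z \<in> Ob" "ident Z = zero Z Z" using assms by (auto simp: is_zero_object_def)
  have 1: "h = zero (dom h) Z" if "h \<in> Mor" "cod h = Z" for h
    using comp_ident(1)[OF that] Z that by simp
  have 2: "h = zero Z (cod h)" if "h \<in> Mor" "dom h = Z" for h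
    using comp_ident(2)[OF that] Z that by simp
  show "cod f = Z \<Longrightarrow> f = g" "dom f = Z \<Longrightarrow> f = g"
    using 1[of f] 1[of g] 2[of f] 2[of g] assms by metis+
qed

lemma is_iso_ident: "A \<in> Ob \<Longrightarrow> is_iso C (ident A)"
  unfolding is_iso_def using ident_hom by (auto intro!: bexI[of _ "ident A"])

text \<open>The mixed composites vanish as a consequence: composing \<open>i q + j p = 1\<close>
  with \<open>q\<close> on the left and cancelling \<open>q\<close> leaves \<open>q j p = 0\<close>,
  and \<open>p j = 1\<close> then gives \<open>q j = 0\<close>.\<close>

lemma biproductD:
  assumes "is_biproduct C A B S i1 i2 p1 p2"
  shows "i1 \<in> hom A S" "i2 \<in> hom B S" "p1 \<in> hom S A" "p2 \<in> hom S B"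
    "p1 \<cdot> i1 = ident A" "p2 \<cdot> i2 = ident B" "i1 \<cdot> p1 \<oplus> i2 \<cdot> p2 = ident S"
    "p1 \<cdot> i2 = zero B A" "p2 \<cdot> i1 = zero A B"
proof -
  show H: "i1 \<in> hom A S" "i2 \<in> hom B S" "p1 \<in> hom S A" "p2 \<in> hom S B"
    and e: "p1 \<cdot> i1 = ident A" "p2 \<cdot> i2 = ident B" "i1 \<cdot> p1 \<oplus> i2 \<cdot> p2 = ident S"
    using assms by (auto simp: is_biproduct_def)
  have vanish: "q \<cdot> j = zero B A"
    if "i \<in> hom A S" "j \<in> hom B S" "q \<in> hom S A" "p \<in> hom S B"
      "q \<cdot> i = ident A" "p \<cdot> j = ident B" "i \<cdot> q \<oplus> j \<cdot> p = ident S" for A B i j q p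
  proof -
    have ob: "A \<in> Ob" "B \<in> Ob" "S \<in> Ob" using that hom_ob by blast+
    have "q \<cdot> (i \<cdot> q \<oplus> j \<cdot> p) = (q \<cdot> i) \<cdot> q \<oplus> q \<cdot> j \<cdot> p"
      using that(1-4) by (simp add: hom_iff)
    then have "q \<oplus> q \<cdot> j \<cdot> p = q \<oplus> zero S A"
      unfolding that(5,7) using that(3) ob by (simp add: hom_iff)
    then have "q \<cdot> j \<cdot> p = zero S A"
      using that ob by (intro plus_left_cancel[of q "q \<cdot> j \<cdot> p" "zero S A"]) (auto simp: hom_iff)
    then have "(q \<cdot> j \<cdot> p) \<cdot> j = zero B A" using that ob by (simp add: hom_iff)
    then show ?thesis using that ob by (simp add: hom_iff)
  qed
  show "p1 \<cdot> i2 = zero B A" using H e by (intro vanish)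
  show "p2 \<cdot> i1 = zero A B"
  proof (intro vanish)
    show "i2 \<cdot> p2 \<oplus> i1 \<cdot> p1 = ident S"
      using H e plus_commute[of "i1 \<cdot> p1" "i2 \<cdot> p2"] by (simp add: hom_iff)
  qed (use H e in auto)
qed

section \<open>The automorphism on objects and morphisms\<close>

lemma SM_hom: "f \<in> hom A B \<Longrightarrow> SM f \<in> hom (SO A) (SO B)"
  using aut unfolding is_automorphism_def by blast

lemma SM_mor [simp]:
  assumes "f \<in> Mor" shows "SM f \<in> Mor" "dom (SM f) = SO (dom f)" "cod (SM f) = SO (cod f)"
  using SM_hom[of f "dom f" "cod f"] assms by (auto simp: hom_iff)

lemma SO_bij: "bij_betw SO Ob Ob"
  using aut unfolding is_automorphism_def by blast

lemma SO_ob [simp]: "A \<in> Ob \<Longrightarrow> SO A \<in> Ob"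
  using SO_bij by (auto simp: bij_betw_def)

lemma SO_eq_iff [simp]: "A \<in> Ob \<Longrightarrow> B \<in> Ob \<Longrightarrow> SO A = SO B \<longleftrightarrow> A = B"
  using SO_bij by (auto simp: bij_betw_def inj_on_def)

lemma SO_surj: assumes "A \<in> Ob" obtains B where "B \<in> Ob" "SO B = A"
  using SO_bij assms unfolding bij_betw_def by (metis imageE)

lemma SM_ident [simp]: "A \<in> Ob \<Longrightarrow> SM (ident A) = ident (SO A)"
  using aut unfolding is_automorphism_def by blast

lemma SM_comp [simp]: "f \<in> Mor \<Longrightarrow> g \<in> Mor \<Longrightarrow> dom g = cod f \<Longrightarrow> SM (g \<cdot> f) = SM g \<cdot> SM f"
  using aut unfolding is_automorphism_def hom_iff by metis

lemma SM_plus [simp]: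
  "f \<in> Mor \<Longrightarrow> g \<in> Mor \<Longrightarrow> dom g = dom f \<Longrightarrow> cod g = cod f \<Longrightarrow> SM (f \<oplus> g) = SM f \<oplus> SM g"
  using aut unfolding is_automorphism_def hom_iff by metis

lemma SM_zero [simp]: assumes "A \<in> Ob" "B \<in> Ob" shows "SM (zero A B) = zero (SO A) (SO B)"
proof (rule plus_self_eq_zero)
  show "SM (zero A B) \<oplus> SM (zero A B) = SM (zero A B)"
    using SM_plus[of "zero A B" "zero A B"] assms by (simp del: SM_plus)
qed (use assms in auto)

lemma SM_neg [simp]: assumes "f \<in> Mor" shows "SM (neg f) = neg (SM f)"
proof (rule neg_unique)
  show "SM f \<oplus> SM (neg f) = zero (dom (SM f)) (cod (SM f))"
    using SM_plus[of f "neg f"] assms by (simp del: SM_plus)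
qed (use assms in auto)

lemma SM_bij: "A \<in> Ob \<Longrightarrow> B \<in> Ob \<Longrightarrow> bij_betw SM (hom A B) (hom (SO A) (SO B))"
  using aut unfolding is_automorphism_def by blast

text \<open>Injectivity is given on each hom-set separately. Equal images have equal domains and
  codomains, so injectivity of \<open>SO\<close> puts both morphisms into one hom-set.\<close>

lemma SM_eq_iff:
  assumes "f \<in> Mor" "g \<in> Mor"
  shows "SM f = SM g \<longleftrightarrow> f = g"
proof
  assume eq: "SM f = SM g"
  have "SO (dom f) = SO (dom g)" "SO (cod f) = SO (cod g)" using SM_mor eq assms by metis+
  then have "dom f = dom g" "cod f = cod g" using assms by auto
  then have "f \<in> hom (dom f) (cod f)" "g \<in> hom (dom f) (cod f)" using assms by (auto simp: hom_iff)
  then show "f = g" using eq SM_bij[of "dom f" "cod f"] assms by (auto simp: bij_betw_def inj_on_def)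
qed simp

lemma SM_surj:
  assumes "f \<in> hom (SO A) (SO B)" "A \<in> Ob" "B \<in> Ob"
  obtains g where "g \<in> hom A B" "SM g = f"
  using SM_bij[of A B] assms unfolding bij_betw_def by (metis imageE)

text \<open>\<open>spow_mor\<close> inverts \<open>SM\<close> on the set of all morphisms, so the
  bijections of hom-sets have to be glued into one.\<close>

lemma SM_bij_Mor: "bij_betw SM Mor Mor"
proof (rule bij_betw_imageI)
  show "inj_on SM Mor" using SM_eq_iff by (auto simp: inj_on_def)
  show "SM ` Mor = Mor"
  proof
    show "Mor \<subseteq> SM ` Mor"
    proof
      fix f assume f: "f \<in> Mor"
      obtain A B where "A \<in> Ob" "SO A = dom f" "B \<in> Ob" "SO B = cod f"
        using SO_surj f dom_cod_ob by metis
      then obtain g where "g \<in> hom A B" "SM g = f" using SM_surj[of f A B] f by (auto simp: hom_iff)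
      then show "f \<in> SM ` Mor" by (auto simp: hom_iff)
    qed
  qed auto
qed

lemma is_zero_object_SO: assumes "is_zero_object C Z" shows "is_zero_object C (SO Z)"
  using assms SM_ident[of Z] by (auto simp: is_zero_object_def)

section \<open>Unrolled sequences\<close>

abbreviation L where "L \<equiv> left_rot C SO SM n"
abbreviation uo where "uo \<equiv> unr_obj C SO n"
abbreviation um where "um \<equiv> unr_mor C SM n"
abbreviation nseq where "nseq \<equiv> is_nseq C SO n"
abbreviation nmor where "nmor \<equiv> is_nseq_mor C SO SM n"

text \<open>Absorbs the convention that the suspension of the first entry follows the last one, so
  that the wrap-around needs no separate clause.\<close>

definition next_obj :: "'o list \<Rightarrow> nat \<Rightarrow> 'o" where
  "next_obj As j = (if Suc j < n then As ! Suc j else SO (As ! 0))"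

definition next_mor :: "'m list \<Rightarrow> nat \<Rightarrow> 'm" where
  "next_mor fs j = (if Suc j < n then fs ! Suc j else SM (fs ! 0))"

lemma all_less_next_iff:
  "(\<forall>j < n. P j (if Suc j < n then Q j else R)) \<longleftrightarrow> (\<forall>j. j + 1 < n \<longrightarrow> P j (Q j)) \<and> P (n - 1) R"
proof (intro iffI conjI allI impI)
  fix j assume *: "(\<forall>j. j + 1 < n \<longrightarrow> P j (Q j)) \<and> P (n - 1) R" "j < n"
  show "P j (if Suc j < n then Q j else R)"
  proof (cases "Suc j < n")
    case False
    then have "j = n - 1" using *(2) by simp
    then show ?thesis using *(1) False by simp
  qed (use * in simp)
next
  assume *: "\<forall>j < n. P j (if Suc j < n then Q j else R)"
  show "P (n - 1) R" using *[rule_format, of "n - 1"] n_ge_3 by simp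
  show "P j (Q j)" if "j + 1 < n" for j using *[rule_format, of j] that by simp
qed

lemma nseq_iff:
  "nseq X \<longleftrightarrow> length (fst X) = n \<and> length (snd X) = n \<and>
     (\<forall>j < n. snd X ! j \<in> hom (fst X ! j) (next_obj (fst X) j))"
proof -
  have "(\<forall>j < n. snd X ! j \<in> hom (fst X ! j) (next_obj (fst X) j)) \<longleftrightarrow>
     (\<forall>j. j + 1 < n \<longrightarrow> snd X ! j \<in> hom (fst X ! j) (fst X ! (j + 1))) \<and>
     snd X ! (n - 1) \<in> hom (fst X ! (n - 1)) (SO (fst X ! 0))"
    unfolding next_obj_def by (subst all_less_next_iff) simp
  moreover have "\<forall>j < n. fst X ! j \<in> Ob"
    if "\<forall>j < n. snd X ! j \<in> hom (fst X ! j) (next_obj (fst X) j)"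
    using that hom_ob by blast
  ultimately show ?thesis
    unfolding is_nseq_def using n_ge_3 by (cases X) auto
qed

lemma nmor_iff:
  "nmor X Y phi \<longleftrightarrow> length phi = n \<and> (\<forall>j < n. phi ! j \<in> hom (fst X ! j) (fst Y ! j)) \<and>
     (\<forall>j < n. next_mor phi j \<cdot> snd X ! j = snd Y ! j \<cdot> phi ! j)"
proof -
  have "(\<forall>j < n. next_mor phi j \<cdot> snd X ! j = snd Y ! j \<cdot> phi ! j) \<longleftrightarrow>
    (\<forall>j. j + 1 < n \<longrightarrow> phi ! (j + 1) \<cdot> snd X ! j = snd Y ! j \<cdot> phi ! j) \<and>
     SM (phi ! 0) \<cdot> snd X ! (n - 1) = snd Y ! (n - 1) \<cdot> phi ! (n - 1)"
    unfolding next_mor_def by (subst all_less_next_iff) simp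
  then show ?thesis unfolding is_nseq_mor_def by auto
qed

lemma nseq_length: "nseq X \<Longrightarrow> length (fst X) = n" "nseq X \<Longrightarrow> length (snd X) = n"
  unfolding nseq_iff by blast+

lemma nseqD:
  assumes "nseq X"
  shows "j < n \<Longrightarrow> snd X ! j \<in> hom (fst X ! j) (next_obj (fst X) j)"
    "j < n \<Longrightarrow> snd X ! j \<in> Mor" "j < n \<Longrightarrow> fst X ! j \<in> Ob"
    "j < n \<Longrightarrow> dom (snd X ! j) = fst X ! j"
    "j < n \<Longrightarrow> cod (snd X ! j) = next_obj (fst X) j"
    "j < n \<Longrightarrow> next_obj (fst X) j \<in> Ob"
proof -
  show *: "j < n \<Longrightarrow> snd X ! j \<in> hom (fst X ! j) (next_obj (fst X) j)" using assms unfolding nseq_iff by blast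
  show "j < n \<Longrightarrow> snd X ! j \<in> Mor" "j < n \<Longrightarrow> fst X ! j \<in> Ob"
    "j < n \<Longrightarrow> dom (snd X ! j) = fst X ! j"
    "j < n \<Longrightarrow> cod (snd X ! j) = next_obj (fst X) j"
    "j < n \<Longrightarrow> next_obj (fst X) j \<in> Ob"
    using * hom_ob unfolding hom_iff by blast+
qed

lemma nmorD:
  assumes "nmor X Y phi"
  shows "j < n \<Longrightarrow> phi ! j \<in> hom (fst X ! j) (fst Y ! j)"
    "j < n \<Longrightarrow> phi ! j \<in> Mor"
    "j < n \<Longrightarrow> dom (phi ! j) = fst X ! j"
    "j < n \<Longrightarrow> cod (phi ! j) = fst Y ! j"
    "j < n \<Longrightarrow> next_mor phi j \<cdot> snd X ! j = snd Y ! j \<cdot> phi ! j"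
    "j < n \<Longrightarrow> next_mor phi j \<in> hom (next_obj (fst X) j) (next_obj (fst Y) j)"
    "j < n \<Longrightarrow> next_mor phi j \<in> Mor"
    "j < n \<Longrightarrow> dom (next_mor phi j) = next_obj (fst X) j"
    "j < n \<Longrightarrow> cod (next_mor phi j) = next_obj (fst Y) j"
proof -
  have 0: "0 < n" using n_ge_3 by auto
  show *: "j < n \<Longrightarrow> phi ! j \<in> hom (fst X ! j) (fst Y ! j)"
    "j < n \<Longrightarrow> next_mor phi j \<cdot> snd X ! j = snd Y ! j \<cdot> phi ! j"
    "j < n \<Longrightarrow> phi ! j \<in> Mor" "j < n \<Longrightarrow> dom (phi ! j) = fst X ! j"
    "j < n \<Longrightarrow> cod (phi ! j) = fst Y ! j" for j
    using assms unfolding nmor_iff by (auto simp: hom_iff)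
  show "j < n \<Longrightarrow> next_mor phi j \<in> hom (next_obj (fst X) j) (next_obj (fst Y) j)"
    using *(1) SM_hom[OF *(1)[OF 0]] by (auto simp: next_mor_def next_obj_def)
  then show "j < n \<Longrightarrow> next_mor phi j \<in> Mor"
    "j < n \<Longrightarrow> dom (next_mor phi j) = next_obj (fst X) j"
    "j < n \<Longrightarrow> cod (next_mor phi j) = next_obj (fst Y) j" by (auto simp: hom_iff)
qed

lemma uo_eq: "j < n \<Longrightarrow> uo X (int j) = fst X ! j"
  and um_eq: "j < n \<Longrightarrow> um X (int j) = snd X ! j"
  by (simp_all add: unr_obj_def unr_mor_def spow_obj_def spow_mor_def)

lemma uo_period: assumes "\<forall>j < n. fst X ! j \<in> Ob" shows "uo X (k + int n) = SO (uo X k)" "uo X k \<in> Ob"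
proof -
  have d: "(k + int n) div int n = k div int n + 1" using n_ge_3 by (intro div_add_self2) auto
  have "nat (k mod int n) < n" using n_ge_3 by (simp add: nat_less_iff)
  then have "fst X ! nat (k mod int n) \<in> Ob" using assms by auto
  note * = bij_betw_int_power[OF SO_bij this, of "k div int n"]
  show "uo X (k + int n) = SO (uo X k)" "uo X k \<in> Ob"
    unfolding unr_obj_def spow_obj_def d mod_add_self2 by (fact *)+
qed

lemma um_period: assumes "\<forall>j < n. snd X ! j \<in> Mor" shows "um X (k + int n) = SM (um X k)" "um X k \<in> Mor"
proof -
  have d: "(k + int n) div int n = k div int n + 1" using n_ge_3 by (intro div_add_self2) auto
  have "nat (k mod int n) < n" using n_ge_3 by (simp add: nat_less_iff)
  then have "snd X ! nat (k mod int n) \<in> Mor" using assms by auto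
  note * = bij_betw_int_power[OF SM_bij_Mor this, of "k div int n"]
  show "um X (k + int n) = SM (um X k)" "um X k \<in> Mor"
    unfolding unr_mor_def spow_mor_def d mod_add_self2 by (fact *)+
qed

lemma uo_next:
  assumes "j < n" "\<forall>j < n. fst X ! j \<in> Ob" shows "uo X (int j + 1) = next_obj (fst X) j"
proof (cases "Suc j < n")
  case True
  then show ?thesis using uo_eq[of "Suc j" X] by (simp add: next_obj_def add.commute)
next
  case False
  then have "int j + 1 = 0 + int n" using assms by auto
  then show ?thesis
    using uo_period(1)[OF assms(2), of 0] uo_eq[of 0 X] n_ge_3 False by (simp add: next_obj_def)
qed

lemma um_next:
  assumes "j < n" "\<forall>j < n. snd X ! j \<in> Mor" shows "um X (int j + 1) = next_mor (snd X) j"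
proof (cases "Suc j < n")
  case True
  then show ?thesis using um_eq[of "Suc j" X] by (simp add: next_mor_def add.commute)
next
  case False
  then have "int j + 1 = 0 + int n" using assms by auto
  then show ?thesis
    using um_period(1)[OF assms(2), of 0] um_eq[of 0 X] n_ge_3 False by (simp add: next_mor_def)
qed

lemma periodic_induct:
  assumes "\<And>j. j < n \<Longrightarrow> P (int j)" "\<And>k. P k \<longleftrightarrow> P (k + int n)"
  shows "P k"
proof (rule int_periodic_induct[of "int n"])
  show "0 < int n" using n_ge_3 by simp
  show "P j" if "0 \<le> j" "j < int n" for j using assms(1)[of "nat j"] that by (simp add: nat_less_iff)
qed (rule assms(2))

lemma SM_hom_iff: "A \<in> Ob \<Longrightarrow> B \<in> Ob \<Longrightarrow> f \<in> Mor \<Longrightarrow> SM f \<in> hom (SO A) (SO B) \<longleftrightarrow> f \<in> hom A B"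
  by (auto simp: hom_iff)

lemma uo_ob: "nseq X \<Longrightarrow> uo X k \<in> Ob" and um_mor: "nseq X \<Longrightarrow> um X k \<in> Mor"
  using uo_period(2) um_period(2) nseqD(2,3) by auto

lemma um_hom: assumes "nseq X" shows "um X k \<in> hom (uo X k) (uo X (k + 1))"
proof (induction k rule: periodic_induct)
  case (1 j)
  then show ?case using uo_next[of j X] nseqD[OF assms] by (simp add: uo_eq um_eq)
next
  case (2 k)
  have "\<forall>j < n. fst X ! j \<in> Ob" "\<forall>j < n. snd X ! j \<in> Mor" using nseqD[OF assms] by auto
  then show ?case using uo_period[of X k] uo_period[of X "k + 1"] um_period[of X k] SM_hom_iff
    by (simp add: add_ac)
qed

text \<open>
  Unrolling only reads the second list of a sequence, so the components \<open>phi\<close> of a morphism are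
  unrolled as the pair \<open>([], phi)\<close>.
\<close>

lemma unr_mor_hom:
  assumes "nmor X Y phi" "nseq X" "nseq Y"
  shows "um ([], phi) k \<in> hom (uo X k) (uo Y k)"
proof (induction k rule: periodic_induct)
  case (1 j)
  then show ?case using nmorD[OF assms(1)] by (simp add: uo_eq um_eq)
next
  case (2 k)
  have "\<forall>j < n. fst X ! j \<in> Ob" "\<forall>j < n. fst Y ! j \<in> Ob" "\<forall>j < n. snd ([], phi) ! j \<in> Mor"
    using nseqD assms nmorD[OF assms(1)] by auto
  then show ?case
    using uo_period[of X k] uo_period[of Y k] um_period[of "([], phi)" k] SM_hom_iff by simp
qed

lemma unr_mor_commute:
  assumes "nmor X Y phi" "nseq X" "nseq Y"
  shows "um ([], phi) (k + 1) \<cdot> um X k = um Y k \<cdot> um ([], phi) k"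
proof (induction k rule: periodic_induct)
  case (1 j)
  then show ?case using nmorD[OF assms(1)] um_next[of j "([], phi)"] by (simp add: um_eq)
next
  case (2 k)
  have per: "um X (k + int n) = SM (um X k)" "um Y (k + int n) = SM (um Y k)"
    "\<And>k. um ([], phi) (k + int n) = SM (um ([], phi) k)"
    using nseqD(2)[OF assms(2)] nseqD(2)[OF assms(3)] nmorD[OF assms(1)] by (auto intro!: um_period)
  have e: "k + int n + 1 = (k + 1) + int n" by simp
  note h = unr_mor_hom[OF assms, of k] unr_mor_hom[OF assms, of "k + 1"] um_hom[OF assms(2), of k] um_hom[OF assms(3), of k]
  have "SM (um ([], phi) (k + 1)) \<cdot> SM (um X k) = SM (um ([], phi) (k + 1) \<cdot> um X k)"
    "SM (um Y k) \<cdot> SM (um ([], phi) k) = SM (um Y k \<cdot> um ([], phi) k)"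
    using h by (simp_all add: hom_iff)
  then show ?case unfolding e per using h SM_eq_iff by (simp add: hom_iff del: SM_comp)
qed

section \<open>Exactness in terms of weak kernels\<close>

text \<open>Says that \<open>f\<close> is a weak kernel of \<open>g\<close>, which is exactness of
  \<open>Hom(B,-)\<close> at the middle object for all \<open>B\<close> at once.\<close>

definition exact_pair :: "'m \<Rightarrow> 'm \<Rightarrow> bool" where
  "exact_pair f g \<longleftrightarrow> g \<cdot> f = zero (dom f) (cod g) \<and>
     (\<forall>h \<in> Mor. cod h = dom g \<longrightarrow> g \<cdot> h = zero (dom h) (cod g) \<longrightarrow>
        (\<exists>t \<in> hom (dom h) (dom f). f \<cdot> t = h))"

lemma is_exact_iff:
  assumes X: "nseq X"
  shows "is_exact C SO SM n X \<longleftrightarrow> (\<forall>k. exact_pair (um X k) (um X (k + 1)))"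
proof -
  note H = um_hom[OF X]
  have ty: "um X k \<in> Mor" "dom (um X k) = uo X k" "cod (um X k) = uo X (k + 1)" "uo X k \<in> Ob" for k
    using H[of k] uo_ob[OF X] by (auto simp: hom_iff)
  have e: "(k + 1) + 1 = k + 2" for k :: int by simp
  have "(\<forall>B \<in> Ob. (\<forall>g \<in> hom B (uo X k). um X (k + 1) \<cdot> um X k \<cdot> g = zero B (uo X (k + 2))) \<and>
        (\<forall>h \<in> hom B (uo X (k + 1)). um X (k + 1) \<cdot> h = zero B (uo X (k + 2)) \<longrightarrow>
           (\<exists>g \<in> hom B (uo X k). um X k \<cdot> g = h)))
       \<longleftrightarrow> exact_pair (um X k) (um X (k + 1))" for k
  proof
    assume *: "\<forall>B \<in> Ob. (\<forall>g \<in> hom B (uo X k). um X (k + 1) \<cdot> um X k \<cdot> g = zero B (uo X (k + 2))) \<and>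
        (\<forall>h \<in> hom B (uo X (k + 1)). um X (k + 1) \<cdot> h = zero B (uo X (k + 2)) \<longrightarrow>
           (\<exists>g \<in> hom B (uo X k). um X k \<cdot> g = h))"
    \<comment> \<open>Testing on the identity of the source turns vanishing on all \<open>g\<close>
      into vanishing of the composite.\<close>
    have "um X (k + 1) \<cdot> um X k \<cdot> ident (uo X k) = zero (uo X k) (uo X (k + 2))"
      using * ty ident_hom by blast
    then have "um X (k + 1) \<cdot> um X k = zero (uo X k) (uo X (k + 2))" using ty by simp
    then show "exact_pair (um X k) (um X (k + 1))"
      unfolding exact_pair_def ty e using * by (auto simp: hom_iff)
  next
    assume *: "exact_pair (um X k) (um X (k + 1))"
    have z: "um X (k + 1) \<cdot> um X k = zero (uo X k) (uo X (k + 2))"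
      using * unfolding exact_pair_def ty e by auto
    have "um X (k + 1) \<cdot> um X k \<cdot> g = zero B (uo X (k + 2))" if "g \<in> hom B (uo X k)" for B g
      using comp_left_cong[OF z H H that] that ty by (simp add: hom_iff)
    then show "\<forall>B \<in> Ob. (\<forall>g \<in> hom B (uo X k). um X (k + 1) \<cdot> um X k \<cdot> g = zero B (uo X (k + 2))) \<and>
        (\<forall>h \<in> hom B (uo X (k + 1)). um X (k + 1) \<cdot> h = zero B (uo X (k + 2)) \<longrightarrow>
           (\<exists>g \<in> hom B (uo X k). um X k \<cdot> g = h))"
      using * unfolding exact_pair_def ty e by (auto simp: hom_iff)
  qed
  then show ?thesis unfolding is_exact_def by blast
qed

text \<open>The difference \<open>u - v\<close> is killed by \<open>g\<close>, hence factors through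
  \<open>f\<close>.\<close>

lemma exact_pairD:
  assumes "exact_pair f g" "u \<in> hom B (dom g)" "v \<in> hom B (dom g)" "g \<in> Mor" "f \<in> Mor"
    "cod f = dom g" "g \<cdot> u = g \<cdot> v"
  obtains t where "t \<in> hom B (dom f)" "u = v \<oplus> f \<cdot> t"
proof -
  have ob: "B \<in> Ob" using assms hom_ob by blast
  have "g \<cdot> (neg v \<oplus> u) = zero B (cod g)" using assms by (simp add: hom_iff)
  then obtain t where t: "t \<in> hom B (dom f)" "f \<cdot> t = neg v \<oplus> u"
    using assms(1) assms(2-6) unfolding exact_pair_def
    by (elim conjE ballE[of _ _ "neg v \<oplus> u"]) (auto simp: hom_iff)
  have "v \<oplus> f \<cdot> t = (v \<oplus> neg v) \<oplus> u" unfolding t using assms by (simp add: hom_iff del: plus_neg)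
  then show thesis using that t(1) assms by (simp add: hom_iff)
qed

lemma exact_pair_neg:
  assumes "f \<in> Mor" "g \<in> Mor" "cod f = dom g"
  shows "exact_pair (neg f) g \<longleftrightarrow> exact_pair f g" "exact_pair f (neg g) \<longleftrightarrow> exact_pair f g"
proof -
  have "(\<exists>t \<in> hom A (dom f). neg f \<cdot> t = h) \<longleftrightarrow> (\<exists>t \<in> hom A (dom f). f \<cdot> t = h)" for A h
  proof -
    have "neg f \<cdot> t = f \<cdot> neg t" "f \<cdot> t = neg f \<cdot> neg t" if "t \<in> hom A (dom f)" for t
      using that assms by (auto simp: hom_iff)
    then show ?thesis using neg_hom by metis
  qed
  then show "exact_pair (neg f) g \<longleftrightarrow> exact_pair f g" "exact_pair f (neg g) \<longleftrightarrow> exact_pair f g"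
    using assms unfolding exact_pair_def by auto
qed

text \<open>Every test morphism has the form \<open>SM h\<close>, and every factorisation of
  \<open>SM h\<close> through \<open>SM f\<close> is the suspension of one of \<open>h\<close>
  through \<open>f\<close>.\<close>

lemma exact_pair_SM:
  assumes "f \<in> Mor" "g \<in> Mor" "cod f = dom g"
  shows "exact_pair (SM f) (SM g) \<longleftrightarrow> exact_pair f g"
proof -
  have z: "SM u = zero (SO A) (SO B) \<longleftrightarrow> u = zero A B" if "u \<in> Mor" "A \<in> Ob" "B \<in> Ob" for u A B
    using SM_eq_iff[of u "zero A B"] that by simp
  have 1: "SM g \<cdot> SM f = zero (dom (SM f)) (cod (SM g)) \<longleftrightarrow> g \<cdot> f = zero (dom f) (cod g)"
    using z[of "g \<cdot> f" "dom f" "cod g"] assms by simp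
  have 2: "SM g \<cdot> SM h = zero (dom (SM h)) (cod (SM g)) \<longleftrightarrow> g \<cdot> h = zero (dom h) (cod g)"
    if "h \<in> Mor" "cod h = dom g" for h
    using z[of "g \<cdot> h" "dom h" "cod g"] that assms by simp
  have 3: "(\<exists>t \<in> hom (dom (SM h)) (dom (SM f)). SM f \<cdot> t = SM h) \<longleftrightarrow> (\<exists>t \<in> hom (dom h) (dom f). f \<cdot> t = h)"
    if "h \<in> Mor" for h
  proof -
    have "SM f \<cdot> SM t = SM h \<longleftrightarrow> f \<cdot> t = h" if "t \<in> hom (dom h) (dom f)" for t
      using that assms \<open>h \<in> Mor\<close> SM_eq_iff[of "f \<cdot> t" h] by (simp add: hom_iff)
    moreover have "\<exists>s \<in> hom (dom h) (dom f). t = SM s" if "t \<in> hom (dom (SM h)) (dom (SM f))" for t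
      using SM_surj[of t "dom h" "dom f"] that assms \<open>h \<in> Mor\<close> by (metis SM_mor(2) dom_cod_ob(1))
    ultimately show ?thesis using that assms SM_hom by (metis SM_mor(2))
  qed
  have 4: "(\<forall>h \<in> Mor. P h) \<longleftrightarrow> (\<forall>h \<in> Mor. P (SM h))" for P
    using SM_bij_Mor unfolding bij_betw_def by (metis image_iff)
  have 5: "cod (SM h) = dom (SM g) \<longleftrightarrow> cod h = dom g" if "h \<in> Mor" for h
    using that assms by simp
  show ?thesis
    unfolding exact_pair_def 1 by (subst 4) (use 2 3 5 in auto)
qed

lemma exact_pair_period:
  assumes "nseq X"
  shows "exact_pair (um X (k + int n)) (um X (k + int n + 1)) \<longleftrightarrow> exact_pair (um X k) (um X (k + 1))"
proof -
  have per: "um X (k + int n) = SM (um X k)" for k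
    using nseqD[OF assms] by (auto intro!: um_period)
  have e: "k + int n + 1 = (k + 1) + int n" by simp
  show ?thesis unfolding e per using um_hom[OF assms, of k] um_hom[OF assms, of "k + 1"]
    by (intro exact_pair_SM) (auto simp: hom_iff)
qed

section \<open>Left rotation\<close>

text \<open>The factor \<open>(-1)^n\<close> of the rotation, kept as one operation so that it can
  be moved through composites and cancelled without splitting on the parity of
  \<open>n\<close>.\<close>

definition rot_sign :: "'m \<Rightarrow> 'm" where "rot_sign f = (if even n then f else neg f)"

lemma rot_sign [simp]:
  assumes "f \<in> Mor"
  shows "rot_sign f \<in> Mor" "dom (rot_sign f) = dom f" "cod (rot_sign f) = cod f"
    "g \<in> Mor \<Longrightarrow> dom g = cod f \<Longrightarrow> g \<cdot> rot_sign f = rot_sign (g \<cdot> f)"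
    "g \<in> Mor \<Longrightarrow> cod g = dom f \<Longrightarrow> rot_sign f \<cdot> g = rot_sign (f \<cdot> g)"
    "g \<in> Mor \<Longrightarrow> rot_sign f = rot_sign g \<longleftrightarrow> f = g"
  using assms neg_eq_iff by (auto simp: rot_sign_def)

lemma rot_sign_cases: "rot_sign f = f \<or> rot_sign f = neg f"
  by (auto simp: rot_sign_def)

lemma left_rot_eq:
  "L X = (tl (fst X) @ [SO (fst X ! 0)], tl (snd X) @ [rot_sign (SM (snd X ! 0))])"
  by (cases X) (auto simp: left_rot_def rot_sign_def)

lemma nth_left_rot:
  assumes "nseq X" "j < n"
  shows "fst (L X) ! j = next_obj (fst X) j"
    "snd (L X) ! j = (if Suc j < n then snd X ! Suc j else rot_sign (SM (snd X ! 0)))"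
  using assms nseq_length[OF assms(1)]
  by (auto simp: left_rot_eq next_obj_def nth_append nth_tl)

lemma next_obj_ob: "\<forall>j < n. As ! j \<in> Ob \<Longrightarrow> next_obj As j \<in> Ob"
  using n_ge_3 by (auto simp: next_obj_def)

lemma nseq_left_rot:
  assumes "nseq X" shows "nseq (L X)"
proof -
  have l: "length (fst (L X)) = n" "length (snd (L X)) = n"
    using n_ge_3 nseq_length[OF assms] by (auto simp: left_rot_eq)
  have "snd (L X) ! j \<in> hom (fst (L X) ! j) (next_obj (fst (L X)) j)" if j: "j < n" for j
  proof (cases "Suc j < n")
    case True
    have "next_obj (fst (L X)) j = next_obj (fst X) (Suc j)"
      using True nth_left_rot[OF assms] by (simp add: next_obj_def)
    then show ?thesis using True nth_left_rot[OF assms] nseqD(1)[OF assms]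
      by (simp add: next_obj_def)
  next
    case False
    have 0: "0 < n" "1 < n" using n_ge_3 by auto
    have "snd (L X) ! j = rot_sign (SM (snd X ! 0))" "fst (L X) ! j = SO (fst X ! 0)"
      using False j nth_left_rot[OF assms] by (auto simp: next_obj_def)
    moreover have "next_obj (fst (L X)) j = SO (next_obj (fst X) 0)"
      using False nth_left_rot(1)[OF assms] 0 by (simp add: next_obj_def)
    ultimately show ?thesis using nseqD(1)[OF assms, of 0] 0 by (simp add: hom_iff)
  qed
  then show ?thesis using l nseq_iff by auto
qed

text \<open>Rotation shifts the unrolled sequence by one place. A sign can occur only at places
  congruent to \<open>n - 1\<close>; it is left undetermined, since exactness does not see
  signs.\<close>

lemma unr_left_rot:
  assumes X: "nseq X"
  shows "uo (L X) k = uo X (k + 1) \<and> um (L X) k \<in> {um X (k + 1), neg (um X (k + 1))}"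
proof (induction k rule: periodic_induct)
  case (1 j)
  have ob: "\<forall>j < n. fst X ! j \<in> Ob" "\<forall>j < n. snd X ! j \<in> Mor" using nseqD[OF X] by auto
  have "uo (L X) (int j) = uo X (int j + 1)"
    using 1 nth_left_rot[OF X 1] uo_next[OF 1 ob(1)] by (simp add: uo_eq)
  moreover have "um (L X) (int j) \<in> {um X (int j + 1), neg (um X (int j + 1))}"
    using 1 nth_left_rot[OF X 1] um_next[OF 1 ob(2)] rot_sign_cases[of "SM (snd X ! 0)"]
    by (auto simp: um_eq next_mor_def)
  ultimately show ?case by simp
next
  case (2 k)
  note LX = nseq_left_rot[OF X]
  have per: "uo Y (k + int n) = SO (uo Y k)" "um Y (k + int n) = SM (um Y k)"
    if "nseq Y" for Y k
    using nseqD[OF that] by (auto intro!: um_period uo_period)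
  have e: "k + int n + 1 = (k + 1) + int n" by simp
  have n: "neg (SM (um X (k + 1))) = SM (neg (um X (k + 1)))" using um_mor[OF X] by simp
  show ?case unfolding e per[OF X] per[OF LX] insert_iff empty_iff n
    using uo_ob[OF X] uo_ob[OF LX] um_mor[OF X] um_mor[OF LX] SM_eq_iff by (simp del: SM_neg)
qed

lemma exact_pair_left_rot:
  assumes X: "nseq X"
  shows "exact_pair (um (L X) k) (um (L X) (k + 1)) \<longleftrightarrow> exact_pair (um X (k + 1)) (um X (k + 1 + 1))"
proof -
  have "um (L X) k = um X (k + 1) \<or> um (L X) k = neg (um X (k + 1))"
    "um (L X) (k + 1) = um X (k + 1 + 1) \<or> um (L X) (k + 1) = neg (um X (k + 1 + 1))"
    using unr_left_rot[OF X] by blast+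
  then show ?thesis using um_hom[OF X, of "k + 1"] um_hom[OF X, of "k + 1 + 1"] exact_pair_neg
    by (auto simp: hom_iff)
qed

lemma is_exact_left_rot:
  assumes X: "nseq X"
  shows "is_exact C SO SM n (L X) \<longleftrightarrow> is_exact C SO SM n X"
proof -
  have "(\<forall>k. P (k + 1)) \<longleftrightarrow> (\<forall>k. P k)" for P :: "int \<Rightarrow> bool"
    by (metis diff_add_cancel)
  from this[of "\<lambda>k. exact_pair (um X k) (um X (k + 1))"] show ?thesis
    unfolding is_exact_iff[OF X] is_exact_iff[OF nseq_left_rot[OF X]] exact_pair_left_rot[OF X] .
qed

section \<open>Morphisms of sequences, retracts and direct sums\<close>

lemma next_mor_map:
  "j < n \<Longrightarrow> next_mor (map f [0..<n]) j = (if Suc j < n then f (Suc j) else SM (f 0))"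
  by (simp add: next_mor_def)

lemma next_mor_hom:
  assumes "\<And>j. j < n \<Longrightarrow> f j \<in> hom (As ! j) (Bs ! j)" "j < n"
  shows "next_mor (map f [0..<n]) j \<in> hom (next_obj As j) (next_obj Bs j)"
  using assms SM_hom[of "f 0"] by (auto simp: next_mor_map next_obj_def)

lemma nmor_comp:
  assumes "nseq X" "nseq Y" "nseq Z" "nmor X Y phi" "nmor Y Z psi"
  shows "nmor X Z (map (\<lambda>j. psi ! j \<cdot> phi ! j) [0..<n])" (is "nmor X Z ?c")
proof -
  note h = nmorD[OF assms(4)] nmorD[OF assms(5)]
  have "next_mor ?c j \<cdot> snd X ! j = snd Z ! j \<cdot> ?c ! j" if j: "j < n" for j
  proof -
    have "next_mor ?c j = next_mor psi j \<cdot> next_mor phi j"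
      using j h(2-4)[of 0] h(11-13)[of 0] by (simp add: next_mor_map next_mor_def)
    then have "next_mor ?c j \<cdot> snd X ! j = next_mor psi j \<cdot> next_mor phi j \<cdot> snd X ! j"
      using j h nseqD[OF assms(1)] by simp
    also have "\<dots> = (next_mor psi j \<cdot> snd Y ! j) \<cdot> phi ! j"
      unfolding h(5)[OF j] using j h(2-4,16-18) nseqD[OF assms(2)] by simp
    also have "\<dots> = snd Z ! j \<cdot> ?c ! j"
      using j h nseqD[OF assms(3)] by simp
    finally show ?thesis .
  qed
  then show ?thesis using h unfolding nmor_iff by (auto simp: hom_iff)
qed

lemma nmor_plus:
  assumes "nseq X" "nseq Y" "nmor X Y phi" "nmor X Y psi"
  shows "nmor X Y (map (\<lambda>j. phi ! j \<oplus> psi ! j) [0..<n])" (is "nmor X Y ?c")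
proof -
  note h = nmorD[OF assms(3)] nmorD[OF assms(4)]
  have "next_mor ?c j \<cdot> snd X ! j = snd Y ! j \<cdot> ?c ! j" if j: "j < n" for j
  proof -
    have "next_mor ?c j = next_mor phi j \<oplus> next_mor psi j"
      using j h(2-4)[of 0] h(11-13)[of 0] by (simp add: next_mor_map next_mor_def)
    then show ?thesis using j h nseqD[OF assms(1)] nseqD[OF assms(2)] by simp
  qed
  then show ?thesis using h unfolding nmor_iff by (auto simp: hom_iff)
qed

lemma nmor_zero:
  assumes "nseq X" "nseq Y"
  shows "nmor X Y (map (\<lambda>j. zero (fst X ! j) (fst Y ! j)) [0..<n])"
  using nseqD[OF assms(1)] nseqD[OF assms(2)] unfolding nmor_iff
  by (auto simp: next_mor_map next_obj_def hom_iff)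

text \<open>
  One notion for direct sums and, with \<open>i2\<close> zero, for summands.
\<close>

definition joint_retract ::
  "('o, 'm) nseq \<Rightarrow> ('o, 'm) nseq \<Rightarrow> ('o, 'm) nseq \<Rightarrow> 'm list \<Rightarrow> 'm list \<Rightarrow> 'm list \<Rightarrow> 'm list \<Rightarrow> bool" where
  "joint_retract S X Y i1 p1 i2 p2 \<longleftrightarrow>
     nmor X S i1 \<and> nmor S X p1 \<and> nmor Y S i2 \<and> nmor S Y p2 \<and>
     (\<forall>j < n. i1 ! j \<cdot> p1 ! j \<oplus> i2 ! j \<cdot> p2 ! j = ident (fst S ! j))"

lemma summand_joint_retract:
  assumes "nseq X" "nseq Y" "is_nseq_summand C SO SM n X Y"
  obtains i1 p1 i2 p2 where "joint_retract X Y Y i1 p1 i2 p2"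
proof -
  obtain phi psi where h: "nmor X Y phi" "nmor Y X psi" "\<forall>j < n. psi ! j \<cdot> phi ! j = ident (fst X ! j)"
    using assms(3) unfolding is_nseq_summand_def by blast
  let ?z = "map (\<lambda>j. zero (fst Y ! j) (fst X ! j)) [0..<n]"
  have "joint_retract X Y Y psi phi ?z phi"
    unfolding joint_retract_def using h nmor_zero[OF assms(2,1)] nmorD[OF h(1)]
      nseqD[OF assms(1)] nseqD[OF assms(2)] by auto
  then show thesis using that by blast
qed

text \<open>Each test morphism \<open>h\<close> splits as \<open>i1 p1 h + i2 p2 h\<close>. The two
  parts are pushed to \<open>X\<close> and \<open>Y\<close>, where composites vanish and lifts
  exist, and the results are carried back by \<open>i1\<close> and \<open>i2\<close>.\<close>

lemma is_exact_joint_retract: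
  assumes S: "nseq S" and X: "nseq X" and Y: "nseq Y"
    and ex: "is_exact C SO SM n X" "is_exact C SO SM n Y"
    and jr: "joint_retract S X Y i1 p1 i2 p2"
  shows "is_exact C SO SM n S"
proof -
  have m: "nmor X S i1" "nmor S X p1" "nmor Y S i2" "nmor S Y p2"
    and one: "\<And>j. j < n \<Longrightarrow> i1 ! j \<cdot> p1 ! j \<oplus> i2 ! j \<cdot> p2 ! j = ident (fst S ! j)"
    using jr unfolding joint_retract_def by auto
  let ?i = "um ([], i1)" and ?p = "um ([], p1)" and ?i' = "um ([], i2)" and ?p' = "um ([], p2)"
  have H: "?i k \<in> Mor" "dom (?i k) = uo X k" "cod (?i k) = uo S k"
    "?p k \<in> Mor" "dom (?p k) = uo S k" "cod (?p k) = uo X k"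
    "?i' k \<in> Mor" "dom (?i' k) = uo Y k" "cod (?i' k) = uo S k"
    "?p' k \<in> Mor" "dom (?p' k) = uo S k" "cod (?p' k) = uo Y k" for k
    using unr_mor_hom[OF m(1) X S, of k] unr_mor_hom[OF m(2) S X, of k]
      unr_mor_hom[OF m(3) Y S, of k] unr_mor_hom[OF m(4) S Y, of k] by (auto simp: hom_iff)
  have U: "um Z k \<in> Mor" "dom (um Z k) = uo Z k" "cod (um Z k) = uo Z (k + 1)" "uo Z k \<in> Ob"
    if "nseq Z" for Z k
    using um_hom[OF that, of k] uo_ob[OF that] by (auto simp: hom_iff)
  \<comment> \<open>Suspension is additive and injective, so the relation passes between
    \<open>k\<close> and \<open>k + n\<close> in both directions.\<close>
  have one: "?i k \<cdot> ?p k \<oplus> ?i' k \<cdot> ?p' k = ident (uo S k)" for k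
  proof (induction k rule: periodic_induct)
    case (1 j)
    then show ?case using one by (simp add: um_eq uo_eq)
  next
    case (2 k)
    have per: "?i (k + int n) = SM (?i k)" "?p (k + int n) = SM (?p k)"
      "?i' (k + int n) = SM (?i' k)" "?p' (k + int n) = SM (?p' k)" "uo S (k + int n) = SO (uo S k)"
      using nmorD[OF m(1)] nmorD[OF m(2)] nmorD[OF m(3)] nmorD[OF m(4)] nseqD[OF S]
      by (auto intro!: um_period uo_period)
    have "SM (?i k \<cdot> ?p k \<oplus> ?i' k \<cdot> ?p' k) = SM (?i k) \<cdot> SM (?p k) \<oplus> SM (?i' k) \<cdot> SM (?p' k)"
      using H by simp
    moreover have "SM (ident (uo S k)) = ident (SO (uo S k))" using U[OF S] by simp
    moreover have "?i k \<cdot> ?p k \<oplus> ?i' k \<cdot> ?p' k \<in> Mor" "ident (uo S k) \<in> Mor" using H U[OF S] by simp_all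
    ultimately show ?case unfolding per by (metis SM_eq_iff)
  qed
  have split: "h = ?i k \<cdot> ?p k \<cdot> h \<oplus> ?i' k \<cdot> ?p' k \<cdot> h" if "h \<in> Mor" "cod h = uo S k" for h k
  proof -
    have "h = (?i k \<cdot> ?p k \<oplus> ?i' k \<cdot> ?p' k) \<cdot> h" unfolding one using that by simp
    then show ?thesis using that H by simp
  qed
  note c = unr_mor_commute[OF m(1) X S] unr_mor_commute[OF m(2) S X]
    unr_mor_commute[OF m(3) Y S] unr_mor_commute[OF m(4) S Y]
  have push: "?p (k + 1) \<cdot> um S k \<cdot> h = um X k \<cdot> ?p k \<cdot> h" "?p' (k + 1) \<cdot> um S k \<cdot> h = um Y k \<cdot> ?p' k \<cdot> h"
    if "h \<in> Mor" "cod h = uo S k" for h k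
  proof -
    have "(?p (k + 1) \<cdot> um S k) \<cdot> h = (um X k \<cdot> ?p k) \<cdot> h" "(?p' (k + 1) \<cdot> um S k) \<cdot> h = (um Y k \<cdot> ?p' k) \<cdot> h"
      by (simp_all only: c)
    then show "?p (k + 1) \<cdot> um S k \<cdot> h = um X k \<cdot> ?p k \<cdot> h" "?p' (k + 1) \<cdot> um S k \<cdot> h = um Y k \<cdot> ?p' k \<cdot> h"
      using that H U[OF S] U[OF X] U[OF Y] by simp_all
  qed
  have pull: "?i (k + 1) \<cdot> um X k \<cdot> h = um S k \<cdot> ?i k \<cdot> h" if "h \<in> Mor" "cod h = uo X k" for h k
  proof -
    have "(?i (k + 1) \<cdot> um X k) \<cdot> h = (um S k \<cdot> ?i k) \<cdot> h" by (simp only: c)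
    then show ?thesis using that H U[OF S] U[OF X] by simp
  qed
  have pull': "?i' (k + 1) \<cdot> um Y k \<cdot> h = um S k \<cdot> ?i' k \<cdot> h" if "h \<in> Mor" "cod h = uo Y k" for h k
  proof -
    have "(?i' (k + 1) \<cdot> um Y k) \<cdot> h = (um S k \<cdot> ?i' k) \<cdot> h" by (simp only: c)
    then show ?thesis using that H U[OF S] U[OF Y] by simp
  qed
  have "exact_pair (um S k) (um S (k + 1))" for k
    unfolding exact_pair_def
  proof (intro conjI ballI impI)
    have exX: "exact_pair (um X k) (um X (k + 1))" and exY: "exact_pair (um Y k) (um Y (k + 1))"
      using ex is_exact_iff X Y by auto
    have z: "um X (k + 1) \<cdot> um X k \<cdot> h = zero (dom h) (uo X (k + 1 + 1))" if "h \<in> Mor" "cod h = uo X k" for h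
    proof -
      have "(um X (k + 1) \<cdot> um X k) \<cdot> h = zero (uo X k) (uo X (k + 1 + 1)) \<cdot> h"
        using exX U[OF X] unfolding exact_pair_def by simp
      then show ?thesis using U[OF X] that by simp
    qed
    have z': "um Y (k + 1) \<cdot> um Y k \<cdot> h = zero (dom h) (uo Y (k + 1 + 1))" if "h \<in> Mor" "cod h = uo Y k" for h
    proof -
      have "(um Y (k + 1) \<cdot> um Y k) \<cdot> h = zero (uo Y k) (uo Y (k + 1 + 1)) \<cdot> h"
        using exY U[OF Y] unfolding exact_pair_def by simp
      then show ?thesis using U[OF Y] that by simp
    qed
    have "um S (k + 1) \<cdot> um S k =
      ?i (k + 1 + 1) \<cdot> um X (k + 1) \<cdot> um X k \<cdot> ?p k \<oplus> ?i' (k + 1 + 1) \<cdot> um Y (k + 1) \<cdot> um Y k \<cdot> ?p' k"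
      using split[of "um S (k + 1) \<cdot> um S k" "k + 1 + 1"] push[of "um S k" "k + 1"]
        push[of "ident (uo S k)" k] U[OF S] H by simp
    then show "um S (k + 1) \<cdot> um S k = zero (dom (um S k)) (cod (um S (k + 1)))"
      using z[of "?p k"] z'[of "?p' k"] H U[OF S] U[OF X] U[OF Y] by simp
    fix h assume h: "h \<in> Mor" "cod h = dom (um S (k + 1))" "um S (k + 1) \<cdot> h = zero (dom h) (cod (um S (k + 1)))"
    have k: "um X (k + 1) \<cdot> ?p (k + 1) \<cdot> h = zero (dom h) (uo X (k + 1 + 1))"
      "um Y (k + 1) \<cdot> ?p' (k + 1) \<cdot> h = zero (dom h) (uo Y (k + 1 + 1))"
      using push[of h "k + 1", symmetric] h H U[OF S] by simp_all
    obtain g where g: "g \<in> hom (dom h) (uo X k)" "um X k \<cdot> g = ?p (k + 1) \<cdot> h"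
      using exX k(1) h U[OF X] U[OF S] H unfolding exact_pair_def
      by (elim conjE ballE[of _ _ "?p (k + 1) \<cdot> h"]) auto
    obtain g' where g': "g' \<in> hom (dom h) (uo Y k)" "um Y k \<cdot> g' = ?p' (k + 1) \<cdot> h"
      using exY k(2) h U[OF Y] U[OF S] H unfolding exact_pair_def
      by (elim conjE ballE[of _ _ "?p' (k + 1) \<cdot> h"]) auto
    have "um S k \<cdot> (?i k \<cdot> g \<oplus> ?i' k \<cdot> g') = ?i (k + 1) \<cdot> um X k \<cdot> g \<oplus> ?i' (k + 1) \<cdot> um Y k \<cdot> g'"
      using pull[of g k] pull'[of g' k] g(1) g'(1) H U[OF S] by (simp add: hom_iff)
    also have "\<dots> = h" unfolding g g' using split[of h "k + 1"] h U[OF S] by simp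
    finally show "\<exists>t \<in> hom (dom h) (dom (um S k)). um S k \<cdot> t = h"
      using g(1) g'(1) H U[OF S] by (intro bexI[of _ "?i k \<cdot> g \<oplus> ?i' k \<cdot> g'"]) (auto simp: hom_iff)
  qed
  then show ?thesis using is_exact_iff[OF S] by simp
qed

lemma is_biproduct_SM:
  assumes "is_biproduct C A B S i1 i2 p1 p2"
  shows "is_biproduct C (SO A) (SO B) (SO S) (SM i1) (SM i2) (SM p1) (SM p2)"
proof -
  note h = biproductD[OF assms]
  have ob: "A \<in> Ob" "B \<in> Ob" "S \<in> Ob" using h hom_ob by blast+
  have "SM (p1 \<cdot> i1) = SM p1 \<cdot> SM i1" "SM (p2 \<cdot> i2) = SM p2 \<cdot> SM i2"
    "SM (i1 \<cdot> p1 \<oplus> i2 \<cdot> p2) = SM i1 \<cdot> SM p1 \<oplus> SM i2 \<cdot> SM p2"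
    using h(1-4) by (simp_all add: hom_iff)
  then show ?thesis unfolding is_biproduct_def using h ob SM_hom by auto
qed

text \<open>The maps of \<open>S\<close> are diagonal with respect to the biproducts, so the
  orthogonality relations make inclusions and projections commute with them; the last square uses
  these relations after suspension.\<close>

lemma dsum_joint_retract:
  assumes "is_nseq_dsum C SO SM n X Y S" "nseq X" "nseq Y"
  obtains i1 p1 i2 p2 where "nseq S" "joint_retract S X Y i1 p1 i2 p2"
    "\<And>j. j < n \<Longrightarrow> is_biproduct C (fst X ! j) (fst Y ! j) (fst S ! j) (i1 ! j) (i2 ! j) (p1 ! j) (p2 ! j)"
proof -
  obtain i1 i2 p1 p2 where len: "length i1 = n" "length i2 = n" "length p1 = n" "length p2 = n"
    and bi: "\<And>j. j < n \<Longrightarrow> is_biproduct C (fst X ! j) (fst Y ! j) (fst S ! j) (i1 ! j) (i2 ! j) (p1 ! j) (p2 ! j)"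
    and s: "\<And>j. j + 1 < n \<Longrightarrow> snd S ! j = i1 ! (j + 1) \<cdot> snd X ! j \<cdot> p1 ! j \<oplus> i2 ! (j + 1) \<cdot> snd Y ! j \<cdot> p2 ! j"
      "snd S ! (n - 1) = SM (i1 ! 0) \<cdot> snd X ! (n - 1) \<cdot> p1 ! (n - 1) \<oplus> SM (i2 ! 0) \<cdot> snd Y ! (n - 1) \<cdot> p2 ! (n - 1)"
    and lenS: "length (fst S) = n" "length (snd S) = n"
    using assms(1) unfolding is_nseq_dsum_def by blast
  have 0: "0 < n" using n_ge_3 by simp
  have s: "snd S ! j = next_mor i1 j \<cdot> snd X ! j \<cdot> p1 ! j \<oplus> next_mor i2 j \<cdot> snd Y ! j \<cdot> p2 ! j"
    if j: "j < n" for j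
  proof (cases "Suc j < n")
    case True
    then show ?thesis using s(1)[of j] by (simp add: next_mor_def)
  next
    case False
    then have "j = n - 1" using j by simp
    then show ?thesis using s(2) False by (simp add: next_mor_def)
  qed
  have bi': "is_biproduct C (next_obj (fst X) j) (next_obj (fst Y) j) (next_obj (fst S) j)
      (next_mor i1 j) (next_mor i2 j) (next_mor p1 j) (next_mor p2 j)" if "j < n" for j
    using bi[of "Suc j"] is_biproduct_SM[OF bi[OF 0]] that by (auto simp: next_mor_def next_obj_def)
  have H: "i1 ! j \<in> Mor" "dom (i1 ! j) = fst X ! j" "cod (i1 ! j) = fst S ! j"
    "i2 ! j \<in> Mor" "dom (i2 ! j) = fst Y ! j" "cod (i2 ! j) = fst S ! j"
    "p1 ! j \<in> Mor" "dom (p1 ! j) = fst S ! j" "cod (p1 ! j) = fst X ! j"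
    "p2 ! j \<in> Mor" "dom (p2 ! j) = fst S ! j" "cod (p2 ! j) = fst Y ! j" if "j < n" for j
    using biproductD(1-4)[OF bi[OF that]] by (auto simp: hom_iff)
  have H': "next_mor i1 j \<in> Mor" "dom (next_mor i1 j) = next_obj (fst X) j" "cod (next_mor i1 j) = next_obj (fst S) j"
    "next_mor i2 j \<in> Mor" "dom (next_mor i2 j) = next_obj (fst Y) j" "cod (next_mor i2 j) = next_obj (fst S) j"
    "next_mor p1 j \<in> Mor" "dom (next_mor p1 j) = next_obj (fst S) j" "cod (next_mor p1 j) = next_obj (fst X) j"
    "next_mor p2 j \<in> Mor" "dom (next_mor p2 j) = next_obj (fst S) j" "cod (next_mor p2 j) = next_obj (fst Y) j"
    if "j < n" for j
    using biproductD(1-4)[OF bi'[OF that]] by (auto simp: hom_iff)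
  note XY = nseqD[OF assms(2)] nseqD[OF assms(3)]
  have "snd S ! j \<in> hom (fst S ! j) (next_obj (fst S) j)" if "j < n" for j
    unfolding s[OF that] using that H H' XY by (simp add: hom_iff)
  then have S: "nseq S" unfolding nseq_iff using lenS by blast
  have e: "next_mor p1 j \<cdot> next_mor i1 j \<cdot> g = g" "next_mor p2 j \<cdot> next_mor i1 j \<cdot> g = zero (dom g) (next_obj (fst Y) j)"
    if "g \<in> Mor" "cod g = next_obj (fst X) j" "j < n" for g j
  proof -
    have "(next_mor p1 j \<cdot> next_mor i1 j) \<cdot> g = g" "(next_mor p2 j \<cdot> next_mor i1 j) \<cdot> g = zero (dom g) (next_obj (fst Y) j)"
      using biproductD(5,9)[OF bi'[OF that(3)]] that XY by simp_all
    then show "next_mor p1 j \<cdot> next_mor i1 j \<cdot> g = g" "next_mor p2 j \<cdot> next_mor i1 j \<cdot> g = zero (dom g) (next_obj (fst Y) j)"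
      using H'[OF that(3)] that by simp_all
  qed
  have e': "next_mor p2 j \<cdot> next_mor i2 j \<cdot> g = g" "next_mor p1 j \<cdot> next_mor i2 j \<cdot> g = zero (dom g) (next_obj (fst X) j)"
    if "g \<in> Mor" "cod g = next_obj (fst Y) j" "j < n" for g j
  proof -
    have "(next_mor p2 j \<cdot> next_mor i2 j) \<cdot> g = g" "(next_mor p1 j \<cdot> next_mor i2 j) \<cdot> g = zero (dom g) (next_obj (fst X) j)"
      using biproductD(6,8)[OF bi'[OF that(3)]] that XY by simp_all
    then show "next_mor p2 j \<cdot> next_mor i2 j \<cdot> g = g" "next_mor p1 j \<cdot> next_mor i2 j \<cdot> g = zero (dom g) (next_obj (fst X) j)"
      using H'[OF that(3)] that by simp_all
  qed
  have "next_mor p1 j \<cdot> snd S ! j = snd X ! j \<cdot> p1 ! j" "next_mor p2 j \<cdot> snd S ! j = snd Y ! j \<cdot> p2 ! j"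
    if "j < n" for j
    unfolding s[OF that] using that H H' e e' XY by simp_all
  then have "nmor S X p1" "nmor S Y p2"
    unfolding nmor_iff using len biproductD(3,4)[OF bi] by blast+
  moreover have "next_mor i1 j \<cdot> snd X ! j = snd S ! j \<cdot> i1 ! j" "next_mor i2 j \<cdot> snd Y ! j = snd S ! j \<cdot> i2 ! j"
    if "j < n" for j
    unfolding s[OF that] using that H H' XY biproductD(5,6,8,9)[OF bi] by simp_all
  then have "nmor X S i1" "nmor Y S i2"
    unfolding nmor_iff using len biproductD(1,2)[OF bi] by blast+
  ultimately have "joint_retract S X Y i1 p1 i2 p2"
    unfolding joint_retract_def using biproductD(7)[OF bi] by auto
  then show thesis using that S bi by blast
qed

lemma dsum_exists:
  assumes "nseq X" "nseq Y" obtains S where "is_nseq_dsum C SO SM n X Y S"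
proof -
  \<comment> \<open>A biproduct must be chosen at every place; its five data are packed into one
    tuple so that a single choice function suffices.\<close>
  have "\<exists>b. is_biproduct C (fst X ! j) (fst Y ! j) (fst b) (fst (snd b)) (fst (snd (snd b)))
      (fst (snd (snd (snd b)))) (snd (snd (snd (snd b))))" if "j < n" for j
    using additive nseqD(3)[OF assms(1) that] nseqD(3)[OF assms(2) that]
    unfolding is_additive_category_def by (metis fst_conv snd_conv)
  then obtain b where b: "\<And>j. j < n \<Longrightarrow> is_biproduct C (fst X ! j) (fst Y ! j) (fst (b j)) (fst (snd (b j))) (fst (snd (snd (b j))))
      (fst (snd (snd (snd (b j))))) (snd (snd (snd (snd (b j)))))" by metis
  define i1 where "i1 = map (\<lambda>j. fst (snd (b j))) [0..<n]"
  define i2 where "i2 = map (\<lambda>j. fst (snd (snd (b j)))) [0..<n]"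
  define p1 where "p1 = map (\<lambda>j. fst (snd (snd (snd (b j))))) [0..<n]"
  define p2 where "p2 = map (\<lambda>j. snd (snd (snd (snd (b j))))) [0..<n]"
  define S where "S = (map (\<lambda>j. fst (b j)) [0..<n],
    map (\<lambda>j. next_mor i1 j \<cdot> snd X ! j \<cdot> p1 ! j \<oplus> next_mor i2 j \<cdot> snd Y ! j \<cdot> p2 ! j) [0..<n])"
  have n1: "\<not> Suc (n - 1) < n" by simp
  have len: "length i1 = n" "length i2 = n" "length p1 = n" "length p2 = n" "length (fst S) = n" "length (snd S) = n"
    by (simp_all add: S_def i1_def i2_def p1_def p2_def)
  have bi: "\<forall>j < n. is_biproduct C (fst X ! j) (fst Y ! j) (fst S ! j) (i1 ! j) (i2 ! j) (p1 ! j) (p2 ! j)"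
    using b by (simp add: S_def i1_def i2_def p1_def p2_def)
  have "\<forall>j. j + 1 < n \<longrightarrow> snd S ! j = i1 ! (j + 1) \<cdot> snd X ! j \<cdot> p1 ! j \<oplus> i2 ! (j + 1) \<cdot> snd Y ! j \<cdot> p2 ! j"
    "snd S ! (n - 1) = SM (i1 ! 0) \<cdot> snd X ! (n - 1) \<cdot> p1 ! (n - 1) \<oplus> SM (i2 ! 0) \<cdot> snd Y ! (n - 1) \<cdot> p2 ! (n - 1)"
    using n_ge_3 n1 by (auto simp: S_def next_mor_def)
  then have "is_nseq_dsum C SO SM n X Y S"
    unfolding is_nseq_dsum_def using len bi by blast
  then show thesis using that by blast
qed

lemma um_0_1: "um X 0 = snd X ! 0" "um X 1 = snd X ! 1"
  using um_eq[of 0 X] um_eq[of 1 X] n_ge_3 by simp_all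

lemma next_obj_small: "next_obj As 0 = As ! 1" "next_obj As 1 = As ! 2" "next_obj As (Suc 0) = As ! 2"
  using n_ge_3 by (auto simp: next_obj_def numeral_2_eq_2)

lemma next_mor_small: "next_mor fs 0 = fs ! 1" "next_mor fs 1 = fs ! 2" "next_mor fs (Suc 0) = fs ! 2"
  using n_ge_3 by (auto simp: next_mor_def numeral_2_eq_2)

lemma triv_nseq_nth:
  "fst (triv_nseq C SO n Z A) ! 0 = A" "fst (triv_nseq C SO n Z A) ! 1 = A"
  "2 \<le> j \<Longrightarrow> j < n \<Longrightarrow> fst (triv_nseq C SO n Z A) ! j = Z"
  "snd (triv_nseq C SO n Z A) ! 0 = ident A" "snd (triv_nseq C SO n Z A) ! 1 = zero A Z"
  by (auto simp: triv_nseq_def nth_append nth_Cons' numeral_2_eq_2)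

section \<open>Members are exact; consequences of (N1*)\<close>

text \<open>Both halves compare \<open>X\<close> with a trivial sequence by (N3). A morphism from
  the trivial sequence on the first object, starting with the identity and the first map of
  \<open>X\<close>, makes the composite of the first two maps factor through a zero object. If
  \<open>h\<close> is killed by the second map, \<open>h\<close> and \<open>0\<close> start a
  morphism between the rotated sequences, whose last component is the suspension of a lift of
  \<open>h\<close>.\<close>

lemma exact_at_start_of_mem:
  assumes sub: "\<forall>X \<in> N. nseq X" and N1b: "N1b C SO n N" and N2s: "N2star C SO SM n N"
    and N3: "N3 C SO SM n N" and X: "X \<in> N"
  shows "exact_pair (snd X ! 0) (snd X ! 1)"
  unfolding exact_pair_def
proof (intro conjI ballI impI)
  have n: "0 < n" "1 < n" "2 < n" "n - 1 < n" "\<not> Suc (n - 1) < n" using n_ge_3 by auto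
  have sX: "nseq X" using sub X by blast
  obtain Z where Z: "is_zero_object C Z" "Z \<in> Ob"
    using additive unfolding is_additive_category_def is_zero_object_def by blast
  note x = nseqD[OF sX, of 0, unfolded next_obj_small] nseqD[OF sX, of 1, unfolded next_obj_small]
  have T: "triv_nseq C SO n Z B \<in> N" "nseq (triv_nseq C SO n Z B)" if "B \<in> Ob" for B
    using N1b that Z sub unfolding N1b_def by blast+
  show "snd X ! 1 \<cdot> snd X ! 0 = zero (dom (snd X ! 0)) (cod (snd X ! 1))"
  proof -
    let ?A = "fst X ! 0" and ?T = "triv_nseq C SO n Z (fst X ! 0)"
    have "ident ?A \<in> hom (fst ?T ! 0) (fst X ! 0)" "snd X ! 0 \<in> hom (fst ?T ! 1) (fst X ! 1)"
      "snd X ! 0 \<cdot> snd ?T ! 0 = snd X ! 0 \<cdot> ident ?A"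
      using x n by (simp_all add: triv_nseq_nth triv_nseq_nth[unfolded One_nat_def] hom_iff)
    then obtain phi where phi: "nmor ?T X phi" "phi ! 1 = snd X ! 0"
      using N3 T(1)[of ?A] X x n unfolding N3_def by blast
    have "phi ! 2 \<cdot> zero ?A Z = snd X ! 1 \<cdot> snd X ! 0"
      using nmorD(5)[OF phi(1), of 1] n phi(2) by (simp only: next_mor_small triv_nseq_nth)
    then show ?thesis using nmorD(2-4)[OF phi(1), of 2] n x Z by (simp add: triv_nseq_nth)
  qed
  fix h assume h: "h \<in> Mor" "cod h = dom (snd X ! 1)" "snd X ! 1 \<cdot> h = zero (dom h) (cod (snd X ! 1))"
  let ?B = "dom h" let ?T = "triv_nseq C SO n Z ?B"
  have B: "?B \<in> Ob" using h by simp
  note LT = nth_left_rot[OF T(2)[OF B]] and LX = nth_left_rot[OF sX]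
  have "h \<in> hom (fst (L ?T) ! 0) (fst (L X) ! 0)" 
    "zero Z (fst X ! 2) \<in> hom (fst (L ?T) ! 1) (fst (L X) ! 1)"
    "zero Z (fst X ! 2) \<cdot> snd (L ?T) ! 0 = snd (L X) ! 0 \<cdot> h"
    using LT[of 0] LT[of 1] LX[of 0] LX[of 1] n h x Z B
    by (simp_all add: next_obj_small[unfolded One_nat_def] triv_nseq_nth[unfolded One_nat_def] hom_iff)
  moreover have "L ?T \<in> N" "L X \<in> N" using N2s T(1)[OF B] X unfolding N2star_def by blast+
  ultimately obtain phi where phi: "nmor (L ?T) (L X) phi" "phi ! 0 = h"
    using N3 unfolding N3_def by blast
  have f: "phi ! (n - 1) \<in> hom (SO ?B) (SO (fst X ! 0))"
    using nmorD(1)[OF phi(1) n(4)] LT(1)[OF n(4)] LX(1)[OF n(4)] n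
    by (simp add: next_obj_def triv_nseq_nth)
  have "SM h \<cdot> rot_sign (SM (ident ?B)) = rot_sign (SM (snd X ! 0)) \<cdot> phi ! (n - 1)"
    using nmorD(5)[OF phi(1) n(4)] LT(2)[OF n(4)] LX(2)[OF n(4)] n phi(2)
    by (simp add: next_mor_def triv_nseq_nth)
  \<comment> \<open>The last maps of both rotated sequences carry the same sign, so it
    cancels.\<close>
  then have "rot_sign (SM h) = rot_sign (SM (snd X ! 0) \<cdot> phi ! (n - 1))"
    using h x n f B by (simp add: hom_iff)
  then have eq: "SM h = SM (snd X ! 0) \<cdot> phi ! (n - 1)"
    using h x n f by (simp add: hom_iff)
  obtain g where g: "g \<in> hom ?B (fst X ! 0)" "SM g = phi ! (n - 1)"
    using SM_surj[OF f] B x n by blast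
  have "SM h = SM (snd X ! 0 \<cdot> g)" using eq g x n by (simp add: hom_iff)
  moreover have "snd X ! 0 \<cdot> g \<in> Mor" using g(1) x n by (simp add: hom_iff)
  ultimately have "snd X ! 0 \<cdot> g = h" using SM_eq_iff h(1) by metis
  then show "\<exists>t \<in> hom (dom h) (dom (snd X ! 0)). snd X ! 0 \<cdot> t = h"
    using g(1) x(4) n by (intro bexI[of _ g]) auto
qed

text \<open>Rotating \<open>m\<close> times brings place \<open>m\<close> to the start. As
  \<open>N2star\<close> rotates in one direction, this reaches the non-negative places; periodicity
  gives the others.\<close>

lemma exact_of_mem:
  assumes sub: "\<forall>X \<in> N. nseq X" and N1b: "N1b C SO n N" and N2s: "N2star C SO SM n N"
    and N3: "N3 C SO SM n N" and X: "X \<in> N"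
  shows "is_exact C SO SM n X"
proof -
  have *: "X \<in> N \<Longrightarrow> exact_pair (um X (int m)) (um X (int m + 1))" for m X
  proof (induction m arbitrary: X)
    case 0
    then show ?case using exact_at_start_of_mem[OF assms(1-4)] um_0_1 by simp
  next
    case (Suc m)
    then have "L X \<in> N" using N2s unfolding N2star_def by blast
    from Suc.IH[OF this] exact_pair_left_rot[of X "int m"] show ?case
      using sub Suc.prems by (simp add: add_ac)
  qed
  have "exact_pair (um X k) (um X (k + 1))" for k
  proof (induction k rule: periodic_induct)
    case (1 j)
    then show ?case using *[OF X] by simp
  next
    case (2 k)
    then show ?case using exact_pair_period sub X by simp
  qed
  then show ?thesis using is_exact_iff sub X by blast
qed

lemma weak_iso_of_ident:
  assumes "nmor X Y phi" "phi ! 0 = ident A" "phi ! 1 = ident B" "A \<in> Ob" "B \<in> Ob"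
  shows "is_nseq_weak_iso C SO SM n X Y phi"
  unfolding is_nseq_weak_iso_def using assms is_iso_ident n_ge_3 by (auto intro!: exI[of _ 0])

text \<open>(N3) extends the first two components of \<open>p1\<close> and \<open>p2\<close> to
  morphisms \<open>f\<close> and \<open>g\<close> out of a member \<open>Z\<close> that begins like
  \<open>S\<close>. The sum of \<open>i1 f\<close> and \<open>i2 g\<close> is the identity at places
  0 and 1 by the relation \<open>i1 p1 + i2 p2 = 1\<close>.\<close>

lemma joint_retract_mem:
  assumes sub: "\<forall>X \<in> N. nseq X" and ex: "\<forall>X \<in> N. is_exact C SO SM n X"
    and N1s: "N1star C SO SM n N" and N3: "N3 C SO SM n N"
    and S: "nseq S" and XY: "X \<in> N" "Y \<in> N" and jr: "joint_retract S X Y i1 p1 i2 p2"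
  shows "S \<in> N"
proof -
  have n: "0 < n" "1 < n" using n_ge_3 by auto
  have sX: "nseq X" "nseq Y" using sub XY by auto
  have exS: "is_exact C SO SM n S" using is_exact_joint_retract[OF S sX _ _ jr] ex XY by blast
  note s = nseqD[OF S, of 0, unfolded next_obj_small] nseqD[OF S, of 1]
  have m: "nmor X S i1" "nmor S X p1" "nmor Y S i2" "nmor S Y p2"
    and one: "\<And>j. j < n \<Longrightarrow> i1 ! j \<cdot> p1 ! j \<oplus> i2 ! j \<cdot> p2 ! j = ident (fst S ! j)"
    using jr unfolding joint_retract_def by auto
  obtain Z where Z: "Z \<in> N" "fst Z ! 0 = fst S ! 0" "fst Z ! 1 = fst S ! 1" "snd Z ! 0 = snd S ! 0"
    using N1s s n unfolding N1star_def N1c_def by metis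
  have sZ: "nseq Z" using sub Z by blast
  have lift: "\<exists>phi. nmor Z W phi \<and> phi ! 0 = p ! 0 \<and> phi ! 1 = p ! 1" if "W \<in> N" "nmor S W p" for W p
    using N3 Z that(1) nmorD(1)[OF that(2), of 0] nmorD(1)[OF that(2), of 1]
      nmorD(5)[OF that(2), of 0, unfolded next_mor_small] n
    unfolding N3_def by metis
  obtain f where f: "nmor Z X f" "f ! 0 = p1 ! 0" "f ! 1 = p1 ! 1" using lift XY m by blast
  obtain g where g: "nmor Z Y g" "g ! 0 = p2 ! 0" "g ! 1 = p2 ! 1" using lift XY m by blast
  have t: "nmor Z S (map (\<lambda>j. map (\<lambda>j. i1 ! j \<cdot> f ! j) [0..<n] ! j \<oplus> map (\<lambda>j. i2 ! j \<cdot> g ! j) [0..<n] ! j) [0..<n])"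
    (is "nmor Z S ?t")
    by (intro nmor_plus nmor_comp[OF sZ sX(1) S] nmor_comp[OF sZ sX(2) S] sZ S f g m)
  have "?t ! 0 = ident (fst S ! 0)" "?t ! 1 = ident (fst S ! 1)"
    using one n f g by simp_all
  then have "is_nseq_weak_iso C SO SM n Z S ?t"
    using n by (intro weak_iso_of_ident[OF t _ _ nseqD(3)[OF S, of 0] nseqD(3)[OF S, of 1]])
  then show ?thesis using N1s Z sZ S ex exS unfolding N1star_def by blast
qed

text \<open>The componentwise inverses commute with the maps and so form a retraction of
  \<open>phi\<close>. Closure under isomorphisms thus becomes a case of closure under
  summands.\<close>

lemma iso_summand:
  assumes "nseq X" "nseq Y" "is_nseq_iso C SO SM n X Y phi"
  shows "is_nseq_summand C SO SM n X Y"
proof -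
  have m: "nmor X Y phi" and iso: "\<And>j. j < n \<Longrightarrow> is_iso C (phi ! j)"
    using assms(3) unfolding is_nseq_iso_def by auto
  have "\<exists>g \<in> hom (fst Y ! j) (fst X ! j). g \<cdot> phi ! j = ident (fst X ! j) \<and> phi ! j \<cdot> g = ident (fst Y ! j)" if "j < n" for j
    using iso[OF that] nmorD(3,4)[OF m that] unfolding is_iso_def by auto
  then obtain g where g: "\<And>j. j < n \<Longrightarrow> g j \<in> hom (fst Y ! j) (fst X ! j)"
    "\<And>j. j < n \<Longrightarrow> g j \<cdot> phi ! j = ident (fst X ! j)" "\<And>j. j < n \<Longrightarrow> phi ! j \<cdot> g j = ident (fst Y ! j)"
    by metis
  let ?g = "map g [0..<n]"
  have "next_mor ?g j \<cdot> snd Y ! j = snd X ! j \<cdot> ?g ! j" if j: "j < n" for j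
  proof -
    note gh = next_mor_hom[of g, OF g(1) j]
    have "next_mor ?g j \<cdot> next_mor phi j = ident (next_obj (fst X) j)"
    proof (cases "Suc j < n")
      case False
      have "SM (g 0) \<cdot> SM (phi ! 0) = SM (g 0 \<cdot> phi ! 0)"
        using g(1)[of 0] nmorD(1)[OF m, of 0] j by (intro SM_comp[symmetric]) (auto simp: hom_iff)
      then show ?thesis using j False g(2)[of 0] nseqD(3)[OF assms(1), of 0]
        by (auto simp: next_mor_map next_mor_def next_obj_def)
    qed (use j g(2) in \<open>auto simp: next_mor_map next_mor_def next_obj_def\<close>)
    then have "snd X ! j \<cdot> g j = (next_mor ?g j \<cdot> next_mor phi j) \<cdot> snd X ! j \<cdot> g j"
      using j g(1) nseqD[OF assms(1)] by (simp add: hom_iff)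
    also have "\<dots> = next_mor ?g j \<cdot> (next_mor phi j \<cdot> snd X ! j) \<cdot> g j"
      using j gh g(1) nseqD[OF assms(1)] nmorD(6-9)[OF m] by (simp add: hom_iff)
    also have "\<dots> = next_mor ?g j \<cdot> snd Y ! j \<cdot> (phi ! j \<cdot> g j)"
      using j gh g(1) nseqD[OF assms(2)] nmorD[OF m] by (simp add: hom_iff)
    also have "\<dots> = next_mor ?g j \<cdot> snd Y ! j"
      unfolding g(3)[OF j] using j nseqD[OF assms(2)] by simp
    finally show ?thesis using j by simp
  qed
  then have "nmor Y X ?g" unfolding nmor_iff using g by simp
  moreover have "\<forall>j < n. ?g ! j \<cdot> phi ! j = ident (fst X ! j)" using g by simp
  ultimately show ?thesis unfolding is_nseq_summand_def using m by blast
qed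

lemma N1a_of_N1star:
  assumes sub: "\<forall>X \<in> N. nseq X" and N1s: "N1star C SO SM n N" and N2s: "N2star C SO SM n N" and N3: "N3 C SO SM n N"
  shows "N1a C SO SM n N"
proof -
  have ex: "\<forall>X \<in> N. is_exact C SO SM n X"
    using exact_of_mem[OF sub _ N2s N3] N1s unfolding N1star_def by blast
  note mem = joint_retract_mem[OF sub ex N1s N3]
  have summand: "X \<in> N" if "nseq X" "Y \<in> N" "is_nseq_summand C SO SM n X Y" for X Y
    using summand_joint_retract[OF that(1) _ that(3)] mem[OF that(1,2,2)] that sub by blast
  have "S \<in> N" if "X \<in> N" "Y \<in> N" "is_nseq_dsum C SO SM n X Y S" for X Y S
    using dsum_joint_retract[OF that(3)] mem[OF _ that(1,2)] that sub by (metis (no_types))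
  then show ?thesis unfolding N1a_def using summand iso_summand sub by blast
qed

section \<open>Full turns and the converse half of (N2)\<close>

text \<open>For \<open>m = n\<close> this is the termwise suspension with the same sign on every
  map, and that can be undone.\<close>

lemma left_rot_funpow:
  assumes "length (fst X) = n" "length (snd X) = n" "m \<le> n"
  shows "(L ^^ m) X = (drop m (fst X) @ map SO (take m (fst X)),
    drop m (snd X) @ map (\<lambda>f. rot_sign (SM f)) (take m (snd X)))"
  using assms(3)
proof (induction m)
  case (Suc m)
  then have "m < length (fst X)" "m < length (snd X)" using assms by auto
  then show ?case using Suc by (simp add: left_rot_eq tl_append_drop del: tl_append2)
qed simp

lemma left_rot_funpow_mem:
  assumes "N2star C SO SM n N" "X \<in> N" shows "(L ^^ m) X \<in> N"
  using assms by (induction m) (auto simp: N2star_def)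

text \<open>From \<open>L X\<close> one can only rotate further. A full turn restores the first map
  of \<open>X\<close> up to suspension and sign, so that (N3) applies with identities in the first
  two places.\<close>

lemma N2_of_N2star:
  assumes sub: "\<forall>X \<in> N. nseq X" and N1s: "N1star C SO SM n N" and N2s: "N2star C SO SM n N" and N3: "N3 C SO SM n N"
  shows "N2 C SO SM n N"
proof -
  have ex: "\<forall>X \<in> N. is_exact C SO SM n X"
    using exact_of_mem[OF sub _ N2s N3] N1s unfolding N1star_def by blast
  have "X \<in> N" if X: "nseq X" and LX: "L X \<in> N" for X
  proof -
    have n: "0 < n" "1 < n" using n_ge_3 by auto
    note x = nseqD[OF X, of 0, unfolded next_obj_small] nseqD[OF X, of 1]
    have exX: "is_exact C SO SM n X" using is_exact_left_rot[OF X] ex LX by blast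
    obtain Y where Y: "Y \<in> N" "fst Y ! 0 = fst X ! 0" "fst Y ! 1 = fst X ! 1" "snd Y ! 0 = snd X ! 0"
      using N1s x n unfolding N1star_def N1c_def by metis
    have sY: "nseq Y" using sub Y by blast
    have full: "(L ^^ n) W = (map SO (fst W), map (\<lambda>f. rot_sign (SM f)) (snd W))" if "nseq W" for W
      using left_rot_funpow[of W n] nseq_length[OF that] by simp
    have "(L ^^ n) X = (L ^^ (n - 1)) (L X)"
      using n funpow_swap1[of L "n - 1" X] by (metis Suc_diff_1 funpow_simps_right(2) o_apply)
    then have mem: "(L ^^ n) X \<in> N" "(L ^^ n) Y \<in> N"
      using left_rot_funpow_mem[OF N2s] LX Y by simp_all
    have "ident (SO (fst X ! 0)) \<in> hom (fst ((L ^^ n) Y) ! 0) (fst ((L ^^ n) X) ! 0)"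
      "ident (SO (fst X ! 1)) \<in> hom (fst ((L ^^ n) Y) ! 1) (fst ((L ^^ n) X) ! 1)"
      "ident (SO (fst X ! 1)) \<cdot> snd ((L ^^ n) Y) ! 0 = snd ((L ^^ n) X) ! 0 \<cdot> ident (SO (fst X ! 0))"
      using n x Y nseq_length[OF sY] nseq_length[OF X]
      by (simp_all add: full[OF X] full[OF sY] hom_iff)
    then obtain phi where phi: "nmor ((L ^^ n) Y) ((L ^^ n) X) phi"
      "phi ! 0 = ident (SO (fst X ! 0))" "phi ! 1 = ident (SO (fst X ! 1))"
      using N3 mem unfolding N3_def by blast
    \<comment> \<open>\<open>SM\<close> is onto each hom-set, so the components of
      \<open>phi\<close> desuspend one by one.\<close>
    have "\<exists>g. g \<in> hom (fst Y ! j) (fst X ! j) \<and> SM g = phi ! j" if "j < n" for j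
      using nmorD(1)[OF phi(1) that] nseqD(3)[OF X that] nseqD(3)[OF sY that] that SM_surj
        nseq_length[OF sY] nseq_length[OF X]
      by (simp add: full[OF X] full[OF sY]) metis
    then obtain g where g: "\<And>j. j < n \<Longrightarrow> g j \<in> hom (fst Y ! j) (fst X ! j)" "\<And>j. j < n \<Longrightarrow> SM (g j) = phi ! j"
      by metis
    let ?g = "map g [0..<n]"
    have "next_mor ?g j \<cdot> snd Y ! j = snd X ! j \<cdot> ?g ! j" if j: "j < n" for j
    proof -
      note gh = next_mor_hom[of g, OF g(1) j] g(1)[OF j] nseqD(1)[OF X j] nseqD(1)[OF sY j]
      have "SM (next_mor ?g j) = next_mor phi j"
        using j g(2) by (simp add: next_mor_map next_mor_def)
      then have "SM (next_mor ?g j) \<cdot> rot_sign (SM (snd Y ! j)) = rot_sign (SM (snd X ! j)) \<cdot> SM (g j)"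
        using nmorD(5)[OF phi(1) j] g(2)[OF j] j nseq_length[OF sY] nseq_length[OF X]
        by (simp add: full[OF X] full[OF sY])
      \<comment> \<open>The sign is the same on all maps of both sequences, so it cancels;
        injectivity of \<open>SM\<close> then removes the suspension.\<close>
      then have "rot_sign (SM (next_mor ?g j \<cdot> snd Y ! j)) = rot_sign (SM (snd X ! j \<cdot> g j))"
        using gh by (simp add: hom_iff)
      then have "SM (next_mor ?g j \<cdot> snd Y ! j) = SM (snd X ! j \<cdot> g j)"
        using gh by (simp add: hom_iff del: SM_comp)
      then show ?thesis using gh j SM_eq_iff by (simp add: hom_iff del: SM_comp)
    qed
    then have m: "nmor Y X ?g" unfolding nmor_iff using g by simp
    have "g j = ident (fst X ! j)" if "j < n" "phi ! j = ident (SO (fst X ! j))" for j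
      using SM_eq_iff[of "g j" "ident (fst X ! j)"] g[OF that(1)] that(2) nseqD(3)[OF X that(1)] by (simp add: hom_iff)
    then have "is_nseq_weak_iso C SO SM n Y X ?g"
      using phi n x by (intro weak_iso_of_ident[OF m, of "fst X ! 0" "fst X ! 1"]) auto
    then show "X \<in> N" using N1s Y sY X ex exX unfolding N1star_def by blast
  qed
  then show ?thesis using N2s unfolding N2_def N2star_def by blast
qed

section \<open>Endomorphisms factoring through members\<close>

lemma is_iso_zero_objects:
  assumes "is_zero_object C Z" "is_zero_object C W" "f \<in> hom Z W"
  shows "is_iso C f"
proof -
  have ob: "Z \<in> Ob" "W \<in> Ob" using assms by (auto simp: is_zero_object_def)
  have "zero W Z \<cdot> f = ident Z" "f \<cdot> zero W Z = ident W"
    using assms ob zero_object_hom_eq(1)[OF assms(1), of "zero W Z \<cdot> f" "ident Z"]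
      zero_object_hom_eq(1)[OF assms(2), of "f \<cdot> zero W Z" "ident W"] by (auto simp: hom_iff)
  then show ?thesis using assms ob zero_hom unfolding is_iso_def
    by (auto simp: hom_iff intro!: bexI[of _ "zero W Z"])
qed

lemma is_iso_inverse:
  assumes "is_iso C f" "f \<in> hom A B"
  obtains g where "g \<in> hom B A" "g \<cdot> f = ident A" "f \<cdot> g = ident B"
  using assms unfolding is_iso_def by (auto simp: hom_iff)

lemma is_isoI:
  assumes "f \<in> hom A B" "g \<in> hom B A" "g \<cdot> f = ident A" "f \<cdot> g = ident B"
  shows "is_iso C f"
  unfolding is_iso_def using assms by (auto simp: hom_iff intro!: bexI[of _ g])

text \<open>For \<open>Suc j < n\<close> these are, up to isomorphism, the rotated trivial
  sequences. The zero objects may differ from place to place because rotation suspends them.\<close>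

definition trivial_at :: "nat \<Rightarrow> ('o, 'm) nseq \<Rightarrow> bool" where
  "trivial_at j T \<longleftrightarrow> nseq T \<and> is_iso C (snd T ! j) \<and>
     (\<forall>i < n. i \<noteq> j \<longrightarrow> i \<noteq> Suc j \<longrightarrow> is_zero_object C (fst T ! i))"

lemma trivial_at_0_iso_triv:
  assumes "trivial_at 0 T" "is_zero_object C Z" "nseq (triv_nseq C SO n Z (fst T ! 0))"
  obtains phi where "is_nseq_iso C SO SM n T (triv_nseq C SO n Z (fst T ! 0)) phi"
proof -
  let ?V = "triv_nseq C SO n Z (fst T ! 0)"
  have n: "0 < n" "1 < n" "Suc 0 < n" using n_ge_3 by auto
  have T: "nseq T" and iso: "is_iso C (snd T ! 0)"
    and zero: "\<And>i. 2 \<le> i \<Longrightarrow> i < n \<Longrightarrow> is_zero_object C (fst T ! i)"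
    using assms(1) unfolding trivial_at_def by auto
  have Z: "Z \<in> Ob" using assms(2) by (simp add: is_zero_object_def)
  note t = nseqD[OF T] and v = nseqD[OF assms(3)]
  obtain g where g: "g \<in> hom (fst T ! 1) (fst T ! 0)" "g \<cdot> snd T ! 0 = ident (fst T ! 0)"
    "snd T ! 0 \<cdot> g = ident (fst T ! 1)"
    using is_iso_inverse[OF iso] t(1)[of 0] n by (metis next_obj_small(1))
  \<comment> \<open>The inverse of the first map of \<open>T\<close> makes the first square commute;
    all later components are forced, since they connect zero objects.\<close>
  define f where "f = (\<lambda>i :: nat. if i = 0 then ident (fst T ! 0) else if i = 1 then g else zero (fst T ! i) Z)"
  let ?f = "map f [0..<n]"
  have f: "f j \<in> hom (fst T ! j) (fst ?V ! j)" if "j < n" for j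
  proof -
    consider "j = 0" | "j = 1" | "2 \<le> j" by linarith
    then show ?thesis
    proof cases
      case 1
      then show ?thesis using t(3) n ident_hom by (simp add: f_def triv_nseq_nth)
    next
      case 2
      then show ?thesis using g triv_nseq_nth(2) by (simp add: f_def)
    next
      case 3
      then show ?thesis using t(3) that Z zero_hom by (simp add: f_def triv_nseq_nth)
    qed
  qed
  have fi: "is_iso C (f j)" if "j < n" for j
  proof -
    consider "j = 0" | "j = 1" | "2 \<le> j" by linarith
    then show ?thesis
    proof cases
      case 1
      then show ?thesis using t(3) n is_iso_ident by (simp add: f_def)
    next
      case 2
      then show ?thesis using is_isoI[OF g(1) _ g(3,2)] t(1)[of 0] n
        by (simp add: f_def next_obj_small)
    next
      case 3
      then show ?thesis using is_iso_zero_objects[OF zero[OF 3 that] assms(2)] t(3) Z zero_hom that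
        by (simp add: f_def)
    qed
  qed
  have "next_mor ?f j \<cdot> snd T ! j = snd ?V ! j \<cdot> f j" if j: "j < n" for j
  proof -
    note h = next_mor_hom[of f, OF f j] f[OF j] t(1)[OF j] v(1)[OF j]
    show ?thesis
    proof (cases "j = 0")
      case True
      then show ?thesis using n g(2) t(3)
        by (simp add: next_mor_map f_def triv_nseq_nth)
    next
      case False
      \<comment> \<open>These squares end in the zero object \<open>Z\<close>, except the last one,
        which begins in a zero object.\<close>
      show ?thesis
      proof (cases "Suc j < n")
        case True
        have "next_obj (fst ?V) j = Z" using True False by (simp add: next_obj_def triv_nseq_nth)
        then show ?thesis using h by (intro zero_object_hom_eq(1)[OF assms(2)]) (auto simp: hom_iff)
      next
        case False
        then have "is_zero_object C (fst T ! j)" using n_ge_3 j zero by simp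
        then show ?thesis using h by (intro zero_object_hom_eq(2)[of "fst T ! j"]) (auto simp: hom_iff)
      qed
    qed
  qed
  then have "nmor T ?V ?f" unfolding nmor_iff using f by simp
  then show thesis using fi by (intro that[of ?f]) (simp add: is_nseq_iso_def)
qed

lemma trivial_at_left_rot:
  assumes "trivial_at (Suc j) T" "Suc (Suc j) < n"
  shows "trivial_at j (L T)"
proof -
  have T: "nseq T" using assms(1) unfolding trivial_at_def by auto
  have "is_zero_object C (fst (L T) ! i)" if "i < n" "i \<noteq> j" "i \<noteq> Suc j" for i
  proof (cases "Suc i < n")
    case True
    then show ?thesis using assms(1) that nth_left_rot(1)[OF T that(1)]
      unfolding trivial_at_def by (simp add: next_obj_def)
  next
    case False
    then show ?thesis using assms that nth_left_rot(1)[OF T that(1)] is_zero_object_SO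
      unfolding trivial_at_def by (simp add: next_obj_def)
  qed
  then show ?thesis using assms nseq_left_rot[OF T] nth_left_rot(2)[OF T]
    unfolding trivial_at_def by simp
qed

text \<open>After \<open>j\<close> left rotations the isomorphism stands at place 0 and the sequence
  is isomorphic to a trivial one; the converse half of (N2) brings membership back.\<close>

lemma trivial_at_mem:
  assumes sub: "\<forall>X \<in> N. nseq X" and N1: "N1 C SO SM n N" and N2: "N2 C SO SM n N"
    and "trivial_at j T" "Suc j < n"
  shows "T \<in> N"
  using assms(4,5)
proof (induction j arbitrary: T)
  case 0
  obtain Z where Z: "is_zero_object C Z"
    using additive unfolding is_additive_category_def by blast
  have T: "nseq T" "fst T ! 0 \<in> Ob" using 0 nseqD(3)[of T 0] unfolding trivial_at_def by auto
  have "triv_nseq C SO n Z (fst T ! 0) \<in> N" using N1 Z T unfolding N1_def N1b_def by blast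
  then show ?case using trivial_at_0_iso_triv[OF 0(1) Z] T N1 sub unfolding N1_def N1a_def by metis
next
  case (Suc j)
  then have "L T \<in> N" using trivial_at_left_rot by simp
  then show ?case using N2 Suc.prems unfolding N2_def trivial_at_def by blast
qed

text \<open>The endomorphism is a function of which only the values below \<open>n\<close> matter,
  so that sums and case distinctions can be written directly. For the identity this is being a
  summand of a member.\<close>

definition factors :: "('o, 'm) nseq set \<Rightarrow> ('o, 'm) nseq \<Rightarrow> (nat \<Rightarrow> 'm) \<Rightarrow> bool" where
  "factors N Y G \<longleftrightarrow> (\<exists>W \<in> N. \<exists>a b. nmor Y W a \<and> nmor W Y b \<and> (\<forall>j < n. b ! j \<cdot> a ! j = G j))"

lemma factors_nmor:
  assumes "\<forall>X \<in> N. nseq X" "nseq Y" "factors N Y G"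
  shows "nmor Y Y (map G [0..<n])"
proof -
  obtain W a b where W: "W \<in> N" and m: "nmor Y W a" "nmor W Y b" and e: "\<And>j. j < n \<Longrightarrow> b ! j \<cdot> a ! j = G j"
    using assms(3) unfolding factors_def by blast
  have "nmor Y Y (map (\<lambda>j. b ! j \<cdot> a ! j) [0..<n])"
    using assms W m by (intro nmor_comp[of Y W Y]) auto
  also have "map (\<lambda>j. b ! j \<cdot> a ! j) [0..<n] = map G [0..<n]" using e by simp
  finally show ?thesis .
qed

lemma mem_of_factors_ident:
  assumes "N1a C SO SM n N" "nseq Y" "factors N Y (\<lambda>j. ident (fst Y ! j))"
  shows "Y \<in> N"
proof -
  obtain W where W: "W \<in> N" "is_nseq_summand C SO SM n Y W"
    using assms(3) unfolding factors_def is_nseq_summand_def by blast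
  then show ?thesis using assms unfolding N1a_def by blast
qed

text \<open>Two factorisations combine through the direct sum of the intermediate members; the mixed
  terms vanish by the biproduct relations.\<close>

lemma factors_plus:
  assumes sub: "\<forall>X \<in> N. nseq X" and N1a: "N1a C SO SM n N" and Y: "nseq Y"
    and "factors N Y G" "factors N Y H"
  shows "factors N Y (\<lambda>j. G j \<oplus> H j)"
proof -
  obtain W a b where W: "W \<in> N" and m: "nmor Y W a" "nmor W Y b" and e: "\<And>j. j < n \<Longrightarrow> b ! j \<cdot> a ! j = G j"
    using assms(4) unfolding factors_def by blast
  obtain V c d where V: "V \<in> N" and m': "nmor Y V c" "nmor V Y d" and e': "\<And>j. j < n \<Longrightarrow> d ! j \<cdot> c ! j = H j"
    using assms(5) unfolding factors_def by blast
  have s: "nseq W" "nseq V" using sub W V by auto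
  obtain S where S: "is_nseq_dsum C SO SM n W V S" using dsum_exists[OF s] by blast
  have SN: "S \<in> N" using N1a W V S unfolding N1a_def by blast
  obtain i1 p1 i2 p2 where "nseq S" and jr: "joint_retract S W V i1 p1 i2 p2"
    and bi: "\<And>j. j < n \<Longrightarrow> is_biproduct C (fst W ! j) (fst V ! j) (fst S ! j) (i1 ! j) (i2 ! j) (p1 ! j) (p2 ! j)"
    using dsum_joint_retract[OF S s] by blast
  have k: "nmor W S i1" "nmor S W p1" "nmor V S i2" "nmor S V p2"
    using jr unfolding joint_retract_def by auto
  let ?a = "map (\<lambda>j. map (\<lambda>j. i1 ! j \<cdot> a ! j) [0..<n] ! j \<oplus> map (\<lambda>j. i2 ! j \<cdot> c ! j) [0..<n] ! j) [0..<n]"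
  let ?b = "map (\<lambda>j. map (\<lambda>j. b ! j \<cdot> p1 ! j) [0..<n] ! j \<oplus> map (\<lambda>j. d ! j \<cdot> p2 ! j) [0..<n] ! j) [0..<n]"
  have "nmor Y S ?a"
    by (intro nmor_plus nmor_comp[OF Y s(1) \<open>nseq S\<close>] nmor_comp[OF Y s(2) \<open>nseq S\<close>] m m' k Y \<open>nseq S\<close>)
  moreover have "nmor S Y ?b"
    by (intro nmor_plus nmor_comp[OF \<open>nseq S\<close> s(1) Y] nmor_comp[OF \<open>nseq S\<close> s(2) Y] m m' k Y \<open>nseq S\<close>)
  moreover have "?b ! j \<cdot> ?a ! j = G j \<oplus> H j" if j: "j < n" for j
  proof -
    note B = biproductD[OF bi[OF j]]
    note h = nmorD(2-4)[OF m(1) j] nmorD(2-4)[OF m(2) j] nmorD(2-4)[OF m'(1) j] nmorD(2-4)[OF m'(2) j]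
      B(1-4)[unfolded hom_iff] nseqD(3)[OF s(1) j] nseqD(3)[OF s(2) j] nseqD(3)[OF Y j]
    have q: "p1 ! j \<cdot> i1 ! j \<cdot> a ! j = a ! j" "p2 ! j \<cdot> i2 ! j \<cdot> c ! j = c ! j"
      "p1 ! j \<cdot> i2 ! j \<cdot> c ! j = zero (fst Y ! j) (fst W ! j)"
      "p2 ! j \<cdot> i1 ! j \<cdot> a ! j = zero (fst Y ! j) (fst V ! j)"
      using comp_left_cong[OF B(5) B(1,3) nmorD(1)[OF m(1) j]] comp_left_cong[OF B(6) B(2,4) nmorD(1)[OF m'(1) j]]
        comp_left_cong[OF B(8) B(2,3) nmorD(1)[OF m'(1) j]] comp_left_cong[OF B(9) B(1,4) nmorD(1)[OF m(1) j]] h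
      by simp_all
    have "?b ! j \<cdot> ?a ! j = b ! j \<cdot> a ! j \<oplus> d ! j \<cdot> c ! j"
      using j h q by simp
    then show ?thesis using e e' j by simp
  qed
  ultimately show ?thesis unfolding factors_def using SN by blast
qed

lemma exact_pair_nth:
  assumes "nseq X" "is_exact C SO SM n X" "j < n"
  shows "exact_pair (snd X ! j) (next_mor (snd X) j)"
proof -
  have "\<forall>j < n. snd X ! j \<in> Mor" using nseqD(2)[OF assms(1)] by blast
  from um_next[OF assms(3) this] show ?thesis
    using is_exact_iff[OF assms(1)] assms(2) um_eq[OF assms(3)] by metis
qed

text \<open>This is the null-homotopic endomorphism of a homotopy whose only nonzero entry is
  \<open>s\<close>. With \<open>y = snd Y ! j\<close>, it enters the sequence \<open>T\<close>,
  which has the identity of \<open>fst Y ! j\<close> at place \<open>j\<close>, by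
  \<open>s y\<close> and \<open>s\<close>, and leaves it by \<open>1\<close> and \<open>y\<close>.
  The neighbouring squares commute because consecutive maps of \<open>Y\<close> compose to
  zero.\<close>

lemma factors_elementary:
  assumes sub: "\<forall>X \<in> N. nseq X" and N1: "N1 C SO SM n N" and N2: "N2 C SO SM n N"
    and Y: "nseq Y" and ex: "is_exact C SO SM n Y"
    and j: "Suc j < n" "0 < j" and s: "s \<in> hom (fst Y ! Suc j) (fst Y ! j)"
  shows "factors N Y (\<lambda>i. if i = j then s \<cdot> snd Y ! j else if i = Suc j then snd Y ! j \<cdot> s
    else zero (fst Y ! i) (fst Y ! i))"
proof -
  obtain Z where Zz: "is_zero_object C Z" using additive unfolding is_additive_category_def by blast
  then have Z: "Z \<in> Ob" by (simp add: is_zero_object_def)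
  let ?B = "fst Y ! j"
  note y = nseqD[OF Y]
  have B: "?B \<in> Ob" using y j by simp
  define o' where "o' = map (\<lambda>i. if i = j \<or> i = Suc j then ?B else Z) [0..<n]"
  define T where "T = (o', map (\<lambda>i. if i = j then ident ?B else zero (o' ! i) (next_obj o' i)) [0..<n])"
  have o: "o' ! i = (if i = j \<or> i = Suc j then ?B else Z)" if "i < n" for i
    using that by (simp add: o'_def)
  have oO: "\<forall>i < n. o' ! i \<in> Ob" using o B Z by simp
  have no: "next_obj o' i \<in> Ob" for i using oO by (rule next_obj_ob)
  have njo: "next_obj o' j = ?B" using j o by (simp add: next_obj_def)
  have T: "nseq T" unfolding nseq_iff
    using oO no njo B j o by (auto simp: T_def o'_def[THEN arg_cong[where f = length]] hom_iff)
  have "trivial_at j T" unfolding trivial_at_def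
    using T j B o Zz by (auto simp: T_def is_iso_ident)
  then have TN: "T \<in> N" using trivial_at_mem[OF sub N1 N2] j by blast
  have ft: "fst T ! i = o' ! i" "i < n \<Longrightarrow> snd T ! i = (if i = j then ident ?B else zero (o' ! i) (next_obj o' i))" for i
    by (simp_all add: T_def)
  have yy: "next_mor (snd Y) i \<cdot> snd Y ! i = zero (fst Y ! i) (cod (next_mor (snd Y) i))" if "i < n" for i
    using exact_pair_nth[OF Y ex that] y that unfolding exact_pair_def by simp
  have y1: "snd Y ! Suc i \<cdot> snd Y ! i = zero (fst Y ! i) (next_obj (fst Y) (Suc i))" if "Suc i < n" for i
    using yy[of i] that y by (simp add: next_mor_def)
  have yj: "snd Y ! j \<in> Mor" "dom (snd Y ! j) = ?B" "cod (snd Y ! j) = fst Y ! Suc j"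
    using y j by (simp_all add: next_obj_def)
  have sh: "s \<in> Mor" "dom s = fst Y ! Suc j" "cod s = ?B" using s by (auto simp: hom_iff)
  \<comment> \<open>Place 0 is neither \<open>j\<close> nor \<open>j + 1\<close>, so the suspended
    component in the last square is zero.\<close>
  have n: "0 < n" "0 \<noteq> j" "0 \<noteq> Suc j" using j by auto
  define a where "a = (\<lambda>i. if i = j then s \<cdot> snd Y ! j else if i = Suc j then s else zero (fst Y ! i) (o' ! i))"
  define b where "b = (\<lambda>i. if i = j then ident ?B else if i = Suc j then snd Y ! j else zero (o' ! i) (fst Y ! i))"
  have a: "a i \<in> hom (fst Y ! i) (fst T ! i)" if "i < n" for i
    using that yj sh o oO y zero_hom unfolding a_def ft by (auto simp: hom_iff)
  have b: "b i \<in> hom (fst T ! i) (fst Y ! i)" if "i < n" for i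
    using that yj B o oO y zero_hom unfolding b_def ft by (auto simp: hom_iff)
  have next_a: "next_mor (map a [0..<n]) i = (if Suc i = j then s \<cdot> snd Y ! j else if i = j then s
      else zero (next_obj (fst Y) i) (next_obj o' i))" if "i < n" for i
    using that n j oO y by (auto simp: next_mor_map a_def next_obj_def)
  have next_b: "next_mor (map b [0..<n]) i = (if Suc i = j then ident ?B else if i = j then snd Y ! j
      else zero (next_obj o' i) (next_obj (fst Y) i))" if "i < n" for i
    using that n j oO y by (auto simp: next_mor_map b_def next_obj_def)
  have "next_mor (map a [0..<n]) i \<cdot> snd Y ! i = snd T ! i \<cdot> a i" if i: "i < n" for i
  proof -
    consider "Suc i = j" | "i = j" | "Suc i \<noteq> j" "i \<noteq> j" by blast
    then show ?thesis
    proof cases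
      case 1
      have "s \<cdot> snd Y ! j \<cdot> snd Y ! i = s \<cdot> zero (fst Y ! i) (fst Y ! Suc j)"
        using y1[of i] 1 j by (simp add: next_obj_def)
      moreover have c: "cod (snd Y ! i) = ?B" "next_obj o' i = ?B"
        using y i 1 j o by (simp_all add: next_obj_def)
      ultimately have "next_mor (map a [0..<n]) i \<cdot> snd Y ! i = zero (fst Y ! i) ?B"
        unfolding next_a[OF i] using 1 i y yj sh j by simp
      moreover have "snd T ! i \<cdot> a i = zero (fst Y ! i) ?B"
        using 1 i c B a[OF i] by (simp add: ft hom_iff)
      ultimately show ?thesis by simp
    next
      case 2
      then show ?thesis unfolding next_a[OF i] ft(2)[OF i] unfolding a_def using yj sh by simp
    next
      case 3
      then show ?thesis unfolding next_a[OF i] using i y no oO a[OF i] by (simp add: ft hom_iff)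
    qed
  qed
  then have ma: "nmor Y T (map a [0..<n])" unfolding nmor_iff using a by simp
  have "next_mor (map b [0..<n]) i \<cdot> snd T ! i = snd Y ! i \<cdot> b i" if i: "i < n" for i
  proof -
    consider "Suc i = j" | "i = j" | "i = Suc j" | "Suc i \<noteq> j" "i \<noteq> j" "i \<noteq> Suc j" by blast
    then show ?thesis
    proof cases
      case 1
      then have "next_obj o' i = ?B" "next_obj (fst Y) i = ?B" using j o by (auto simp: next_obj_def)
      then show ?thesis unfolding next_b[OF i] ft(2)[OF i] unfolding b_def using 1 i y oO B j by simp
    next
      case 2
      then show ?thesis unfolding next_b[OF i] ft(2)[OF i] unfolding b_def using i yj by simp
    next
      case 3
      then show ?thesis unfolding next_b[OF i] ft(2)[OF i] unfolding b_def using i y no oO o y1[of j] by simp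
    next
      case 4
      then show ?thesis unfolding next_b[OF i] ft(2)[OF i] unfolding b_def using i y no oO by simp
    qed
  qed
  then have mb: "nmor T Y (map b [0..<n])" unfolding nmor_iff using b by simp
  have "\<forall>i < n. map b [0..<n] ! i \<cdot> map a [0..<n] ! i = (if i = j then s \<cdot> snd Y ! j else if i = Suc j then snd Y ! j \<cdot> s
    else zero (fst Y ! i) (fst Y ! i))"
    using y yj sh oO by (simp add: a_def b_def)
  then show ?thesis unfolding factors_def using TN ma mb by blast
qed

text \<open>Adding elementary endomorphisms makes \<open>G\<close> the identity at all places except
  2. The result is invertible with inverse \<open>H\<close>, and composing its factorisation with
  \<open>H\<close> makes \<open>Y\<close> a summand of a member.\<close>

lemma mem_of_factors_weak:
  assumes sub: "\<forall>X \<in> N. nseq X" and N1: "N1 C SO SM n N" and N2: "N2 C SO SM n N"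
    and Y: "nseq Y" and ex: "is_exact C SO SM n Y"
    and "factors N Y G" "G 0 = ident (fst Y ! 0)" "G 1 = ident (fst Y ! 1)"
  shows "Y \<in> N"
proof -
  have N1a: "N1a C SO SM n N" using N1 unfolding N1_def by blast
  have n: "0 < n" "1 < n" "2 < n" "2 \<le> n - 1" using n_ge_3 by auto
  note y = nseqD[OF Y]
  let ?P = "\<lambda>i. \<exists>G. factors N Y G \<and> G 0 = ident (fst Y ! 0) \<and> G 1 = ident (fst Y ! 1) \<and>
    (\<forall>k. i < k \<longrightarrow> k < n \<longrightarrow> G k = ident (fst Y ! k))"
  \<comment> \<open>Where the next component is the identity, the square reads
    \<open>y G = y\<close>, and exactness makes \<open>G - 1\<close> factor through the previous
    map. At the top place the next component is \<open>SM (G 0)\<close>, whence the assumption on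
    \<open>G 0\<close>.\<close>
  have split: "\<exists>s \<in> hom (fst Y ! Suc m) (fst Y ! m). G (Suc m) = ident (fst Y ! Suc m) \<oplus> snd Y ! m \<cdot> s"
    if G: "factors N Y G" "G 0 = ident (fst Y ! 0)" "\<forall>k. Suc m < k \<longrightarrow> k < n \<longrightarrow> G k = ident (fst Y ! k)"
      and m: "Suc m < n" for G m
  proof -
    have m': "m < n" using m by simp
    have nm: "nmor Y Y (map G [0..<n])" using factors_nmor[OF sub Y G(1)] .
    have Gh: "G (Suc m) \<in> hom (fst Y ! Suc m) (fst Y ! Suc m)" using nmorD(1)[OF nm m] m by simp
    have "next_mor (map G [0..<n]) (Suc m) = ident (next_obj (fst Y) (Suc m))"
      using m G y(3)[of 0] by (simp add: next_mor_map next_obj_def)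
    then have e: "snd Y ! Suc m \<cdot> G (Suc m) = snd Y ! Suc m \<cdot> ident (fst Y ! Suc m)"
      using nmorD(5)[OF nm m] m y[OF m] by simp
    have "exact_pair (snd Y ! m) (snd Y ! Suc m)"
      using exact_pair_nth[OF Y ex m'] m by (simp add: next_mor_def)
    moreover have "cod (snd Y ! m) = fst Y ! Suc m" using y(5)[OF m'] m by (simp add: next_obj_def)
    ultimately obtain t where "t \<in> hom (fst Y ! Suc m) (dom (snd Y ! m))"
      "G (Suc m) = ident (fst Y ! Suc m) \<oplus> snd Y ! m \<cdot> t"
      using exact_pairD[of "snd Y ! m" "snd Y ! Suc m" "G (Suc m)" "fst Y ! Suc m" "ident (fst Y ! Suc m)"]
        e Gh y[OF m] y[OF m'] ident_hom by metis
    then show ?thesis using y(4)[OF m'] by auto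
  qed
  have "?P 2"
    using n(4)
  proof (induction rule: inc_induct)
    case base
    show ?case using assms(6-8) by (intro exI[of _ G]) auto
  next
    case (step m)
    then obtain G where G: "factors N Y G" "G 0 = ident (fst Y ! 0)" "G 1 = ident (fst Y ! 1)"
      "\<forall>k. Suc m < k \<longrightarrow> k < n \<longrightarrow> G k = ident (fst Y ! k)" by blast
    have m: "Suc m < n" "m < n" "0 < m" "m \<noteq> 0" "m \<noteq> 1" using step by auto
    obtain s where s: "s \<in> hom (fst Y ! Suc m) (fst Y ! m)"
      "G (Suc m) = ident (fst Y ! Suc m) \<oplus> snd Y ! m \<cdot> s"
      using split[OF G(1,2,4) m(1)] by blast
    \<comment> \<open>Subtracting the homotopy \<open>s\<close> clears place \<open>m + 1\<close>
      and moves the error to place \<open>m\<close>; as \<open>m\<close> is at least 2, places 0 and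
      1 stay untouched.\<close>
    define E where "E = (\<lambda>i. if i = m then neg s \<cdot> snd Y ! m else if i = Suc m then snd Y ! m \<cdot> neg s
      else zero (fst Y ! i) (fst Y ! i))"
    have "factors N Y E" unfolding E_def
      by (rule factors_elementary[OF sub N1 N2 Y ex m(1,3) neg_hom[OF s(1)]])
    then have "factors N Y (\<lambda>i. G i \<oplus> E i)" using factors_plus[OF sub N1a Y G(1)] by blast
    moreover have "G 0 \<oplus> E 0 = ident (fst Y ! 0)" "G 1 \<oplus> E 1 = ident (fst Y ! 1)"
      using m y(3) n G by (simp_all add: E_def)
    moreover have "G k \<oplus> E k = ident (fst Y ! k)" if k: "m < k" "k < n" for k
    proof (cases "k = Suc m")
      case True
      have "cod (snd Y ! m) = fst Y ! Suc m" using y(5)[OF m(2)] m by (simp add: next_obj_def)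
      then show ?thesis using True s m y[OF m(2)] y(3)[OF m(1)] by (simp add: E_def hom_iff)
    next
      case False
      then show ?thesis using k G(4) y(3) by (simp add: E_def)
    qed
    ultimately show ?case by blast
  qed
  then obtain G where G: "factors N Y G" "G 0 = ident (fst Y ! 0)" "G 1 = ident (fst Y ! 1)"
      "\<forall>k. 2 < k \<longrightarrow> k < n \<longrightarrow> G k = ident (fst Y ! k)" by blast
  obtain s where s: "s \<in> hom (fst Y ! 2) (fst Y ! 1)" "G 2 = ident (fst Y ! 2) \<oplus> snd Y ! 1 \<cdot> s"
    using split[OF G(1,2), of 1] G(4) n by (auto simp: numeral_2_eq_2)
  have sh: "s \<in> Mor" "dom s = fst Y ! 2" "cod s = fst Y ! 1" using s(1) by (auto simp: hom_iff)
  have y1: "snd Y ! 1 \<in> Mor" "dom (snd Y ! 1) = fst Y ! 1" "cod (snd Y ! 1) = fst Y ! 2"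
    using y[OF n(2)] by (auto simp: next_obj_small)
  have ob: "fst Y ! 1 \<in> Ob" "fst Y ! 2 \<in> Ob" using y(3) n by auto
  let ?d = "snd Y ! 1 \<cdot> s"
  have nm: "nmor Y Y (map G [0..<n])" using factors_nmor[OF sub Y G(1)] .
  \<comment> \<open>The square between places 1 and 2, where \<open>G 1\<close> is the identity,
    shows that \<open>d\<close> kills the incoming map. As \<open>d\<close> factors through that
    map, it squares to zero.\<close>
  have "(ident (fst Y ! 2) \<oplus> ?d) \<cdot> snd Y ! 1 = snd Y ! 1 \<cdot> ident (fst Y ! 1)"
    using nmorD(5)[OF nm n(2)] n G s(2) by (simp add: next_mor_small numeral_2_eq_2 del: comp_ident)
  then have "snd Y ! 1 \<oplus> ?d \<cdot> snd Y ! 1 = snd Y ! 1 \<oplus> zero (fst Y ! 1) (fst Y ! 2)"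
    using sh y1 ob by simp
  then have dy: "?d \<cdot> snd Y ! 1 = zero (fst Y ! 1) (fst Y ! 2)"
    by (rule plus_left_cancel[rotated -1]) (use sh y1 ob in auto)
  then have dd: "?d \<cdot> ?d = zero (fst Y ! 2) (fst Y ! 2)"
    using comp_left_cong[OF dy, of "fst Y ! 1" "fst Y ! 2" "fst Y ! 2" s "fst Y ! 2"] sh y1 ob
    by (simp add: hom_iff)
  \<comment> \<open>Inverse of \<open>1 + d\<close> at place 2. It is an endomorphism of
    \<open>Y\<close> because \<open>d\<close> composes to zero with the maps of \<open>Y\<close> on
    both sides.\<close>
  define H where "H = (\<lambda>k. if k = 2 then ident (fst Y ! 2) \<oplus> neg ?d else ident (fst Y ! k))"
  have Hh: "H k \<in> hom (fst Y ! k) (fst Y ! k)" if "k < n" for k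
    using that sh y1 ob y(3) by (auto simp: H_def hom_iff)
  have "next_mor (map H [0..<n]) k \<cdot> snd Y ! k = snd Y ! k \<cdot> H k" if k: "k < n" for k
  proof -
    have nx: "next_mor (map H [0..<n]) k = (if k = 1 then H 2 else ident (next_obj (fst Y) k))"
      using k n y(3)[OF n(1)] by (auto simp: next_mor_map next_obj_def H_def)
    consider "k = 1" | "k = 2" | "k \<noteq> 1" "k \<noteq> 2" by blast
    then show ?thesis
    proof cases
      case 1
      then show ?thesis using nx sh y1 ob dy by (simp add: H_def)
    next
      case 2
      have "exact_pair (snd Y ! 1) (snd Y ! 2)"
        using exact_pair_nth[OF Y ex n(2)] by (simp add: next_mor_small)
      then have "snd Y ! 2 \<cdot> snd Y ! 1 = zero (fst Y ! 1) (cod (snd Y ! 2))"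
        using y1 unfolding exact_pair_def by simp
      then have "snd Y ! 2 \<cdot> ?d = zero (fst Y ! 2) (cod (snd Y ! 2))"
        using comp_left_cong[of "snd Y ! 2" "snd Y ! 1" "zero (fst Y ! 1) (cod (snd Y ! 2))" "fst Y ! 1" "fst Y ! 2"
          "cod (snd Y ! 2)" s "fst Y ! 2"] sh y1 ob y[OF n(3)] by (simp add: hom_iff)
      then show ?thesis using 2 nx sh y1 ob y[OF n(3)] by (simp add: H_def)
    next
      case 3
      then show ?thesis using nx y[OF k] by (simp add: H_def)
    qed
  qed
  then have Hm: "nmor Y Y (map H [0..<n])" unfolding nmor_iff using Hh by simp
  obtain W a b where W: "W \<in> N" and m: "nmor Y W a" "nmor W Y b" and e: "\<And>j. j < n \<Longrightarrow> b ! j \<cdot> a ! j = G j"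
    using G(1) unfolding factors_def by blast
  let ?b = "map (\<lambda>j. map H [0..<n] ! j \<cdot> b ! j) [0..<n]"
  have "nmor W Y ?b" by (rule nmor_comp[OF _ Y Y m(2) Hm]) (use sub W in auto)
  moreover have "?b ! k \<cdot> a ! k = ident (fst Y ! k)" if k: "k < n" for k
  proof -
    have "?b ! k \<cdot> a ! k = H k \<cdot> G k"
      unfolding e[OF k, symmetric]
      using k Hh[OF k] nmorD(1)[OF m(1) k] nmorD(1)[OF m(2) k] by (simp add: hom_iff)
    also have "\<dots> = ident (fst Y ! k)"
    proof (cases "k = 2")
      case True
      have "H 2 \<cdot> G 2 = (ident (fst Y ! 2) \<oplus> neg ?d) \<oplus> (?d \<oplus> neg (?d \<cdot> ?d))"
        unfolding s(2) H_def using sh y1 ob by (simp add: plus_left_commute plus_commute)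
      also have "\<dots> = ident (fst Y ! 2) \<oplus> (neg ?d \<oplus> ?d)"
        unfolding dd using sh y1 ob by (simp del: plus_neg(4))
      finally show ?thesis using True sh y1 ob by simp
    next
      case False
      have "G k = ident (fst Y ! k)"
      proof -
        consider "k = 0" | "k = 1" | "2 < k" using False by linarith
        then show ?thesis using G k by cases auto
      qed
      then show ?thesis using False y(3)[OF k] by (simp add: H_def)
    qed
    finally show ?thesis .
  qed
  ultimately have "factors N Y (\<lambda>k. ident (fst Y ! k))" unfolding factors_def using W m(1) by blast
  then show ?thesis by (rule mem_of_factors_ident[OF N1a Y])
qed

section \<open>Sections of weak isomorphisms\<close>

lemma exact_pair_lift:
  assumes "exact_pair f g" "g \<in> Mor" "f \<in> Mor" "u \<in> hom B (dom g)" "g \<cdot> u = zero B (cod g)"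
  obtains t where "t \<in> hom B (dom f)" "f \<cdot> t = u"
proof -
  have "u \<in> Mor" "cod u = dom g" "dom u = B" using assms(4) by (auto simp: hom_iff)
  then show thesis using assms(1,5) that unfolding exact_pair_def by blast
qed

text \<open>
  Invariant of the downward lifting: on the image of the incoming map, \<open>f psi\<close> agrees with the
  identity up to a term through the preceding object. At the last step \<open>lift_close_up\<close> absorbs this
  term into \<open>psi\<close>, because the next component of \<open>f\<close> is invertible.
\<close>

lemma lift_step:
  assumes ex: "exact_pair x1 x2" "exact_pair y0 y1"
    and x: "x1 \<in> hom X1 X2" "x2 \<in> hom X2 X3" and y: "y0 \<in> hom Y0 Y1" "y1 \<in> hom Y1 Y2"
    and f: "f1 \<in> hom X1 Y1" "f2 \<in> hom X2 Y2" "f2 \<cdot> x1 = y1 \<cdot> f1"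
    and psi: "psi2 \<in> hom Y2 X2" and sig: "sig2 \<in> hom Y2 Y1"
    and e: "f2 \<cdot> psi2 \<cdot> y1 = y1 \<oplus> y1 \<cdot> sig2 \<cdot> y1" "x2 \<cdot> psi2 \<cdot> y1 = zero Y1 X3"
  obtains psi1 sig1 where "psi1 \<in> hom Y1 X1" "sig1 \<in> hom Y1 Y0" "x1 \<cdot> psi1 = psi2 \<cdot> y1"
    "f1 \<cdot> psi1 \<cdot> y0 = y0 \<oplus> y0 \<cdot> sig1 \<cdot> y0" "x1 \<cdot> psi1 \<cdot> y0 = zero Y0 X2"
proof -
  have ty: "x1 \<in> Mor" "dom x1 = X1" "cod x1 = X2" "x2 \<in> Mor" "dom x2 = X2" "cod x2 = X3"
    "y0 \<in> Mor" "dom y0 = Y0" "cod y0 = Y1" "y1 \<in> Mor" "dom y1 = Y1" "cod y1 = Y2"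
    "f1 \<in> Mor" "dom f1 = X1" "cod f1 = Y1" "f2 \<in> Mor" "dom f2 = X2" "cod f2 = Y2"
    "psi2 \<in> Mor" "dom psi2 = Y2" "cod psi2 = X2" "sig2 \<in> Mor" "dom sig2 = Y2" "cod sig2 = Y1"
    using x y f psi sig by (auto simp: hom_iff)
  have ob: "X1 \<in> Ob" "X2 \<in> Ob" "X3 \<in> Ob" "Y0 \<in> Ob" "Y1 \<in> Ob" "Y2 \<in> Ob"
    using x y hom_ob by blast+
  obtain psi1 where p: "psi1 \<in> hom Y1 X1" "x1 \<cdot> psi1 = psi2 \<cdot> y1"
    using exact_pair_lift[OF ex(1), of "psi2 \<cdot> y1" Y1] e(2) ty by (auto simp: hom_iff)
  have ph: "psi1 \<in> Mor" "dom psi1 = Y1" "cod psi1 = X1" using p by (auto simp: hom_iff)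
  \<comment> \<open>After \<open>y1\<close>, the composite \<open>f1 psi1\<close> agrees with
    \<open>1 + sig2 y1\<close>, so the two differ by some \<open>y0 t\<close>. Precomposing with
    \<open>y0\<close> kills \<open>sig2 y1\<close>, and \<open>t\<close> becomes the new
    \<open>sig1\<close>.\<close>
  have "y1 \<cdot> f1 \<cdot> psi1 = (f2 \<cdot> x1) \<cdot> psi1" unfolding f(3) using ty ph by simp
  also have "\<dots> = f2 \<cdot> psi2 \<cdot> y1" using ty ph p(2) by simp
  also have "\<dots> = y1 \<cdot> (ident Y1 \<oplus> sig2 \<cdot> y1)" unfolding e(1) using ty ob by simp
  finally have *: "y1 \<cdot> f1 \<cdot> psi1 = y1 \<cdot> (ident Y1 \<oplus> sig2 \<cdot> y1)" .
  obtain t where t: "t \<in> hom Y1 Y0" "f1 \<cdot> psi1 = (ident Y1 \<oplus> sig2 \<cdot> y1) \<oplus> y0 \<cdot> t"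
    using exact_pairD[OF ex(2), of "f1 \<cdot> psi1" Y1 "ident Y1 \<oplus> sig2 \<cdot> y1"] * ty ph ob
    by (auto simp: hom_iff)
  have th: "t \<in> Mor" "dom t = Y1" "cod t = Y0" using t(1) by (auto simp: hom_iff)
  have yy: "y1 \<cdot> y0 = zero Y0 Y2" using ex(2) ty unfolding exact_pair_def by simp
  have "f1 \<cdot> psi1 \<cdot> y0 = (f1 \<cdot> psi1) \<cdot> y0" using ty ph by simp
  also have "\<dots> = y0 \<oplus> y0 \<cdot> t \<cdot> y0" unfolding t(2) using ty th ob yy by simp
  finally have 1: "f1 \<cdot> psi1 \<cdot> y0 = y0 \<oplus> y0 \<cdot> t \<cdot> y0" .
  have "x1 \<cdot> psi1 \<cdot> y0 = (x1 \<cdot> psi1) \<cdot> y0" using ty ph by simp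
  also have "\<dots> = zero Y0 X2" unfolding p(2) using ty yy ob by simp
  finally show thesis using that[OF p(1) t(1) p(2) 1] by simp
qed

text \<open>Reconciles the lift at place 2 with the inverses \<open>g0\<close> and \<open>g1\<close>
  below it. Since \<open>x2 psi2\<close> is kept, the square above remains valid.\<close>

lemma lift_close_up:
  assumes ex: "exact_pair x0 x1" "exact_pair x1 x2" "exact_pair y0 y1"
    and x: "x0 \<in> hom X0 X1" "x1 \<in> hom X1 X2" "x2 \<in> hom X2 X3"
    and y: "y0 \<in> hom Y0 Y1" "y1 \<in> hom Y1 Y2"
    and f: "f0 \<in> hom X0 Y0" "f1 \<in> hom X1 Y1" "f2 \<in> hom X2 Y2" "f1 \<cdot> x0 = y0 \<cdot> f0" "f2 \<cdot> x1 = y1 \<cdot> f1"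
    and g: "g0 \<in> hom Y0 X0" "g1 \<in> hom Y1 X1" "f0 \<cdot> g0 = ident Y0" "g1 \<cdot> f1 = ident X1" "f1 \<cdot> g1 = ident Y1"
    and psi: "psi2 \<in> hom Y2 X2" and sig: "sig2 \<in> hom Y2 Y1"
    and e: "f2 \<cdot> psi2 \<cdot> y1 = y1 \<oplus> y1 \<cdot> sig2 \<cdot> y1" "x2 \<cdot> psi2 \<cdot> y1 = zero Y1 X3"
  obtains psi where "psi \<in> hom Y2 X2" "x2 \<cdot> psi = x2 \<cdot> psi2" "psi \<cdot> y1 = x1 \<cdot> g1" "g1 \<cdot> y0 = x0 \<cdot> g0"
proof -
  have ty: "x0 \<in> Mor" "dom x0 = X0" "cod x0 = X1" "x1 \<in> Mor" "dom x1 = X1" "cod x1 = X2" "x2 \<in> Mor" "dom x2 = X2" "cod x2 = X3"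
    "y0 \<in> Mor" "dom y0 = Y0" "cod y0 = Y1" "y1 \<in> Mor" "dom y1 = Y1" "cod y1 = Y2"
    "f0 \<in> Mor" "dom f0 = X0" "cod f0 = Y0"
    "f1 \<in> Mor" "dom f1 = X1" "cod f1 = Y1" "f2 \<in> Mor" "dom f2 = X2" "cod f2 = Y2"
    "g0 \<in> Mor" "dom g0 = Y0" "cod g0 = X0" "g1 \<in> Mor" "dom g1 = Y1" "cod g1 = X1"
    "psi2 \<in> Mor" "dom psi2 = Y2" "cod psi2 = X2" "sig2 \<in> Mor" "dom sig2 = Y2" "cod sig2 = Y1"
    using x y f g psi sig by (auto simp: hom_iff)
  have ob: "X0 \<in> Ob" "X1 \<in> Ob" "X2 \<in> Ob" "X3 \<in> Ob" "Y0 \<in> Ob" "Y1 \<in> Ob" "Y2 \<in> Ob"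
    using x y hom_ob by blast+
  have xx: "x1 \<cdot> x0 = zero X0 X2" "x2 \<cdot> x1 = zero X1 X3"
    using ex ty unfolding exact_pair_def by simp_all
  have x2x1: "x2 \<cdot> x1 \<cdot> h = zero (dom h) X3" if "h \<in> Mor" "cod h = X1" for h
    using comp_left_cong[OF xx(2) x(2,3), of h "dom h"] that ob by (simp add: hom_iff)
  have x1x0: "x1 \<cdot> x0 \<cdot> h = zero (dom h) X2" if "h \<in> Mor" "cod h = X0" for h
    using comp_left_cong[OF xx(1) x(1,2), of h "dom h"] that ob by (simp add: hom_iff)
  have f2x1: "f2 \<cdot> x1 \<cdot> h = y1 \<cdot> f1 \<cdot> h" if "h \<in> Mor" "cod h = X1" for h
    using comp_left_cong[OF f(5) x(2) f(3), of h "dom h"] that ty by (simp add: hom_iff)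
  have f1g1: "f1 \<cdot> g1 \<cdot> h = h" if "h \<in> Mor" "cod h = Y1" for h
    using comp_left_cong[OF g(5) g(2) f(2), of h "dom h"] that by (simp add: hom_iff)
  have g1f1: "g1 \<cdot> f1 \<cdot> h = h" if "h \<in> Mor" "cod h = X1" for h
    using comp_left_cong[OF g(4) f(2) g(2), of h "dom h"] that by (simp add: hom_iff)
  have "x0 \<cdot> g0 = g1 \<cdot> (f1 \<cdot> x0) \<cdot> g0" using g1f1 ty by simp
  also have "\<dots> = g1 \<cdot> y0 \<cdot> (f0 \<cdot> g0)" unfolding f(4) using ty by simp
  also have "\<dots> = g1 \<cdot> y0" unfolding g(3) using ty by simp
  finally have gy: "g1 \<cdot> y0 = x0 \<cdot> g0" by simp
  \<comment> \<open>The correction is invisible to \<open>x2\<close>, and it removes the error term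
    from \<open>f2 psi2 y1\<close>.\<close>
  define psi where "psi = psi2 \<oplus> neg (x1 \<cdot> g1 \<cdot> sig2)"
  have ph: "psi \<in> Mor" "dom psi = Y2" "cod psi = X2" using ty by (simp_all add: psi_def)
  have x2p: "x2 \<cdot> psi = x2 \<cdot> psi2" using ty ob x2x1 by (simp add: psi_def)
  have "f2 \<cdot> psi \<cdot> y1 = f2 \<cdot> psi2 \<cdot> y1 \<oplus> neg (y1 \<cdot> sig2 \<cdot> y1)"
    using ty f2x1 f1g1 by (simp add: psi_def)
  also have "\<dots> = y1" unfolding e(1) using ty ob by simp
  finally have f2p: "f2 \<cdot> psi \<cdot> y1 = y1" .
  have "x2 \<cdot> psi \<cdot> y1 = (x2 \<cdot> psi) \<cdot> y1" using ty ph by simp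
  also have "\<dots> = zero Y1 X3" unfolding x2p using ty e(2) by simp
  finally have "x2 \<cdot> psi \<cdot> y1 = x2 \<cdot> x1 \<cdot> g1" using x2x1 ty by simp
  then obtain t where t: "t \<in> hom Y1 X1" "psi \<cdot> y1 = x1 \<cdot> g1 \<oplus> x1 \<cdot> t"
    using exact_pairD[OF ex(2), of "psi \<cdot> y1" Y1 "x1 \<cdot> g1"] ty ph by (auto simp: hom_iff)
  have th: "t \<in> Mor" "dom t = Y1" "cod t = X1" using t(1) by (auto simp: hom_iff)
  \<comment> \<open>The remaining discrepancy \<open>x1 t\<close> vanishes:
    \<open>y1 f1 t = 0\<close> lets \<open>f1 t\<close> factor as \<open>y0 u\<close>, so
    \<open>t = g1 y0 u = x0 g0 u\<close>, which \<open>x1\<close> kills.\<close>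
  have "y1 \<oplus> y1 \<cdot> f1 \<cdot> t = f2 \<cdot> (x1 \<cdot> g1 \<oplus> x1 \<cdot> t)" using f2x1 f1g1 ty th g(5) by simp
  also have "\<dots> = y1 \<oplus> zero Y1 Y2" unfolding t(2)[symmetric] f2p using ty by simp
  finally have "y1 \<cdot> f1 \<cdot> t = zero Y1 Y2"
    by (rule plus_left_cancel[rotated -1]) (use ty th ob in auto)
  then obtain u where u: "u \<in> hom Y1 Y0" "y0 \<cdot> u = f1 \<cdot> t"
    using exact_pair_lift[OF ex(3), of "f1 \<cdot> t" Y1] ty th by (auto simp: hom_iff)
  have uh: "u \<in> Mor" "dom u = Y1" "cod u = Y0" using u(1) by (auto simp: hom_iff)
  have "t = g1 \<cdot> y0 \<cdot> u" unfolding u(2) using g1f1 th by simp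
  also have "\<dots> = x0 \<cdot> g0 \<cdot> u"
    using comp_left_cong[OF gy y(1) g(2) u(1)] ty uh by simp
  finally have "x1 \<cdot> t = zero Y1 X2" using x1x0[of "g0 \<cdot> u"] ty uh by simp
  then have "psi \<cdot> y1 = x1 \<cdot> g1" using t(2) ty ob by simp
  then show thesis using that[of psi] ph x2p gy by (simp add: hom_iff)
qed

text \<open>Works on the unrolled sequences, where place \<open>n\<close> with the suspended inverse
  of \<open>phi ! 0\<close> is an ordinary place to start from.\<close>

lemma weak_iso_section:
  assumes X: "nseq X" and Y: "nseq Y" and ex: "is_exact C SO SM n X" "is_exact C SO SM n Y"
    and m: "nmor X Y phi" and iso: "is_iso C (phi ! 0)" "is_iso C (phi ! 1)"
  obtains psi where "nmor Y X psi" "phi ! 0 \<cdot> psi ! 0 = ident (fst Y ! 0)" "phi ! 1 \<cdot> psi ! 1 = ident (fst Y ! 1)"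
proof -
  have n: "0 < n" "1 < n" "2 < n" "n - 1 < n" using n_ge_3 by auto
  obtain g0 where g0: "g0 \<in> hom (fst Y ! 0) (fst X ! 0)" "g0 \<cdot> phi ! 0 = ident (fst X ! 0)" "phi ! 0 \<cdot> g0 = ident (fst Y ! 0)"
    using is_iso_inverse[OF iso(1) nmorD(1)[OF m n(1)]] by blast
  obtain g1 where g1: "g1 \<in> hom (fst Y ! 1) (fst X ! 1)" "g1 \<cdot> phi ! 1 = ident (fst X ! 1)" "phi ! 1 \<cdot> g1 = ident (fst Y ! 1)"
    using is_iso_inverse[OF iso(2) nmorD(1)[OF m n(2)]] by blast
  let ?x = "um X" and ?y = "um Y" and ?f = "um ([], phi)"
  let ?X = "uo X" and ?Y = "uo Y"
  have hx: "?x k \<in> hom (?X k) (?X (k + 1))" and hy: "?y k \<in> hom (?Y k) (?Y (k + 1))"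
    and hf: "?f k \<in> hom (?X k) (?Y k)" and cf: "?f (k + 1) \<cdot> ?x k = ?y k \<cdot> ?f k"
    and ex: "exact_pair (?x k) (?x (k + 1))" and ey: "exact_pair (?y k) (?y (k + 1))" for k
    using um_hom[OF X] um_hom[OF Y] unr_mor_hom[OF m X Y] unr_mor_commute[OF m X Y]
      ex is_exact_iff[OF X] is_exact_iff[OF Y] by blast+
  have perO: "?X (int n) = SO (fst X ! 0)" "?Y (int n) = SO (fst Y ! 0)"
    using uo_period(1)[of X 0] uo_period(1)[of Y 0] nseqD(3)[OF X] nseqD(3)[OF Y] uo_eq[OF n(1)] by auto
  have perM: "?x (int n) = SM (snd X ! 0)" "?y (int n) = SM (snd Y ! 0)" "?f (int n) = SM (phi ! 0)"
    using um_period(1)[of X 0] um_period(1)[of Y 0] um_period(1)[of "([], phi)" 0]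
      nseqD(2)[OF X] nseqD(2)[OF Y] nmorD(2)[OF m] um_eq[OF n(1)] by auto
  have small: "?X 0 = fst X ! 0" "?X 1 = fst X ! 1" "?X 2 = fst X ! 2" "?Y 0 = fst Y ! 0" "?Y 1 = fst Y ! 1" "?Y 2 = fst Y ! 2"
    "?x 0 = snd X ! 0" "?x 1 = snd X ! 1" "?x 2 = snd X ! 2" "?y 0 = snd Y ! 0" "?y 1 = snd Y ! 1" "?y 2 = snd Y ! 2"
    "?f 0 = phi ! 0" "?f 1 = phi ! 1" "?f 2 = phi ! 2"
    using uo_eq[OF n(1)] uo_eq[OF n(2)] uo_eq[OF n(3)] um_eq[OF n(1)] um_eq[OF n(2)] um_eq[OF n(3)] by simp_all
  \<comment> \<open>Here \<open>psi\<close> is the component at place \<open>k + 1\<close>, and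
    \<open>k\<close> is the place of the map of \<open>Y\<close> leading into it.\<close>
  define Q where "Q = (\<lambda>k psi. psi \<in> hom (?Y (k + 1)) (?X (k + 1)) \<and>
    (\<exists>sig \<in> hom (?Y (k + 1)) (?Y k). ?f (k + 1) \<cdot> psi \<cdot> ?y k = ?y k \<oplus> ?y k \<cdot> sig \<cdot> ?y k) \<and>
    ?x (k + 1) \<cdot> psi \<cdot> ?y k = zero (?Y k) (?X (k + 1 + 1)))"
  have step: "\<exists>psi'. Q (k - 1) psi' \<and> ?x k \<cdot> psi' = psi \<cdot> ?y k" if Q: "Q k psi" for k psi
  proof -
    obtain sig where q: "psi \<in> hom (?Y (k + 1)) (?X (k + 1))" "sig \<in> hom (?Y (k + 1)) (?Y k)"
      "?f (k + 1) \<cdot> psi \<cdot> ?y k = ?y k \<oplus> ?y k \<cdot> sig \<cdot> ?y k" "?x (k + 1) \<cdot> psi \<cdot> ?y k = zero (?Y k) (?X (k + 1 + 1))"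
      using Q unfolding Q_def by blast
    obtain psi1 sig1 where "psi1 \<in> hom (?Y k) (?X k)" "sig1 \<in> hom (?Y k) (?Y (k - 1))" "?x k \<cdot> psi1 = psi \<cdot> ?y k"
      "?f k \<cdot> psi1 \<cdot> ?y (k - 1) = ?y (k - 1) \<oplus> ?y (k - 1) \<cdot> sig1 \<cdot> ?y (k - 1)" "?x k \<cdot> psi1 \<cdot> ?y (k - 1) = zero (?Y (k - 1)) (?X (k + 1))"
      using lift_step[OF ex[of k] ey[of "k - 1", simplified] hx[of k] hx[of "k + 1"] hy[of "k - 1", simplified] hy[of k]
        hf[of k] hf[of "k + 1"] cf[of k] q] by blast
    then show ?thesis unfolding Q_def by auto
  qed
  have g0S: "SM g0 \<in> hom (?Y (int n)) (?X (int n))" "SM (phi ! 0) \<cdot> SM g0 = ident (?Y (int n))"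
  proof -
    show "SM g0 \<in> hom (?Y (int n)) (?X (int n))" unfolding perO by (rule SM_hom[OF g0(1)])
    have "SM (phi ! 0) \<cdot> SM g0 = SM (phi ! 0 \<cdot> g0)"
      using g0(1) nmorD(2-4)[OF m n(1)] by (intro SM_comp[symmetric]) (auto simp: hom_iff)
    then show "SM (phi ! 0) \<cdot> SM g0 = ident (?Y (int n))"
      unfolding g0(3) perO using nseqD(3)[OF Y n(1)] by simp
  qed
  have n1: "int n - 1 + 1 = int n" by simp
  have gy: "g1 \<cdot> snd Y ! 0 = snd X ! 0 \<cdot> g0"
  proof -
    note h = g0(1)[unfolded hom_iff] g1(1)[unfolded hom_iff] nseqD(2,4,5)[OF X n(1), unfolded next_obj_small]
      nseqD(2,4,5)[OF Y n(1), unfolded next_obj_small] nmorD(2-4)[OF m n(1)] nmorD(2-4)[OF m n(2)]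
    have c: "phi ! 1 \<cdot> snd X ! 0 = snd Y ! 0 \<cdot> phi ! 0" using cf[of 0] by (simp add: small)
    have "snd X ! 0 \<cdot> g0 = (g1 \<cdot> phi ! 1) \<cdot> snd X ! 0 \<cdot> g0" unfolding g1(2) using h by simp
    also have "\<dots> = g1 \<cdot> (phi ! 1 \<cdot> snd X ! 0) \<cdot> g0" using h by simp
    also have "\<dots> = g1 \<cdot> snd Y ! 0 \<cdot> (phi ! 0 \<cdot> g0)" unfolding c using h by simp
    also have "\<dots> = g1 \<cdot> snd Y ! 0" unfolding g0(3) using h by simp
    finally show ?thesis by simp
  qed
  \<comment> \<open>The error term is zero at place \<open>n\<close>, where \<open>SM g0\<close> is
    an exact inverse. The second condition follows by suspending \<open>gy\<close>, which turns the
    composite into \<open>SM g1\<close> after two consecutive maps of \<open>Y\<close>.\<close>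
  have base: "Q (int n - 1) (SM g0)"
  proof -
    have hyn: "?y (int n - 1) \<in> Mor" "dom (?y (int n - 1)) = ?Y (int n - 1)" "cod (?y (int n - 1)) = ?Y (int n)"
      using hy[of "int n - 1"] by (auto simp: hom_iff)
    have ob: "?Y (int n - 1) \<in> Ob" "?Y (int n) \<in> Ob" using uo_ob[OF Y] by blast+
    have hfn: "?f (int n) \<in> Mor" "dom (?f (int n)) = ?X (int n)" "cod (?f (int n)) = ?Y (int n)"
      using hf[of "int n"] by (auto simp: hom_iff)
    have "?f (int n) \<cdot> SM g0 \<cdot> ?y (int n - 1) = (?f (int n) \<cdot> SM g0) \<cdot> ?y (int n - 1)"
      using g0S(1) hyn hfn by (simp add: hom_iff)
    also have "\<dots> = ?y (int n - 1) \<oplus> ?y (int n - 1) \<cdot> zero (?Y (int n)) (?Y (int n - 1)) \<cdot> ?y (int n - 1)"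
      unfolding perM g0S(2) using hyn ob by simp
    finally have 1: "?f (int n) \<cdot> SM g0 \<cdot> ?y (int n - 1) =
      ?y (int n - 1) \<oplus> ?y (int n - 1) \<cdot> zero (?Y (int n)) (?Y (int n - 1)) \<cdot> ?y (int n - 1)" .
    have g1S: "SM g1 \<in> hom (SO (fst Y ! 1)) (SO (fst X ! 1))" by (rule SM_hom[OF g1(1)])
    have c: "SM (snd X ! 0) \<cdot> SM g0 = SM g1 \<cdot> ?y (int n)"
    proof -
      have "SM (snd X ! 0) \<cdot> SM g0 = SM (snd X ! 0 \<cdot> g0)"
        using g0(1) nseqD[OF X n(1)] by (intro SM_comp[symmetric]) (auto simp: hom_iff)
      also have "\<dots> = SM g1 \<cdot> SM (snd Y ! 0)" unfolding gy[symmetric]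
        using g1(1) nseqD[OF Y n(1)] by (intro SM_comp) (auto simp: hom_iff next_obj_small)
      finally show ?thesis unfolding perM .
    qed
    have hn: "?y (int n) \<in> Mor" "dom (?y (int n)) = ?Y (int n)" "cod (?y (int n)) = SO (fst Y ! 1)"
      using hy[of "int n"] nseqD[OF Y n(1)] unfolding perM by (auto simp: hom_iff next_obj_small)
    have xn: "?x (int n) \<in> Mor" "dom (?x (int n)) = ?X (int n)" "cod (?x (int n)) = SO (fst X ! 1)" "?X (int n + 1) = SO (fst X ! 1)"
      using hx[of "int n"] nseqD[OF X n(1)] unfolding perM by (auto simp: hom_iff next_obj_small)
    have yy: "?y (int n) \<cdot> ?y (int n - 1) = zero (?Y (int n - 1)) (SO (fst Y ! 1))"
      using ey[of "int n - 1"] hyn hn unfolding exact_pair_def n1 by simp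
    have "?x (int n) \<cdot> SM g0 \<cdot> ?y (int n - 1) = (?x (int n) \<cdot> SM g0) \<cdot> ?y (int n - 1)"
      using g0S(1) hyn xn by (simp add: hom_iff)
    also have "\<dots> = SM g1 \<cdot> ?y (int n) \<cdot> ?y (int n - 1)"
      unfolding perM(1) c using g1S hn hyn by (simp add: hom_iff)
    also have "\<dots> = zero (?Y (int n - 1)) (SO (fst X ! 1))"
      unfolding yy using g1S ob by (simp add: hom_iff)
    finally have 2: "?x (int n) \<cdot> SM g0 \<cdot> ?y (int n - 1) = zero (?Y (int n - 1)) (SO (fst X ! 1))" .
    show ?thesis unfolding Q_def n1 xn(4) using g0S(1) 1 2 zero_hom[OF ob(2,1)] by blast
  qed
  \<comment> \<open>\<open>F i\<close> is the component at place \<open>n - i\<close>. The choice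
    continues forever, but only places 2 to \<open>n\<close> enter.\<close>
  have "\<exists>F. \<forall>i. (Q (int n - 1 - int i) (F i) \<and> (i = 0 \<longrightarrow> F i = SM g0)) \<and>
    ?x (int n - 1 - int i) \<cdot> F (Suc i) = F i \<cdot> ?y (int n - 1 - int i)"
  proof (rule dependent_nat_choice)
    show "\<exists>psi. Q (int n - 1 - int 0) psi \<and> (0 = (0 :: nat) \<longrightarrow> psi = SM g0)" using base by auto
    show "\<exists>psi'. (Q (int n - 1 - int (Suc i)) psi' \<and> (Suc i = 0 \<longrightarrow> psi' = SM g0)) \<and>
      ?x (int n - 1 - int i) \<cdot> psi' = psi \<cdot> ?y (int n - 1 - int i)"
      if "Q (int n - 1 - int i) psi \<and> (i = 0 \<longrightarrow> psi = SM g0)" for psi i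
      using step[of "int n - 1 - int i" psi] that by (simp add: algebra_simps)
  qed
  then obtain F where F: "\<And>i. Q (int n - 1 - int i) (F i)" "F 0 = SM g0"
    "\<And>i. ?x (int n - 1 - int i) \<cdot> F (Suc i) = F i \<cdot> ?y (int n - 1 - int i)" by blast
  define psi where "psi = (\<lambda>k. F (n - k))"
  have pQ: "Q (int k - 1) (psi k)" if "k \<le> n" for k
    using F(1)[of "n - k"] that by (simp add: psi_def)
  have pn: "psi n = SM g0" using F(2) by (simp add: psi_def)
  have pc: "?x (int k) \<cdot> psi k = psi (Suc k) \<cdot> ?y (int k)" if "k < n" for k
  proof -
    have "Suc (n - Suc k) = n - k" "int n - 1 - int (n - Suc k) = int k" using that by auto
    then show ?thesis using F(3)[of "n - Suc k"] by (simp add: psi_def)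
  qed
  obtain sig where q: "psi 2 \<in> hom (?Y 2) (?X 2)" "sig \<in> hom (?Y 2) (?Y 1)"
    "?f 2 \<cdot> psi 2 \<cdot> ?y 1 = ?y 1 \<oplus> ?y 1 \<cdot> sig \<cdot> ?y 1" "?x 2 \<cdot> psi 2 \<cdot> ?y 1 = zero (?Y 1) (?X 3)"
    using pQ[of 2] n unfolding Q_def by auto
  \<comment> \<open>\<open>p2\<close> replaces \<open>psi 2\<close>: it keeps the square towards
    place 3 and fits \<open>g1\<close> below.\<close>
  obtain p2 where p2: "p2 \<in> hom (?Y 2) (?X 2)" "?x 2 \<cdot> p2 = ?x 2 \<cdot> psi 2" "p2 \<cdot> ?y 1 = ?x 1 \<cdot> g1"
  proof (rule lift_close_up[of "?x 0" "?x 1" "?x 2" "?y 0" "?y 1" "?X 0" "?X 1" "?X 2" "?X 3" "?Y 0" "?Y 1" "?Y 2"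
        "?f 0" "?f 1" "?f 2" g0 g1 "psi 2" sig])
    show "exact_pair (?x 0) (?x 1)" "exact_pair (?x 1) (?x 2)" "exact_pair (?y 0) (?y 1)"
      using ex[of 0] ex[of 1] ey[of 0] by simp_all
    show "?x 0 \<in> hom (?X 0) (?X 1)" "?x 1 \<in> hom (?X 1) (?X 2)" "?x 2 \<in> hom (?X 2) (?X 3)"
      "?y 0 \<in> hom (?Y 0) (?Y 1)" "?y 1 \<in> hom (?Y 1) (?Y 2)"
      using hx[of 0] hx[of 1] hx[of 2] hy[of 0] hy[of 1] by simp_all
    show "?f 1 \<cdot> ?x 0 = ?y 0 \<cdot> ?f 0" "?f 2 \<cdot> ?x 1 = ?y 1 \<cdot> ?f 1" using cf[of 0] cf[of 1] by simp_all
    show "g0 \<in> hom (?Y 0) (?X 0)" "g1 \<in> hom (?Y 1) (?X 1)" "?f 0 \<cdot> g0 = ident (?Y 0)"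
      "g1 \<cdot> ?f 1 = ident (?X 1)" "?f 1 \<cdot> g1 = ident (?Y 1)"
      unfolding small by (fact g0 g1)+
  qed (use hf q that in auto)
  define r where "r = (\<lambda>k :: nat. if k = 0 then g0 else if k = 1 then g1 else if k = 2 then p2 else psi k)"
  let ?r = "map r [0..<n]"
  have r: "r k \<in> hom (fst Y ! k) (fst X ! k)" if "k < n" for k
    using pQ[of k] that g0(1) g1(1) p2(1) unfolding Q_def r_def small by (auto simp: uo_eq)
  \<comment> \<open>The wrap-around fits because the lifting started from \<open>SM g0\<close>, the
    suspension of the component chosen at place 0.\<close>
  have nr: "next_mor ?r k = (if k = 0 then g1 else if k = 1 then p2 else psi (Suc k))" if "k < n" for k
  proof (cases "Suc k < n")
    case False
    then have "Suc k = n" using that by simp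
    then have "psi (Suc k) = SM g0" using pn by simp
    then show ?thesis using False n that by (auto simp: next_mor_map r_def)
  qed (use that in \<open>auto simp: next_mor_map r_def\<close>)
  have "next_mor ?r k \<cdot> snd Y ! k = snd X ! k \<cdot> r k" if k: "k < n" for k
  proof -
    consider "k = 0" | "k = 1" | "k = 2" | "3 \<le> k" by linarith
    then show ?thesis
    proof cases
      case 1
      then show ?thesis using nr[OF k] gy by (simp add: r_def)
    next
      case 2
      have "p2 \<cdot> snd Y ! 1 = snd X ! 1 \<cdot> g1" using p2(3) unfolding small .
      then show ?thesis using 2 nr[OF k] by (simp add: r_def)
    next
      case 3
      have "snd X ! 2 \<cdot> p2 = psi (Suc 2) \<cdot> snd Y ! 2" using p2(2) pc[OF n(3)] by (simp add: small)
      then show ?thesis using 3 nr[OF k] by (simp add: r_def)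
    next
      case 4
      then show ?thesis using nr[OF k] pc[OF k] k by (simp add: r_def um_eq)
    qed
  qed
  then have "nmor Y X ?r" unfolding nmor_iff using r by simp
  moreover have "?r ! 0 = g0" "?r ! 1 = g1" using n by (simp_all add: r_def)
  ultimately show thesis using that[of ?r] g0(3) g1(3) by metis
qed

section \<open>Weak isomorphisms at an arbitrary place and the equivalence\<close>

lemma weak_iso_start_mem:
  assumes sub: "\<forall>X \<in> N. nseq X" and N1: "N1 C SO SM n N" and N2: "N2 C SO SM n N"
    and X: "X \<in> N" and Y: "nseq Y" and ex: "is_exact C SO SM n X" "is_exact C SO SM n Y"
    and m: "nmor X Y phi" and iso: "is_iso C (phi ! 0)" "is_iso C (phi ! 1)"
  shows "Y \<in> N"
proof -
  obtain psi where psi: "nmor Y X psi" "phi ! 0 \<cdot> psi ! 0 = ident (fst Y ! 0)" "phi ! 1 \<cdot> psi ! 1 = ident (fst Y ! 1)"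
    using weak_iso_section[OF _ Y ex m iso] sub X by blast
  have "factors N Y (\<lambda>j. phi ! j \<cdot> psi ! j)"
    unfolding factors_def using X psi(1) m by blast
  then show ?thesis by (rule mem_of_factors_weak[OF sub N1 N2 Y ex(2)]) (fact psi)+
qed

lemma nmor_left_rot:
  assumes X: "nseq X" and Y: "nseq Y" and m: "nmor X Y phi"
  shows "nmor (L X) (L Y) (map (next_mor phi) [0..<n])" (is "nmor _ _ ?r")
proof -
  have n: "0 < n" "1 < n" using n_ge_3 by auto
  have "next_mor ?r j \<cdot> snd (L X) ! j = snd (L Y) ! j \<cdot> next_mor phi j" if j: "j < n" for j
  proof (cases "Suc j < n")
    case True
    then have "snd (L X) ! j = snd X ! Suc j" "snd (L Y) ! j = snd Y ! Suc j" "next_mor phi j = phi ! Suc j"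
      "next_mor ?r j = next_mor phi (Suc j)"
      using nth_left_rot(2)[OF X j] nth_left_rot(2)[OF Y j] by (simp_all add: next_mor_def)
    then show ?thesis using nmorD(5)[OF m True] by simp
  next
    case False
    then have e: "snd (L X) ! j = rot_sign (SM (snd X ! 0))" "snd (L Y) ! j = rot_sign (SM (snd Y ! 0))"
      "next_mor phi j = SM (phi ! 0)" "next_mor ?r j = SM (next_mor phi 0)"
      using nth_left_rot(2)[OF X j] nth_left_rot(2)[OF Y j] j by (simp_all add: next_mor_def)
    have "SM (next_mor phi 0 \<cdot> snd X ! 0) = SM (snd Y ! 0 \<cdot> phi ! 0)" using nmorD(5)[OF m n(1)] by simp
    then have "SM (next_mor phi 0) \<cdot> SM (snd X ! 0) = SM (snd Y ! 0) \<cdot> SM (phi ! 0)"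
      using nmorD[OF m n(1)] nseqD[OF X n(1)] nseqD[OF Y n(1)] by (metis SM_comp)
    then show ?thesis unfolding e
      using nmorD(2-4,7-9)[OF m n(1)] nseqD[OF X n(1)] nseqD[OF Y n(1)] by simp
  qed
  moreover have "next_mor phi j \<in> hom (fst (L X) ! j) (fst (L Y) ! j)" if "j < n" for j
    using nmorD(6)[OF m that] nth_left_rot(1)[OF X that] nth_left_rot(1)[OF Y that] by simp
  ultimately show ?thesis unfolding nmor_iff by simp
qed

text \<open>\<open>j\<close> rotations bring the two invertible components to places 0 and 1; (N2)
  is read backwards to return from \<open>L Y\<close> to \<open>Y\<close>.\<close>

lemma weak_iso_mem:
  assumes sub: "\<forall>X \<in> N. nseq X" and N1: "N1 C SO SM n N" and N2: "N2 C SO SM n N"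
    and "X \<in> N" "nseq Y" "is_exact C SO SM n X" "is_exact C SO SM n Y"
    and "nmor X Y phi" "j < n" "is_iso C (phi ! j)" "is_iso C (next_mor phi j)"
  shows "Y \<in> N"
  using assms(4-)
proof (induction j arbitrary: X Y phi)
  case 0
  then show ?case using weak_iso_start_mem[OF sub N1 N2, of X Y phi] by (simp add: next_mor_small)
next
  case (Suc j)
  have X: "nseq X" using sub Suc.prems by blast
  have j: "j < n" "Suc j < n" using Suc.prems by auto
  let ?r = "map (next_mor phi) [0..<n]"
  have "L X \<in> N" using N2 X Suc.prems(1) unfolding N2_def by blast
  moreover have "is_iso C (?r ! j)" "is_iso C (next_mor ?r j)"
    using Suc.prems j by (simp_all add: next_mor_def)
  ultimately have "L Y \<in> N"
    using Suc.IH[of "L X" "L Y" ?r] nseq_left_rot is_exact_left_rot[OF X] is_exact_left_rot[OF Suc.prems(2)]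
      nmor_left_rot[OF X Suc.prems(2,5)] Suc.prems j by blast
  then show ?case using N2 Suc.prems(2) unfolding N2_def by blast
qed

lemma N1star_of_N1:
  assumes sub: "\<forall>X \<in> N. nseq X" and N1: "N1 C SO SM n N" and N2: "N2 C SO SM n N"
  shows "N1star C SO SM n N"
proof -
  have "Y \<in> N" if "nseq Y" "is_exact C SO SM n X" "is_exact C SO SM n Y"
    "is_nseq_weak_iso C SO SM n X Y phi" "X \<in> N" for X Y phi
    using that weak_iso_mem[OF sub N1 N2 that(5,1-3)] unfolding is_nseq_weak_iso_def next_mor_def
    by (metis Suc_eq_plus1)
  then show ?thesis using N1 unfolding N1star_def N1_def by blast
qed

lemma N2star_of_N2: "\<forall>X \<in> N. nseq X \<Longrightarrow> N2 C SO SM n N \<Longrightarrow> N2star C SO SM n N"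
  unfolding N2_def N2star_def by blast

end

theorem theorem3p4:
  fixes C :: "('o, 'm) addcat" and SO :: "'o \<Rightarrow> 'o" and SM :: "'m \<Rightarrow> 'm"
    and n :: nat and N :: "('o, 'm) nseq set"
  assumes "is_additive_category C"
    and "is_automorphism C SO SM"
    and "3 \<le> n"
    and "\<forall>X \<in> N. is_nseq C SO n X"
  shows "((N1 C SO SM n N \<and> N2 C SO SM n N \<and> N3 C SO SM n N) \<longleftrightarrow>
          (N1star C SO SM n N \<and> N2 C SO SM n N \<and> N3 C SO SM n N)) \<and>
         ((N1star C SO SM n N \<and> N2 C SO SM n N \<and> N3 C SO SM n N) \<longleftrightarrow>
          (N1star C SO SM n N \<and> N2star C SO SM n N \<and> N3 C SO SM n N))"
proof -
  interpret suspended_category C SO SM n by unfold_locales (fact assms)+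
  note sub = assms(4)
  have "N1 C SO SM n N" if "N1star C SO SM n N" "N2 C SO SM n N" "N3 C SO SM n N"
    using N1a_of_N1star[OF sub that(1) N2star_of_N2[OF sub that(2)] that(3)] that(1)
    unfolding N1_def N1star_def by blast
  then show ?thesis
    using N1star_of_N1[OF sub] N2_of_N2star[OF sub] N2star_of_N2[OF sub] by blast
qed

end
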